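(* Let $M(z)$ be a singular Weyl $m$-function of $H$ and $\rho$ its associated spectral measure. Then there exists an entire function $g(z)$ such that $g(\lambda)\ge0$ for $\lambda\in\mathbb{R}$ and $e^{-g(\lambda)}\in L^2(\mathbb{R},d\rho)$. Moreover, for any entire function $\hat g(z)$ such that $\hat g(\lambda)>0$ for $\lambda\in\mathbb{R}$ and $(1+\lambda^2)^{-1}\hat g(\lambda)^{-1}\in L^1(\mathbb{R},d\rho)$ (e.g. $\hat g(z)=e^{2g(z)}$) one has the integral representation $$M(z)=E(z)+\hat g(z)\int_{\mathbb{R}}\left(\frac{1}{\lambda-z}-\frac{\lambda}{1+\lambda^2}\right)\frac{d\rho(\lambda)}{\hat g(\lambda)},\qquad z\in\mathbb{C}\setminus\sigma(H),$$ where $E(z)$ is a real entire function (i.e. entire and real-valued on $\mathbb{R}$).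
   Context: Let $-\infty\le a<b\le\infty$, let $q\in L^1_{\mathrm{loc}}(a,b)$ be real-valued, $\tau=-\frac{d^2}{dx^2}+q$, and let $H$ be a self-adjoint operator in $L^2(a,b)$ associated with $\tau$ with separated boundary conditions at $a$ and/or $b$. A solution lies in the domain of $H$ near an endpoint if it is square integrable near it and satisfies the boundary condition of $H$ there in case $\tau$ is limit circle at that endpoint. Standing assumption: the restriction $H^D_{(a,c)}$ of $H$ to $(a,c)$ with a Dirichlet condition at $c$ has purely discrete spectrum for one (hence all) $c\in(a,b)$. Then there are real entire (in $z$, real for real $z$) solutions $\phi(z,x)$, $\theta(z,x)$ of $\tau u=zu$ with $\phi(z,\cdot)$ in the domain of $H$ near $a$ and Wronskian $W(\theta(z),\phi(z))=\theta\phi'-\theta'\phi=1$. Fixing such a system, the singular Weyl $m$-function $M(z)$, $z\in\mathbb{C}\setminus\sigma(H)$, is defined by requiring that $\theta(z,x)+M(z)\phi(z,x)$ lie in the domain of $H$ near $b$. The associated spectral measure $\rho$ is the Borel measure on $\mathbb{R}$ with $\frac12\big(\rho((\lambda_0,\lambda_1))+\rho([\lambda_0,\lambda_1])\big)=\lim_{\varepsilon\downarrow0}\frac1\pi\int_{\lambda_0}^{\lambda_1}\operatorname{Im}M(\lambda+i\varepsilon)\,d\lambda$ for all $\lambda_0<\lambda_1$. *)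

theory Defs
  imports "HOL-Complex_Analysis.Complex_Analysis"
begin

section \<open>Unbounded operators in a complex $L^2$ space\<close>

text \<open>
  An element of \<open>L\<^sup>2(M)\<close> is represented by a function, and an operator by its graph, a set of
  pairs of such functions. All graphs used below are closed under change of either component on a
  null set, so that they correspond to relations between almost-everywhere classes.
\<close>

definition square_integrable :: "'x measure \<Rightarrow> ('x \<Rightarrow> complex) \<Rightarrow> bool" where
  "square_integrable M f \<longleftrightarrow>
     f \<in> borel_measurable M \<and> integrable M (\<lambda>x. (norm (f x))\<^sup>2)"

definition l2_inner :: "'x measure \<Rightarrow> ('x \<Rightarrow> complex) \<Rightarrow> ('x \<Rightarrow> complex) \<Rightarrow> complex" where
  "l2_inner M f g = (LINT x|M. cnj (f x) * g x)"

definition l2_norm :: "'x measure \<Rightarrow> ('x \<Rightarrow> complex) \<Rightarrow> real" where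
  "l2_norm M f = sqrt (LINT x|M. (norm (f x))\<^sup>2)"

type_synonym 'x operator = "(('x \<Rightarrow> complex) \<times> ('x \<Rightarrow> complex)) set"

definition densely_defined :: "'x measure \<Rightarrow> 'x operator \<Rightarrow> bool" where
  "densely_defined M T \<longleftrightarrow>
     (\<forall>g \<epsilon>. square_integrable M g \<and> \<epsilon> > 0 \<longrightarrow>
        (\<exists>(f, h)\<in>T. l2_norm M (\<lambda>x. g x - f x) < \<epsilon>))"

definition adjoint_operator :: "'x measure \<Rightarrow> 'x operator \<Rightarrow> 'x operator" where
  "adjoint_operator M T =
     {(g, k). square_integrable M g \<and> square_integrable M k \<and>
              (\<forall>(f, h)\<in>T. l2_inner M g h = l2_inner M k f)}"

definition self_adjoint_operator :: "'x measure \<Rightarrow> 'x operator \<Rightarrow> bool" where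
  "self_adjoint_operator M T \<longleftrightarrow> densely_defined M T \<and> adjoint_operator M T = T"

text \<open>
  \<open>z\<close> is in the resolvent set iff \<open>T - z\<close> maps its domain onto \<open>L\<^sup>2(M)\<close> and has a bounded
  inverse; the norm bound below contains the injectivity of \<open>T - z\<close>.
\<close>
definition resolvent_set :: "'x measure \<Rightarrow> 'x operator \<Rightarrow> complex set" where
  "resolvent_set M T =
     {z. (\<forall>k. square_integrable M k \<longrightarrow> (\<exists>(f, h)\<in>T. AE x in M. h x - z * f x = k x)) \<and>
         (\<exists>C. \<forall>(f, h)\<in>T. l2_norm M f \<le> C * l2_norm M (\<lambda>x. h x - z * f x))}"

definition op_spectrum :: "'x measure \<Rightarrow> 'x operator \<Rightarrow> complex set" where
  "op_spectrum M T = - resolvent_set M T"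

definition eigenspace :: "'x measure \<Rightarrow> 'x operator \<Rightarrow> complex \<Rightarrow> ('x \<Rightarrow> complex) set" where
  "eigenspace M T z = {f. \<exists>h. (f, h) \<in> T \<and> (AE x in M. h x = z * f x)}"

definition finite_mult_eigenvalue :: "'x measure \<Rightarrow> 'x operator \<Rightarrow> complex \<Rightarrow> bool" where
  "finite_mult_eigenvalue M T z \<longleftrightarrow>
     (\<exists>f\<in>eigenspace M T z. \<not> (AE x in M. f x = 0)) \<and>
     (\<exists>B. finite B \<and>
        (\<forall>f\<in>eigenspace M T z. \<exists>c. AE x in M. f x = (\<Sum>e\<in>B. c e * e x)))"

definition purely_discrete_spectrum :: "'x measure \<Rightarrow> 'x operator \<Rightarrow> bool" where
  "purely_discrete_spectrum M T \<longleftrightarrow>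
     (\<forall>z\<in>op_spectrum M T. z isolated_in op_spectrum M T \<and> finite_mult_eigenvalue M T z)"


section \<open>The differential expression $-u'' + q u$ on $(a,b)$\<close>

abbreviation lebesgue_ival :: "ereal \<Rightarrow> ereal \<Rightarrow> real measure" where
  "lebesgue_ival a b \<equiv> lebesgue_on (einterval a b)"

definition locally_integrable :: "ereal \<Rightarrow> ereal \<Rightarrow> (real \<Rightarrow> 'e::euclidean_space) \<Rightarrow> bool" where
  "locally_integrable a b f \<longleftrightarrow>
     (\<forall>c d. a < ereal c \<longrightarrow> ereal d < b \<longrightarrow> f absolutely_integrable_on {c..d})"

text \<open>
  \<open>f\<close> is locally absolutely continuous on \<open>(a,b)\<close> with derivative \<open>g\<close> (almost everywhere), i.e.
  \<open>f\<close> is an indefinite integral of the locally integrable function \<open>g\<close>.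
\<close>
definition ac_derivative ::
    "ereal \<Rightarrow> ereal \<Rightarrow> (real \<Rightarrow> complex) \<Rightarrow> (real \<Rightarrow> complex) \<Rightarrow> bool" where
  "ac_derivative a b f g \<longleftrightarrow>
     locally_integrable a b g \<and>
     (\<forall>c d. a < ereal c \<longrightarrow> c \<le> d \<longrightarrow> ereal d < b \<longrightarrow> (g has_integral (f d - f c)) {c..d})"

abbreviation D1 :: "(real \<Rightarrow> complex) \<Rightarrow> real \<Rightarrow> complex" where
  "D1 f \<equiv> (\<lambda>x. vector_derivative f (at x))"

text \<open>
  \<open>u\<close> and \<open>u'\<close> are locally absolutely continuous on \<open>(a,b)\<close> and \<open>- u'' + q u = h\<close> almost
  everywhere. As \<open>D1 u\<close> is then continuous, it is the classical derivative of \<open>u\<close>; \<open>u2\<close> is \<open>u''\<close>,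
  which is determined up to a null set.
\<close>
definition tau_eq ::
    "ereal \<Rightarrow> ereal \<Rightarrow> (real \<Rightarrow> real) \<Rightarrow> (real \<Rightarrow> complex) \<Rightarrow> (real \<Rightarrow> complex) \<Rightarrow> bool" where
  "tau_eq a b q u h \<longleftrightarrow>
     ac_derivative a b u (D1 u) \<and>
     (\<exists>u2. ac_derivative a b (D1 u) u2 \<and>
        (AE x in lebesgue_ival a b. - u2 x + complex_of_real (q x) * u x = h x))"

definition tau_solution ::
    "ereal \<Rightarrow> ereal \<Rightarrow> (real \<Rightarrow> real) \<Rightarrow> complex \<Rightarrow> (real \<Rightarrow> complex) \<Rightarrow> bool" where
  "tau_solution a b q z u \<longleftrightarrow> tau_eq a b q u (\<lambda>x. z * u x)"

definition wronskian :: "(real \<Rightarrow> complex) \<Rightarrow> (real \<Rightarrow> complex) \<Rightarrow> real \<Rightarrow> complex" where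
  "wronskian f g x = f x * D1 g x - D1 f x * g x"

definition max_domain :: "ereal \<Rightarrow> ereal \<Rightarrow> (real \<Rightarrow> real) \<Rightarrow> (real \<Rightarrow> complex) set" where
  "max_domain a b q =
     {u. square_integrable (lebesgue_ival a b) u \<and>
         (\<exists>h. square_integrable (lebesgue_ival a b) h \<and> tau_eq a b q u h)}"


section \<open>Endpoint behaviour and boundary conditions\<close>

text \<open>The limits of $W_x(f,g)$ as $x$ tends to $a$ from the right or to $b$ from the left.\<close>

definition wronskian_left :: "ereal \<Rightarrow> (real \<Rightarrow> complex) \<Rightarrow> (real \<Rightarrow> complex) \<Rightarrow> complex \<Rightarrow> bool" where
  "wronskian_left a f g l \<longleftrightarrow> ((\<lambda>x. wronskian f g (real_of_ereal x)) \<longlongrightarrow> l) (at_right a)"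

definition wronskian_right :: "ereal \<Rightarrow> (real \<Rightarrow> complex) \<Rightarrow> (real \<Rightarrow> complex) \<Rightarrow> complex \<Rightarrow> bool" where
  "wronskian_right b f g l \<longleftrightarrow> ((\<lambda>x. wronskian f g (real_of_ereal x)) \<longlongrightarrow> l) (at_left b)"

definition sq_int_near_left :: "ereal \<Rightarrow> ereal \<Rightarrow> (real \<Rightarrow> complex) \<Rightarrow> bool" where
  "sq_int_near_left a b u \<longleftrightarrow>
     (\<exists>c. a < ereal c \<and> ereal c < b \<and> square_integrable (lebesgue_ival a (ereal c)) u)"

definition sq_int_near_right :: "ereal \<Rightarrow> ereal \<Rightarrow> (real \<Rightarrow> complex) \<Rightarrow> bool" where
  "sq_int_near_right a b u \<longleftrightarrow>
     (\<exists>c. a < ereal c \<and> ereal c < b \<and> square_integrable (lebesgue_ival (ereal c) b) u)"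

definition limit_circle_left :: "ereal \<Rightarrow> ereal \<Rightarrow> (real \<Rightarrow> real) \<Rightarrow> bool" where
  "limit_circle_left a b q \<longleftrightarrow> (\<forall>z u. tau_solution a b q z u \<longrightarrow> sq_int_near_left a b u)"

definition limit_circle_right :: "ereal \<Rightarrow> ereal \<Rightarrow> (real \<Rightarrow> real) \<Rightarrow> bool" where
  "limit_circle_right a b q \<longleftrightarrow> (\<forall>z u. tau_solution a b q z u \<longrightarrow> sq_int_near_right a b u)"

text \<open>
  A separated boundary condition at a limit circle endpoint is $W_a(v,u) = 0$, where $v$ is in the
  maximal domain with $W_a(\overline{v},v) = 0$ and $W_a(v,f) \neq 0$ for some $f$ in the maximal
  domain. No condition is imposed at a limit point endpoint, where $v$ is irrelevant.
\<close>

definition bc_function_left :: "ereal \<Rightarrow> ereal \<Rightarrow> (real \<Rightarrow> real) \<Rightarrow> (real \<Rightarrow> complex) \<Rightarrow> bool" where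
  "bc_function_left a b q v \<longleftrightarrow>
     (limit_circle_left a b q \<longrightarrow>
        v \<in> max_domain a b q \<and> wronskian_left a (\<lambda>x. cnj (v x)) v 0 \<and>
        (\<exists>f\<in>max_domain a b q. \<exists>l. l \<noteq> 0 \<and> wronskian_left a v f l))"

definition bc_function_right :: "ereal \<Rightarrow> ereal \<Rightarrow> (real \<Rightarrow> real) \<Rightarrow> (real \<Rightarrow> complex) \<Rightarrow> bool" where
  "bc_function_right a b q w \<longleftrightarrow>
     (limit_circle_right a b q \<longrightarrow>
        w \<in> max_domain a b q \<and> wronskian_right b (\<lambda>x. cnj (w x)) w 0 \<and>
        (\<exists>f\<in>max_domain a b q. \<exists>l. l \<noteq> 0 \<and> wronskian_right b w f l))"

definition bc_left ::
    "ereal \<Rightarrow> ereal \<Rightarrow> (real \<Rightarrow> real) \<Rightarrow> (real \<Rightarrow> complex) \<Rightarrow> (real \<Rightarrow> complex) \<Rightarrow> bool" where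
  "bc_left a b q v u \<longleftrightarrow> (limit_circle_left a b q \<longrightarrow> wronskian_left a v u 0)"

definition bc_right ::
    "ereal \<Rightarrow> ereal \<Rightarrow> (real \<Rightarrow> real) \<Rightarrow> (real \<Rightarrow> complex) \<Rightarrow> (real \<Rightarrow> complex) \<Rightarrow> bool" where
  "bc_right a b q w u \<longleftrightarrow> (limit_circle_right a b q \<longrightarrow> wronskian_right b w u 0)"

text \<open>
  The realisation of the differential expression in \<open>L\<^sup>2(a,b)\<close> with boundary conditions \<open>A\<close> at
  \<open>a\<close> and \<open>B\<close> at \<open>b\<close>; here \<open>u\<close> is the continuously differentiable representative of \<open>f\<close>.
\<close>
definition sl_realisation ::
    "ereal \<Rightarrow> ereal \<Rightarrow> (real \<Rightarrow> real) \<Rightarrow> ((real \<Rightarrow> complex) \<Rightarrow> bool) \<Rightarrow> ((real \<Rightarrow> complex) \<Rightarrow> bool)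
      \<Rightarrow> real operator" where
  "sl_realisation a b q A B =
     {(f, h). square_integrable (lebesgue_ival a b) f \<and> square_integrable (lebesgue_ival a b) h \<and>
        (\<exists>u. (AE x in lebesgue_ival a b. u x = f x) \<and> tau_eq a b q u h \<and> A u \<and> B u)}"

definition sl_operator ::
    "ereal \<Rightarrow> ereal \<Rightarrow> (real \<Rightarrow> real) \<Rightarrow> (real \<Rightarrow> complex) \<Rightarrow> (real \<Rightarrow> complex) \<Rightarrow> real operator" where
  "sl_operator a b q v w = sl_realisation a b q (bc_left a b q v) (bc_right a b q w)"

text \<open>The restriction of \<open>sl_operator a b q v w\<close> to \<open>(a,c)\<close> with a Dirichlet condition at \<open>c\<close>.\<close>
definition sl_dirichlet ::
    "ereal \<Rightarrow> ereal \<Rightarrow> (real \<Rightarrow> real) \<Rightarrow> (real \<Rightarrow> complex) \<Rightarrow> real \<Rightarrow> real operator" where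
  "sl_dirichlet a b q v c =
     sl_realisation a (ereal c) q (bc_left a b q v) (\<lambda>u. (u \<longlongrightarrow> 0) (at_left c))"

definition in_domain_near_left ::
    "ereal \<Rightarrow> ereal \<Rightarrow> (real \<Rightarrow> real) \<Rightarrow> (real \<Rightarrow> complex) \<Rightarrow> (real \<Rightarrow> complex) \<Rightarrow> bool" where
  "in_domain_near_left a b q v u \<longleftrightarrow> sq_int_near_left a b u \<and> bc_left a b q v u"

definition in_domain_near_right ::
    "ereal \<Rightarrow> ereal \<Rightarrow> (real \<Rightarrow> real) \<Rightarrow> (real \<Rightarrow> complex) \<Rightarrow> (real \<Rightarrow> complex) \<Rightarrow> bool" where
  "in_domain_near_right a b q w u \<longleftrightarrow> sq_int_near_right a b u \<and> bc_right a b q w u"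


section \<open>Singular Weyl function and spectral measure\<close>

definition real_entire :: "(complex \<Rightarrow> complex) \<Rightarrow> bool" where
  "real_entire f \<longleftrightarrow> f holomorphic_on UNIV \<and> (\<forall>t::real. f (complex_of_real t) \<in> \<real>)"

definition entire_system ::
    "ereal \<Rightarrow> ereal \<Rightarrow> (real \<Rightarrow> real) \<Rightarrow> (real \<Rightarrow> complex)
      \<Rightarrow> (complex \<Rightarrow> real \<Rightarrow> complex) \<Rightarrow> (complex \<Rightarrow> real \<Rightarrow> complex) \<Rightarrow> bool" where
  "entire_system a b q v \<phi> \<theta> \<longleftrightarrow>
     (\<forall>z. tau_solution a b q z (\<phi> z) \<and> tau_solution a b q z (\<theta> z)) \<and>
     (\<forall>x\<in>einterval a b. real_entire (\<lambda>z. \<phi> z x) \<and> real_entire (\<lambda>z. \<theta> z x)) \<and>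
     (\<forall>z. in_domain_near_left a b q v (\<phi> z)) \<and>
     (\<forall>z. \<forall>x\<in>einterval a b. wronskian (\<theta> z) (\<phi> z) x = 1)"

text \<open>The values of \<open>M\<close> on the spectrum are left unconstrained.\<close>
definition singular_weyl_function ::
    "ereal \<Rightarrow> ereal \<Rightarrow> (real \<Rightarrow> real) \<Rightarrow> (real \<Rightarrow> complex) \<Rightarrow> real operator
      \<Rightarrow> (complex \<Rightarrow> real \<Rightarrow> complex) \<Rightarrow> (complex \<Rightarrow> real \<Rightarrow> complex)
      \<Rightarrow> (complex \<Rightarrow> complex) \<Rightarrow> bool" where
  "singular_weyl_function a b q w H \<phi> \<theta> M \<longleftrightarrow>
     (\<forall>z. z \<notin> op_spectrum (lebesgue_ival a b) H \<longrightarrow>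
        in_domain_near_right a b q w (\<lambda>x. \<theta> z x + M z * \<phi> z x))"

text \<open>
  Finiteness on bounded intervals is part of the limit formula, whose right-hand side is a finite
  number; it is stated separately because \<open>measure\<close> is 0 on sets of infinite measure.
\<close>
definition weyl_spectral_measure :: "(complex \<Rightarrow> complex) \<Rightarrow> real measure \<Rightarrow> bool" where
  "weyl_spectral_measure M \<rho> \<longleftrightarrow>
     sets \<rho> = sets borel \<and>
     (\<forall>s t. emeasure \<rho> {s..t} < \<infinity>) \<and>
     (\<forall>s t. s < t \<longrightarrow>
        ((\<lambda>\<epsilon>. 1 / pi * integral {s..t} (\<lambda>l. Im (M (Complex l \<epsilon>))))
           \<longlongrightarrow> (measure \<rho> {s<..<t} + measure \<rho> {s..t}) / 2) (at_right 0))"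

definition sq_int_weight :: "real measure \<Rightarrow> (complex \<Rightarrow> complex) \<Rightarrow> bool" where
  "sq_int_weight \<rho> g \<longleftrightarrow>
     g holomorphic_on UNIV \<and>
     (\<forall>t::real. g (complex_of_real t) \<in> \<real> \<and> Re (g (complex_of_real t)) \<ge> 0) \<and>
     square_integrable \<rho> (\<lambda>t. exp (- g (complex_of_real t)))"

definition admissible_weight :: "real measure \<Rightarrow> (complex \<Rightarrow> complex) \<Rightarrow> bool" where
  "admissible_weight \<rho> G \<longleftrightarrow>
     G holomorphic_on UNIV \<and>
     (\<forall>t::real. G (complex_of_real t) \<in> \<real> \<and> Re (G (complex_of_real t)) > 0) \<and>
     integrable \<rho> (\<lambda>t. 1 / ((1 + (complex_of_real t)\<^sup>2) * G (complex_of_real t)))"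

end

theory Submission imports Defs begin

text \<open>
  The diagonal value \<open>\<phi> (\<theta> + M \<phi>)\<close> of the Green function of \<open>H\<close> at a point \<open>x0\<close> is a Herglotz
  function of size \<open>O(1 / Im z)\<close> near the real axis. Choosing \<open>x0\<close> with \<open>\<phi> \<lambda> x0 \<noteq> 0\<close>, one finds that
  near a real \<open>\<lambda>\<close> also \<open>M\<close> is \<open>O(1 / Im z)\<close>, with imaginary part bounded below. By the limit formula
  for \<open>\<rho>\<close>, the imaginary part of \<open>M\<close> minus the Stieltjes transform of \<open>\<rho>\<close> restricted to a
  neighbourhood of \<open>\<lambda>\<close> has integrals over short real intervals which tend to 0 at the real axis, so
  that this difference continues analytically by reflection. The weighted integral differs from that
  transform by a locally analytic function, because \<open>G z - G t\<close> is divisible by \<open>z - t\<close>; thus \<open>E\<close>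
  extends to the whole plane. The weight \<open>g\<close> is a power series with nonnegative terms on the real
  axis which grows faster than the measures of the intervals \<open>[-n, n]\<close>.
\<close>

section \<open>Square integrable functions\<close>

text \<open>\<open>M\<close> itself need not be a Herglotz function and nothing is known about its
  growth at infinity, so no global representation theorem applies to it. All arguments are local at
  the real axis, and \<open>E\<close> is only claimed to be entire. Two obstacles shape the local
  step. For a fixed \<open>x0\<close> the function \<open>\<phi> \<lambda> x0\<close> may vanish at
  real \<open>\<lambda>\<close>, so \<open>x0\<close> must change with \<open>\<lambda>\<close>. And
  \<open>\<rho>\<close> controls \<open>Im M\<close> only through limits of integrals over
  intervals; pointwise there is just the bound \<open>O(1 / Im z)\<close>. Two primitives turn this
  growth into boundedness and a third one into continuity up to the axis; there the integrated
  limits become genuine boundary values, and three derivatives undo the primitives afterwards. The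
  Green function is obtained purely by testing: solutions cut off away from an endpoint belong to
  \<open>H\<close>, and the symmetry of \<open>H\<close> against them replaces the computation of
  Wronskian limits. Real points of the resolvent set need an extra argument, because the kernel is
  singular there; \<open>\<rho>\<close> has no mass near them.\<close>

lemma square_integrable_measurable [measurable_dest]:
  "square_integrable M f \<Longrightarrow> f \<in> borel_measurable M"
  by (simp add: square_integrable_def)

lemma square_integrable_norm_sq: "square_integrable M f \<Longrightarrow> integrable M (\<lambda>x. (norm (f x))\<^sup>2)"
  by (simp add: square_integrable_def)

lemma square_integrable_norm_mult:
  assumes f: "square_integrable M f" and g: "square_integrable M g"
  shows "integrable M (\<lambda>x. norm (f x) * norm (g x))"
proof (rule Bochner_Integration.integrable_bound)
  show "integrable M (\<lambda>x. (norm (f x))\<^sup>2 + (norm (g x))\<^sup>2)"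
    using f g by (intro Bochner_Integration.integrable_add square_integrable_norm_sq)
  show "(\<lambda>x. norm (f x) * norm (g x)) \<in> borel_measurable M"
    using f g by measurable
  have "s * t \<le> s\<^sup>2 + t\<^sup>2" if "0 \<le> s" "0 \<le> t" for s t :: real
    using sum_squares_bound[of s t] that mult_nonneg_nonneg[of s t] by linarith
  then show "AE x in M. norm (norm (f x) * norm (g x)) \<le> norm ((norm (f x))\<^sup>2 + (norm (g x))\<^sup>2)"
    by auto
qed

lemma square_integrable_mult:
  assumes f: "square_integrable M f" and g: "square_integrable M g"
  shows "integrable M (\<lambda>x. f x * g x)"
proof (rule Bochner_Integration.integrable_bound[OF square_integrable_norm_mult[OF f g]])
  show "(\<lambda>x. f x * g x) \<in> borel_measurable M"
    using f g by (auto simp: square_integrable_def)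
qed (simp add: norm_mult)

lemma square_integrable_cnj: "square_integrable M f \<Longrightarrow> square_integrable M (\<lambda>x. cnj (f x))"
  unfolding square_integrable_def by (auto intro: borel_measurable_continuous_on continuous_intros)

lemma square_integrable_cmult:
  assumes f: "square_integrable M f"
  shows "square_integrable M (\<lambda>x. c * f x)"
  using f unfolding square_integrable_def by (auto simp: norm_mult power_mult_distrib)

lemma square_integrable_add:
  assumes f: "square_integrable M f" and g: "square_integrable M g"
  shows "square_integrable M (\<lambda>x. f x + g x)"
  unfolding square_integrable_def
proof (rule conjI, goal_cases)
  case 1
  show ?case using f g by (auto simp: square_integrable_def)
next
  case 2
  show ?case
proof (rule Bochner_Integration.integrable_bound)
  show "integrable M (\<lambda>x. 2 * ((norm (f x))\<^sup>2 + (norm (g x))\<^sup>2))"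
    using f g by (intro integrable_mult_right Bochner_Integration.integrable_add square_integrable_norm_sq)
  show "(\<lambda>x. (norm (f x + g x))\<^sup>2) \<in> borel_measurable M"
    using f g by measurable
  have "(norm (u + v))\<^sup>2 \<le> 2 * ((norm u)\<^sup>2 + (norm v)\<^sup>2)" for u v :: complex
  proof -
    have "(norm (u + v))\<^sup>2 \<le> (norm u + norm v)\<^sup>2"
      by (intro power_mono norm_triangle_ineq norm_ge_zero)
    also have "\<dots> = (norm u)\<^sup>2 + (norm v)\<^sup>2 + 2 * norm u * norm v" by (rule power2_sum)
    also have "\<dots> \<le> 2 * ((norm u)\<^sup>2 + (norm v)\<^sup>2)"
      using sum_squares_bound[of "norm u" "norm v"] by (simp add: algebra_simps)
    finally show ?thesis .
  qed
  then show "AE x in M. norm ((norm (f x + g x))\<^sup>2) \<le> norm (2 * ((norm (f x))\<^sup>2 + (norm (g x))\<^sup>2))"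
    unfolding real_norm_def by (intro AE_I2 order_trans[OF _ abs_ge_self]) simp
qed
qed

lemma square_integrable_diff:
  assumes f: "square_integrable M f" and g: "square_integrable M g"
  shows "square_integrable M (\<lambda>x. f x - g x)"
  using square_integrable_add[OF f square_integrable_cmult[OF g, of "-1"]] by simp

lemma l2_inner_integrable:
  "square_integrable M f \<Longrightarrow> square_integrable M g \<Longrightarrow> integrable M (\<lambda>x. cnj (f x) * g x)"
  by (intro square_integrable_mult square_integrable_cnj)

lemma l2_inner_add_right:
  assumes "square_integrable M f" "square_integrable M g" "square_integrable M h"
  shows "l2_inner M f (\<lambda>x. g x + h x) = l2_inner M f g + l2_inner M f h"
  unfolding l2_inner_def distrib_left
  by (intro Bochner_Integration.integral_add l2_inner_integrable assms)

lemma l2_inner_diff_right: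
  assumes "square_integrable M f" "square_integrable M g" "square_integrable M h"
  shows "l2_inner M f (\<lambda>x. g x - h x) = l2_inner M f g - l2_inner M f h"
  unfolding l2_inner_def right_diff_distrib
  by (intro Bochner_Integration.integral_diff l2_inner_integrable assms)

lemma l2_inner_diff_left:
  assumes "square_integrable M f" "square_integrable M g" "square_integrable M h"
  shows "l2_inner M (\<lambda>x. g x - h x) f = l2_inner M g f - l2_inner M h f"
  unfolding l2_inner_def complex_cnj_diff left_diff_distrib
  by (intro Bochner_Integration.integral_diff l2_inner_integrable assms)

lemma l2_inner_add_left:
  assumes "square_integrable M f" "square_integrable M g" "square_integrable M h"
  shows "l2_inner M (\<lambda>x. g x + h x) f = l2_inner M g f + l2_inner M h f"
  unfolding l2_inner_def complex_cnj_add distrib_right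
  by (intro Bochner_Integration.integral_add l2_inner_integrable assms)

lemma l2_inner_cmult_right: "l2_inner M f (\<lambda>x. c * g x) = c * l2_inner M f g"
  unfolding l2_inner_def by (simp add: mult.left_commute[of _ c])

lemma l2_inner_cmult_left: "l2_inner M (\<lambda>x. c * f x) g = cnj c * l2_inner M f g"
  unfolding l2_inner_def by (simp add: mult.assoc)

lemma l2_inner_commute: "l2_inner M f g = cnj (l2_inner M g f)"
  unfolding l2_inner_def by (simp add: Bochner_Integration.integral_cnj[symmetric] mult.commute)

lemma l2_norm_nonneg: "0 \<le> l2_norm M f"
  by (simp add: l2_norm_def)

lemma l2_norm_sq: "(l2_norm M f)\<^sup>2 = (LINT x|M. (norm (f x))\<^sup>2)"
  by (simp add: l2_norm_def)

lemma l2_inner_self: "l2_inner M f f = complex_of_real ((l2_norm M f)\<^sup>2)"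
  unfolding l2_norm_sq l2_inner_def
  by (simp add: integral_complex_of_real[symmetric] mult.commute complex_norm_square del: integral_complex_of_real of_real_power)

lemma l2_norm_cnj: "l2_norm M (\<lambda>x. cnj (f x)) = l2_norm M f"
  by (simp add: l2_norm_def)

lemma l2_norm_cmult: "l2_norm M (\<lambda>x. c * f x) = norm c * l2_norm M f"
  by (simp add: l2_norm_def norm_mult power_mult_distrib real_sqrt_mult)

lemma l2_norm_eq_0_AE:
  assumes "square_integrable M f" "l2_norm M f = 0"
  shows "AE x in M. f x = 0"
proof -
  have "AE x in M. (norm (f x))\<^sup>2 = 0"
    using assms integral_nonneg_eq_0_iff_AE[OF square_integrable_norm_sq[OF assms(1)]]
    by (simp add: l2_norm_def)
  then show ?thesis by auto
qed

section \<open>Cauchy-Schwarz, the triangle inequality and the parallelogram law\<close>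

lemma l2_Cauchy_Schwarz_norm:
  assumes f: "square_integrable M f" and g: "square_integrable M g"
  shows "(LINT x|M. norm (f x) * norm (g x)) \<le> l2_norm M f * l2_norm M g"
proof -
  have [measurable]: "f \<in> borel_measurable M" "g \<in> borel_measurable M"
    using f g by (auto simp: square_integrable_def)
  let ?I = "LINT x|M. norm (f x) * norm (g x)"
  have I: "(\<integral>\<^sup>+x. ennreal (norm (f x)) * ennreal (norm (g x)) \<partial>M) = ennreal ?I"
    by (subst nn_integral_eq_integral[symmetric])
       (use square_integrable_norm_mult[OF f g] in \<open>auto simp: ennreal_mult'\<close>)
  have sq: "(\<integral>\<^sup>+x. (ennreal (norm (u x)))\<^sup>2 \<partial>M) = ennreal ((l2_norm M u)\<^sup>2)"
    if "square_integrable M u" for u :: "_ \<Rightarrow> complex"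
    unfolding l2_norm_sq
    by (subst nn_integral_eq_integral[symmetric])
       (use square_integrable_norm_sq[OF that] in \<open>auto simp: ennreal_power\<close>)
  have "(ennreal ?I)\<^sup>2 \<le> ennreal ((l2_norm M f)\<^sup>2) * ennreal ((l2_norm M g)\<^sup>2)"
    unfolding I[symmetric] sq[OF f, symmetric] sq[OF g, symmetric]
    by (rule Cauchy_Schwarz_nn_integral) auto
  also have "\<dots> = ennreal ((l2_norm M f * l2_norm M g)\<^sup>2)"
    by (simp add: ennreal_mult' power_mult_distrib)
  finally have "?I\<^sup>2 \<le> (l2_norm M f * l2_norm M g)\<^sup>2"
    by (simp add: ennreal_power)
  then show ?thesis
    by (rule power2_le_imp_le) (simp add: l2_norm_nonneg)
qed

lemma l2_Cauchy_Schwarz: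
  assumes f: "square_integrable M f" and g: "square_integrable M g"
  shows "norm (l2_inner M f g) \<le> l2_norm M f * l2_norm M g"
proof -
  have "norm (l2_inner M f g) \<le> (LINT x|M. norm (cnj (f x) * g x))"
    unfolding l2_inner_def by (rule integral_norm_bound)
  also have "\<dots> \<le> l2_norm M f * l2_norm M g"
    using l2_Cauchy_Schwarz_norm[OF f g] by (simp add: norm_mult)
  finally show ?thesis .
qed

lemma l2_norm_add_sq:
  assumes f: "square_integrable M f" and g: "square_integrable M g"
  shows "(l2_norm M (\<lambda>x. f x + g x))\<^sup>2 = (l2_norm M f)\<^sup>2 + 2 * Re (l2_inner M f g) + (l2_norm M g)\<^sup>2"
proof -
  have "complex_of_real ((l2_norm M (\<lambda>x. f x + g x))\<^sup>2)
      = l2_inner M f f + l2_inner M f g + (cnj (l2_inner M f g) + l2_inner M g g)"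
    unfolding l2_inner_self[symmetric] l2_inner_commute[of M g f, symmetric]
    using f g by (simp add: l2_inner_add_right l2_inner_add_left square_integrable_add)
  then have "Re (complex_of_real ((l2_norm M (\<lambda>x. f x + g x))\<^sup>2))
      = Re (l2_inner M f f + l2_inner M f g + (cnj (l2_inner M f g) + l2_inner M g g))" by simp
  then show ?thesis by (simp add: l2_inner_self del: of_real_power)
qed

lemma l2_norm_triangle:
  assumes f: "square_integrable M f" and g: "square_integrable M g"
  shows "l2_norm M (\<lambda>x. f x + g x) \<le> l2_norm M f + l2_norm M g"
proof (rule power2_le_imp_le)
  have "Re (l2_inner M f g) \<le> l2_norm M f * l2_norm M g"
    using l2_Cauchy_Schwarz[OF f g] complex_Re_le_cmod order_trans by blast
  then show "(l2_norm M (\<lambda>x. f x + g x))\<^sup>2 \<le> (l2_norm M f + l2_norm M g)\<^sup>2"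
    unfolding l2_norm_add_sq[OF f g] by (simp add: power2_sum)
qed (simp add: l2_norm_nonneg)

lemma l2_norm_triangle_diff:
  assumes f: "square_integrable M f" and g: "square_integrable M g"
  shows "l2_norm M f \<le> l2_norm M (\<lambda>x. f x - g x) + l2_norm M g"
  using l2_norm_triangle[OF square_integrable_diff[OF f g] g] by simp

lemma l2_norm_minus_commute: "l2_norm M (\<lambda>x. f x - g x) = l2_norm M (\<lambda>x. g x - f x)"
  by (simp add: l2_norm_def norm_minus_commute)

lemma l2_parallelogram:
  assumes f: "square_integrable M f" and g: "square_integrable M g"
  shows "(l2_norm M (\<lambda>x. f x + g x))\<^sup>2 + (l2_norm M (\<lambda>x. f x - g x))\<^sup>2
       = 2 * (l2_norm M f)\<^sup>2 + 2 * (l2_norm M g)\<^sup>2"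
  using l2_norm_add_sq[OF f g] l2_norm_add_sq[OF f square_integrable_cmult[OF g, of "-1"]]
  unfolding l2_inner_cmult_right l2_norm_cmult by simp

text \<open>A subsequence with rapidly decreasing increments converges almost everywhere; Fatou's
  lemma then converts this into convergence in norm of the whole Cauchy sequence.\<close>

theorem Riesz_Fischer:
  assumes sq: "\<And>n. square_integrable M (s n)"
    and cauchy: "\<And>e. 0 < e \<Longrightarrow> \<exists>N. \<forall>i\<ge>N. \<forall>j\<ge>N. l2_norm M (\<lambda>x. s i x - s j x) < e"
  obtains f where "square_integrable M f" "(\<lambda>n. l2_norm M (\<lambda>x. s n x - f x)) \<longlonglongrightarrow> 0"
proof -
  have [measurable]: "s n \<in> borel_measurable M" for n
    using sq by (auto simp: square_integrable_def)
  define d where "d = (\<lambda>i j. l2_norm M (\<lambda>x. s i x - s j x))"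
  have "\<exists>r. \<forall>n. (\<forall>i\<ge>r n. \<forall>j\<ge>r n. d i j < (1/2)^n) \<and> r n < r (Suc n)"
  proof (intro dependent_nat_choice, goal_cases)
    case 1 then show ?case using cauchy[of 1] by (auto simp: d_def)
  next
    case (2 x n)
    obtain N where N: "\<forall>i\<ge>N. \<forall>j\<ge>N. d i j < (1/2)^Suc n"
      using cauchy[of "(1/2)^Suc n"] by (auto simp: d_def)
    then show ?case by (intro exI[of _ "max N (Suc x)"]) auto
  qed
  then obtain r where r1: "\<And>n i j. r n \<le> i \<Longrightarrow> r n \<le> j \<Longrightarrow> d i j < (1/2)^n"
    and r2: "\<And>n. r n < r (Suc n)" by metis
  have rmono: "strict_mono r" using r2 by (simp add: strict_mono_Suc_iff)
  have rle: "r n \<le> r (Suc n)" for n using r2[of n] by simp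
  define D where "D = (\<lambda>n x. s (r (Suc n)) x - s (r n) x)"
  have [measurable]: "D n \<in> borel_measurable M" for n unfolding D_def by measurable
  have sqD: "square_integrable M (D n)" for n
    unfolding D_def by (intro square_integrable_diff sq)
  \<comment> \<open>The squared norm of \<open>D n\<close> is at most \<open>(1/2)^(2 * n)\<close>.
    Spending a factor \<open>2^n\<close> on it leaves a summable bound, and pointwise it yields
    decay like \<open>(1 / sqrt 2)^n\<close>, which makes the increments summable.\<close>
  have nnD: "(\<integral>\<^sup>+x. ennreal (2^n * (norm (D n x))\<^sup>2) \<partial>M) \<le> ennreal ((1/2)^n)" for n
  proof -
    have "(\<integral>\<^sup>+x. ennreal (2^n * (norm (D n x))\<^sup>2) \<partial>M) = ennreal (2^n * (l2_norm M (D n))\<^sup>2)"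
      unfolding l2_norm_sq using square_integrable_norm_sq[OF sqD[of n]]
      by (subst nn_integral_eq_integral) auto
    also have "l2_norm M (D n) = d (r (Suc n)) (r n)" by (simp add: D_def d_def)
    also have "2^n * (d (r (Suc n)) (r n))\<^sup>2 \<le> 2^n * ((1/2)^n)\<^sup>2"
      using r1[of n "r (Suc n)" "r n"] rle[of n]
      by (intro mult_left_mono power_mono) (auto simp: d_def l2_norm_nonneg)
    also have "2^n * ((1/2)^n)\<^sup>2 = ((1/2)^n :: real)"
      by (simp add: power2_eq_square power_mult_distrib[symmetric] flip: mult.assoc)
    finally show ?thesis by (simp add: ennreal_leI)
  qed
  have "(\<integral>\<^sup>+x. (\<Sum>n. ennreal (2^n * (norm (D n x))\<^sup>2)) \<partial>M)
      = (\<Sum>n. \<integral>\<^sup>+x. ennreal (2^n * (norm (D n x))\<^sup>2) \<partial>M)"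
    by (rule nn_integral_suminf) measurable
  also have "\<dots> \<le> (\<Sum>n. ennreal ((1/2)^n))" by (intro suminf_le nnD) auto
  also have "\<dots> < \<infinity>"
    by (subst suminf_ennreal2) (auto intro: summable_geometric)
  finally have fin: "(\<integral>\<^sup>+x. (\<Sum>n. ennreal (2^n * (norm (D n x))\<^sup>2)) \<partial>M) \<noteq> \<infinity>" by simp
  have "AE x in M. (\<Sum>n. ennreal (2^n * (norm (D n x))\<^sup>2)) \<noteq> \<infinity>"
    by (rule nn_integral_PInf_AE[OF _ fin]) measurable
  then have conv: "AE x in M. convergent (\<lambda>n. s (r n) x)"
  proof (eventually_elim)
    case (elim x)
    have "summable (\<lambda>n. 2^n * (norm (D n x))\<^sup>2)"
      by (rule summable_suminf_not_top) (use elim in auto)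
    then have "Bseq (\<lambda>n. 2^n * (norm (D n x))\<^sup>2)"
      by (intro convergent_imp_Bseq) (auto simp: convergent_def dest: summable_LIMSEQ_zero)
    then obtain B where B: "0 < B" "\<And>n. 2^n * (norm (D n x))\<^sup>2 \<le> B"
      by (auto simp: Bseq_def)
    have Dle: "norm (D n x) \<le> sqrt B * (1 / sqrt 2)^n" for n
    proof (rule power2_le_imp_le)
      have "(norm (D n x))\<^sup>2 \<le> B / 2^n" using B(2)[of n] by (simp add: field_simps)
      also have "\<dots> = (sqrt B * (1 / sqrt 2)^n)\<^sup>2"
        using B(1) by (simp add: power_mult_distrib power_divide real_sqrt_power[symmetric])
      finally show "(norm (D n x))\<^sup>2 \<le> (sqrt B * (1 / sqrt 2)^n)\<^sup>2" .
    qed (use B(1) in simp)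
    have "summable (\<lambda>n. sqrt B * (1 / sqrt 2)^n)"
      by (rule summable_mult, rule summable_geometric) simp
    then have "summable (\<lambda>n. D n x)"
      by (rule summable_comparison_test'[where N=0]) (rule Dle)
    then have "convergent (\<lambda>n. \<Sum>i<n. D i x)" by (rule summable_iff_convergent[THEN iffD1])
    moreover have "(\<lambda>n. \<Sum>i<n. D i x) = (\<lambda>n. s (r n) x - s (r 0) x)"
      unfolding D_def by (intro ext sum_lessThan_telescope)
    ultimately have "convergent (\<lambda>n. s (r n) x - s (r 0) x)" by (simp only:)
    from convergent_add[OF this convergent_const[of "s (r 0) x"]] show ?case
      by (simp only: diff_add_cancel)
  qed
  define f where "f = (\<lambda>x. lim (\<lambda>n. s (r n) x))"
  have [measurable]: "f \<in> borel_measurable M" unfolding f_def by measurable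
  have lim: "AE x in M. (\<lambda>n. s (r n) x) \<longlonglongrightarrow> f x"
    using conv by eventually_elim (simp add: f_def convergent_LIMSEQ_iff)
  have fatou: "(\<integral>\<^sup>+x. ennreal ((norm (s k x - f x))\<^sup>2) \<partial>M) \<le> ennreal (((1/2)^n)\<^sup>2)" if k: "r n \<le> k" for n k
  proof -
    have "(\<integral>\<^sup>+x. ennreal ((norm (s k x - f x))\<^sup>2) \<partial>M)
       = (\<integral>\<^sup>+x. liminf (\<lambda>m. ennreal ((norm (s k x - s (r m) x))\<^sup>2)) \<partial>M)"
    proof (rule nn_integral_cong_AE, use lim in eventually_elim)
      case (elim x)
      have "(\<lambda>m. ennreal ((norm (s k x - s (r m) x))\<^sup>2)) \<longlonglongrightarrow> ennreal ((norm (s k x - f x))\<^sup>2)"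
        using elim by (intro tendsto_ennrealI tendsto_power tendsto_norm tendsto_diff tendsto_const)
      from lim_imp_Liminf[OF _ this] show ?case by simp
    qed
    also have "\<dots> \<le> liminf (\<lambda>m. \<integral>\<^sup>+x. ennreal ((norm (s k x - s (r m) x))\<^sup>2) \<partial>M)"
      by (rule nn_integral_liminf) measurable
    also have "\<dots> \<le> liminf (\<lambda>m. ennreal (((1/2)^n)\<^sup>2))"
    proof (rule Liminf_mono, rule eventually_sequentiallyI)
      fix m assume "n \<le> m"
      then have "r n \<le> r m" using rmono by (simp add: strict_mono_less_eq)
      have "(\<integral>\<^sup>+x. ennreal ((norm (s k x - s (r m) x))\<^sup>2) \<partial>M) = ennreal ((d k (r m))\<^sup>2)"
        unfolding d_def l2_norm_sq
        by (rule nn_integral_eq_integral) (auto intro!: square_integrable_norm_sq square_integrable_diff sq)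
      also have "\<dots> \<le> ennreal (((1/2)^n)\<^sup>2)"
        using r1[OF k \<open>r n \<le> r m\<close>] by (intro ennreal_leI power_mono) (auto simp: d_def l2_norm_nonneg)
      finally show "(\<integral>\<^sup>+x. ennreal ((norm (s k x - s (r m) x))\<^sup>2) \<partial>M) \<le> ennreal (((1/2)^n)\<^sup>2)" .
    qed
    finally show ?thesis by (simp add: Liminf_const)
  qed
  \<comment> \<open>Finiteness of the Fatou bound is also what makes \<open>f\<close> square
    integrable, since \<open>f\<close> differs from \<open>s (r 0)\<close> by a square integrable
    function.\<close>
  have sqdiff: "square_integrable M (\<lambda>x. s k x - f x)" if "r 0 \<le> k" for k
    unfolding square_integrable_def
    using fatou[OF that] by (auto intro!: integrableI_bounded order.strict_trans1[OF fatou[OF that]])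
  have bd: "l2_norm M (\<lambda>x. s k x - f x) \<le> (1/2)^n" if k: "r n \<le> k" for n k
  proof -
    have "r 0 \<le> r n" using rmono by (simp add: strict_mono_less_eq)
    then have "ennreal ((l2_norm M (\<lambda>x. s k x - f x))\<^sup>2) \<le> ennreal (((1/2)^n)\<^sup>2)"
      unfolding l2_norm_sq using fatou[OF k] square_integrable_norm_sq[OF sqdiff[of k]] k
      by (subst nn_integral_eq_integral[symmetric]) auto
    then have "(l2_norm M (\<lambda>x. s k x - f x))\<^sup>2 \<le> ((1/2)^n)\<^sup>2" by simp
    then show ?thesis by (rule power2_le_imp_le) simp
  qed
  have "square_integrable M f"
    using square_integrable_diff[OF sq[of "r 0"] sqdiff[of "r 0"]] by simp
  moreover have "(\<lambda>n. l2_norm M (\<lambda>x. s n x - f x)) \<longlonglongrightarrow> 0"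
  proof (rule LIMSEQ_I)
    fix e :: real assume "0 < e"
    then obtain n where "(1/2)^n < e" using real_arch_pow_inv[of e "1/2"] by auto
    then show "\<exists>no. \<forall>k\<ge>no. norm (l2_norm M (\<lambda>x. s k x - f x) - 0) < e"
      using bd[of n] by (intro exI[of _ "r n"]) (force simp: l2_norm_nonneg)
  qed
  ultimately show ?thesis by (rule that)
qed

lemma l2_inner_tendsto_right:
  assumes g: "square_integrable M g" and s: "\<And>n. square_integrable M (s n)" and f: "square_integrable M f"
    and lim: "(\<lambda>n. l2_norm M (\<lambda>x. s n x - f x)) \<longlonglongrightarrow> 0"
  shows "(\<lambda>n. l2_inner M g (s n)) \<longlonglongrightarrow> l2_inner M g f"
proof -
  have "(\<lambda>n. l2_inner M g (s n) - l2_inner M g f) \<longlonglongrightarrow> 0"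
  proof (rule Lim_null_comparison[OF always_eventually])
    show "\<forall>n. norm (l2_inner M g (s n) - l2_inner M g f) \<le> l2_norm M g * l2_norm M (\<lambda>x. s n x - f x)"
      using l2_Cauchy_Schwarz[OF g square_integrable_diff[OF s f]] by (simp add: l2_inner_diff_right g s f)
    show "(\<lambda>n. l2_norm M g * l2_norm M (\<lambda>x. s n x - f x)) \<longlonglongrightarrow> 0"
      using tendsto_mult_right_zero[OF lim] by simp
  qed
  then show ?thesis by (simp add: LIM_zero_iff)
qed

section \<open>Resolvents of self-adjoint operators\<close>

lemma self_adjoint_square_integrable:
  assumes "self_adjoint_operator M T" "(f, h) \<in> T"
  shows "square_integrable M f" "square_integrable M h"
  using assms unfolding self_adjoint_operator_def adjoint_operator_def by fastforce+

lemma self_adjoint_symmetric: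
  assumes "self_adjoint_operator M T" "(f, h) \<in> T" "(g, k) \<in> T"
  shows "l2_inner M g h = l2_inner M k f"
  using assms unfolding self_adjoint_operator_def adjoint_operator_def by fastforce

text \<open>Since \<open>T\<close> is its own adjoint, membership can be shown without looking at
  the domain: a symmetric pairing with every element is enough. In particular no boundary condition
  has to be verified.\<close>

lemma self_adjointI:
  assumes "self_adjoint_operator M T" "square_integrable M g" "square_integrable M k"
    and "\<And>f h. (f, h) \<in> T \<Longrightarrow> l2_inner M g h = l2_inner M k f"
  shows "(g, k) \<in> T"
proof -
  have "(g, k) \<in> adjoint_operator M T" unfolding adjoint_operator_def using assms by auto
  then show ?thesis using assms(1) by (simp add: self_adjoint_operator_def)
qed

lemma self_adjoint_zero: "self_adjoint_operator M T \<Longrightarrow> (\<lambda>_. 0, \<lambda>_. 0) \<in> T"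
  by (rule self_adjointI) (auto simp: square_integrable_def l2_inner_def)

lemma self_adjoint_add_cmult:
  assumes T: "self_adjoint_operator M T" and f: "(f, h) \<in> T" and g: "(g, k) \<in> T"
  shows "(\<lambda>x. f x + c * g x, \<lambda>x. h x + c * k x) \<in> T"
proof (rule self_adjointI[OF T])
  note sq = self_adjoint_square_integrable[OF T f] self_adjoint_square_integrable[OF T g]
  show "square_integrable M (\<lambda>x. f x + c * g x)" "square_integrable M (\<lambda>x. h x + c * k x)"
    using sq by (auto intro: square_integrable_add square_integrable_cmult)
  fix p s assume p: "(p, s) \<in> T"
  show "l2_inner M (\<lambda>x. f x + c * g x) s = l2_inner M (\<lambda>x. h x + c * k x) p"
    unfolding l2_inner_add_left[OF self_adjoint_square_integrable(2)[OF T p] sq(1) square_integrable_cmult[OF sq(3)]]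
      l2_inner_add_left[OF self_adjoint_square_integrable(1)[OF T p] sq(2) square_integrable_cmult[OF sq(4)]]
      l2_inner_cmult_left self_adjoint_symmetric[OF T p f] self_adjoint_symmetric[OF T p g] ..
qed

lemma self_adjoint_closed:
  assumes T: "self_adjoint_operator M T" and s: "\<And>n. (s n, r n) \<in> T"
    and f: "square_integrable M f" "(\<lambda>n. l2_norm M (\<lambda>x. s n x - f x)) \<longlonglongrightarrow> 0"
    and h: "square_integrable M h" "(\<lambda>n. l2_norm M (\<lambda>x. r n x - h x)) \<longlonglongrightarrow> 0"
  shows "(f, h) \<in> T"
proof (rule self_adjointI[OF T f(1) h(1)])
  fix p q assume p: "(p, q) \<in> T"
  note sq = self_adjoint_square_integrable[OF T p]
  have "(\<lambda>n. l2_inner M q (s n)) \<longlonglongrightarrow> l2_inner M q f"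
    by (rule l2_inner_tendsto_right[OF sq(2) self_adjoint_square_integrable(1)[OF T s] f])
  moreover have "(\<lambda>n. l2_inner M p (r n)) \<longlonglongrightarrow> l2_inner M p h"
    by (rule l2_inner_tendsto_right[OF sq(1) self_adjoint_square_integrable(2)[OF T s] h])
  moreover have "l2_inner M p (r n) = l2_inner M q (s n)" for n
    by (rule self_adjoint_symmetric[OF T s p])
  ultimately have "l2_inner M p h = l2_inner M q f"
    using LIMSEQ_unique by auto
  then show "l2_inner M f q = l2_inner M h p"
    by (simp add: l2_inner_commute[of M f q] l2_inner_commute[of M h p])
qed

lemma l2_norm_zero: "l2_norm M (\<lambda>_. 0) = 0"
  by (simp add: l2_norm_def)

text \<open>The range of \<open>T - z\<close> is closed by the first bound and dense by the second one: its
  orthogonal complement consists of eigenfunctions for the conjugate of \<open>z\<close>.\<close>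

lemma self_adjoint_resolventI:
  assumes T: "self_adjoint_operator M T"
    and C: "\<And>f h. (f, h) \<in> T \<Longrightarrow> l2_norm M f \<le> C * l2_norm M (\<lambda>x. h x - z * f x)"
    and C': "\<And>f h. (f, h) \<in> T \<Longrightarrow> l2_norm M f \<le> C' * l2_norm M (\<lambda>x. h x - cnj z * f x)"
  shows "z \<in> resolvent_set M T"
proof -
  have surj: "\<exists>(f, h)\<in>T. AE x in M. h x - z * f x = k x" if k: "square_integrable M k" for k
  proof -
    \<comment> \<open>The Hilbert space projection by hand: \<open>d\<close> is the infimum of the
      squared distances from \<open>k\<close> to the range of \<open>T - z\<close>, and
      \<open>s\<close>, \<open>r\<close> form a minimising sequence of preimages and images.\<close>
    define E where "E = (\<lambda>(f, h). (l2_norm M (\<lambda>x. k x - (h x - z * f x)))\<^sup>2)"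
    define d where "d = Inf (E ` T)"
    have bdd: "bdd_below (E ` T)" by (rule bdd_belowI[where m=0]) (auto simp: E_def)
    have dle: "d \<le> E t" if "t \<in> T" for t
      unfolding d_def using bdd that by (intro cInf_lower) auto
    have "\<exists>t\<in>T. E t < d + 1 / (real n + 1)" for n
      using cInf_lessD[of "E ` T" "d + 1 / (real n + 1)"] self_adjoint_zero[OF T]
      unfolding d_def[symmetric] by auto
    then obtain t where t: "\<And>n. t n \<in> T" "\<And>n. E (t n) < d + 1 / (real n + 1)" by metis
    define s r where "s = (\<lambda>n. fst (t n))" and "r = (\<lambda>n x. snd (t n) x - z * s n x)"
    have sT: "(s n, \<lambda>x. r n x + z * s n x) \<in> T" for n
      using t(1)[of n] by (simp add: s_def r_def)
    have sqs: "square_integrable M (s n)" for n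
      using self_adjoint_square_integrable[OF T sT] by simp
    have sqr: "square_integrable M (r n)" for n
      using square_integrable_diff[OF self_adjoint_square_integrable(2)[OF T sT] square_integrable_cmult[OF sqs], of n z n]
      by simp
    have Er: "(l2_norm M (\<lambda>x. k x - r n x))\<^sup>2 < d + 1 / (real n + 1)" for n
      using t(2)[of n] by (simp add: E_def s_def r_def case_prod_unfold)
    \<comment> \<open>The midpoint of two approximants is again in the range, so its squared
      distance to \<open>k\<close> is at least \<open>d\<close>; the parallelogram law turns this
      into a bound for the difference.\<close>
    have cauchy2: "(l2_norm M (\<lambda>x. r i x - r j x))\<^sup>2 \<le> 2 / (real i + 1) + 2 / (real j + 1)" for i j
    proof -
      let ?a = "\<lambda>x. k x - r i x" and ?b = "\<lambda>x. k x - r j x"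
      \<comment> \<open>The zero pair is the starting point because the closure rule rescales only
        its second argument.\<close>
      have "(\<lambda>x. (0 + (1/2) * s i x) + (1/2) * s j x, \<lambda>x. (0 + (1/2) * (r i x + z * s i x)) + (1/2) * (r j x + z * s j x)) \<in> T"
        by (intro self_adjoint_add_cmult[OF T] self_adjoint_zero[OF T] sT)
      then have "d \<le> (l2_norm M (\<lambda>x. k x - (1/2) * (r i x + r j x)))\<^sup>2"
        using dle by (fastforce simp: E_def algebra_simps)
      also have "(\<lambda>x. k x - (1/2) * (r i x + r j x)) = (\<lambda>x. (1/2) * (?a x + ?b x))"
        by (auto simp: field_simps)
      finally have "4 * d \<le> (l2_norm M (\<lambda>x. ?a x + ?b x))\<^sup>2"
        unfolding l2_norm_cmult by (simp add: power_mult_distrib power2_eq_square)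
      moreover have "(l2_norm M (\<lambda>x. ?a x + ?b x))\<^sup>2 + (l2_norm M (\<lambda>x. ?a x - ?b x))\<^sup>2
          = 2 * (l2_norm M ?a)\<^sup>2 + 2 * (l2_norm M ?b)\<^sup>2"
        by (intro l2_parallelogram square_integrable_diff k sqr)
      moreover have "l2_norm M (\<lambda>x. ?a x - ?b x) = l2_norm M (\<lambda>x. r i x - r j x)"
        by (subst l2_norm_minus_commute) simp
      ultimately show ?thesis using Er[of i] Er[of j] by simp
    qed
    have cauchy: "\<exists>N. \<forall>i\<ge>N. \<forall>j\<ge>N. l2_norm M (\<lambda>x. r i x - r j x) < e" if "0 < e" for e
    proof -
      obtain N :: nat where N: "4 / e\<^sup>2 < real N" using reals_Archimedean2 by blast
      show ?thesis
      proof (intro exI[of _ N] allI impI)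
        fix i j assume ij: "N \<le> i" "N \<le> j"
        have "1 / (real m + 1) < e\<^sup>2 / 4" if "N \<le> m" for m
        proof -
          have "4 / e\<^sup>2 < real m + 1" using N that by linarith
          then show ?thesis using \<open>0 < e\<close> by (simp add: field_simps)
        qed
        from this[OF ij(1)] this[OF ij(2)] have "(l2_norm M (\<lambda>x. r i x - r j x))\<^sup>2 < e\<^sup>2"
          using cauchy2[of i j] by simp
        then show "l2_norm M (\<lambda>x. r i x - r j x) < e"
          by (rule power2_less_imp_less) (use \<open>0 < e\<close> in simp)
      qed
    qed
    \<comment> \<open>The lower bound for \<open>T - z\<close> carries the Cauchy property from the
      range back to the domain.\<close>
    have scauchy: "\<exists>N. \<forall>i\<ge>N. \<forall>j\<ge>N. l2_norm M (\<lambda>x. s i x - s j x) < e" if "0 < e" for e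
    proof -
      have "0 < e / (\<bar>C\<bar> + 1)" using that by simp
      then obtain N where N: "\<forall>i\<ge>N. \<forall>j\<ge>N. l2_norm M (\<lambda>x. r i x - r j x) < e / (\<bar>C\<bar> + 1)"
        using cauchy by blast
      have "l2_norm M (\<lambda>x. s i x - s j x) < e" if "N \<le> i" "N \<le> j" for i j
      proof -
        have "l2_norm M (\<lambda>x. s i x + (-1) * s j x)
           \<le> C * l2_norm M (\<lambda>x. ((r i x + z * s i x) + (-1) * (r j x + z * s j x)) - z * (s i x + (-1) * s j x))"
          by (intro C self_adjoint_add_cmult[OF T] sT)
        also have "\<dots> = C * l2_norm M (\<lambda>x. r i x - r j x)" by (simp add: algebra_simps)
        also have "\<dots> \<le> (\<bar>C\<bar> + 1) * l2_norm M (\<lambda>x. r i x - r j x)"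
          by (intro mult_right_mono) (auto simp: l2_norm_nonneg)
        also have "\<dots> < e" using N that by (simp add: field_simps)
        finally show ?thesis by simp
      qed
      then show ?thesis by blast
    qed
    obtain f where f: "square_integrable M f" "(\<lambda>n. l2_norm M (\<lambda>x. s n x - f x)) \<longlonglongrightarrow> 0"
      using Riesz_Fischer[OF sqs scauchy] by blast
    obtain u where u: "square_integrable M u" "(\<lambda>n. l2_norm M (\<lambda>x. r n x - u x)) \<longlonglongrightarrow> 0"
      using Riesz_Fischer[OF sqr cauchy] by blast
    have fT: "(f, \<lambda>x. u x + z * f x) \<in> T"
    proof (rule self_adjoint_closed[OF T sT f])
      show "square_integrable M (\<lambda>x. u x + z * f x)"
        by (intro square_integrable_add square_integrable_cmult f u)
      show "(\<lambda>n. l2_norm M (\<lambda>x. r n x + z * s n x - (u x + z * f x))) \<longlonglongrightarrow> 0"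
      proof (rule Lim_null_comparison[OF always_eventually])
        have "l2_norm M (\<lambda>x. r n x + z * s n x - (u x + z * f x))
           \<le> l2_norm M (\<lambda>x. r n x - u x) + norm z * l2_norm M (\<lambda>x. s n x - f x)" for n
        proof -
          have "(\<lambda>x. r n x + z * s n x - (u x + z * f x)) = (\<lambda>x. (r n x - u x) + z * (s n x - f x))"
            by (auto simp: algebra_simps)
          then show ?thesis
            using l2_norm_triangle[OF square_integrable_diff[OF sqr u(1)]
                square_integrable_cmult[OF square_integrable_diff[OF sqs f(1)]], of n z n]
            by (simp only: l2_norm_cmult)
        qed
        then show "\<forall>n. norm (l2_norm M (\<lambda>x. r n x + z * s n x - (u x + z * f x)))
           \<le> l2_norm M (\<lambda>x. r n x - u x) + norm z * l2_norm M (\<lambda>x. s n x - f x)"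
          by (simp add: l2_norm_nonneg)
        show "(\<lambda>n. l2_norm M (\<lambda>x. r n x - u x) + norm z * l2_norm M (\<lambda>x. s n x - f x)) \<longlonglongrightarrow> 0"
          using tendsto_add[OF u(2) tendsto_mult_right_zero[OF f(2)]] by simp
      qed
    qed
    define g where "g = (\<lambda>x. k x - u x)"
    have sqg: "square_integrable M g" unfolding g_def by (intro square_integrable_diff k u)
    have gle: "(l2_norm M g)\<^sup>2 \<le> d"
    proof -
      have "l2_norm M g \<le> l2_norm M (\<lambda>x. k x - r n x) + l2_norm M (\<lambda>x. r n x - u x)" for n
        using l2_norm_triangle[OF square_integrable_diff[OF k sqr] square_integrable_diff[OF sqr u(1)], of n n]
        by (simp add: g_def)
      moreover have "l2_norm M (\<lambda>x. k x - r n x) \<le> sqrt (d + 1 / (real n + 1))" for n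
        using Er[of n] by (intro real_le_rsqrt) simp
      ultimately have "l2_norm M g \<le> sqrt (d + 1 / (real n + 1)) + l2_norm M (\<lambda>x. r n x - u x)" for n
        using add_right_mono order_trans by meson
      moreover have "(\<lambda>n. 1 / (real n + 1)) \<longlonglongrightarrow> 0"
        using LIMSEQ_inverse_real_of_nat by (simp add: inverse_eq_divide add.commute)
      then have "(\<lambda>n. sqrt (d + 1 / (real n + 1)) + l2_norm M (\<lambda>x. r n x - u x)) \<longlonglongrightarrow> sqrt (d + 0) + 0"
        by (intro tendsto_add tendsto_real_sqrt tendsto_const u)
      ultimately have "l2_norm M g \<le> sqrt d"
        using LIMSEQ_le_const[of _ "sqrt (d + 0) + 0" "l2_norm M g"] by auto
      moreover have "0 \<le> d" unfolding d_def using self_adjoint_zero[OF T]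
        by (intro cInf_greatest) (auto simp: E_def)
      ultimately show ?thesis
        using power_mono[OF _ l2_norm_nonneg, of M g "sqrt d" 2] by simp
    qed
    have orth: "l2_inner M g (\<lambda>x. q x - z * p x) = 0" if p: "(p, q) \<in> T" for p q
    proof -
      let ?e = "\<lambda>x. q x - z * p x"
      let ?w = "l2_inner M g ?e"
      have sqe: "square_integrable M ?e"
        using self_adjoint_square_integrable[OF T p] by (intro square_integrable_diff square_integrable_cmult)
      \<comment> \<open>Moving the minimiser by a multiple of \<open>?e\<close> stays in the range
        and cannot reduce the distance; expanding the square gives a first order term bounded by a
        second order one.\<close>
      have var: "2 * Re (c * ?w) \<le> (norm c)\<^sup>2 * (l2_norm M ?e)\<^sup>2" for c
      proof -
        have "d \<le> E (\<lambda>x. f x + c * p x, \<lambda>x. (u x + z * f x) + c * q x)"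
          by (intro dle self_adjoint_add_cmult[OF T] fT p)
        also have "\<dots> = (l2_norm M (\<lambda>x. g x + (-c) * ?e x))\<^sup>2"
          by (simp add: E_def g_def algebra_simps)
        also have "\<dots> = (l2_norm M g)\<^sup>2 + 2 * Re ((-c) * ?w) + (norm c)\<^sup>2 * (l2_norm M ?e)\<^sup>2"
          unfolding l2_norm_add_sq[OF sqg square_integrable_cmult[OF sqe]]
          unfolding l2_inner_cmult_right l2_norm_cmult by (simp add: power_mult_distrib)
        finally show ?thesis using gle by simp
      qed
      define N where "N = (l2_norm M ?e)\<^sup>2"
      have "0 \<le> N" by (simp add: N_def)
      \<comment> \<open>For \<open>c = t * cnj ?w\<close> the left side of \<open>var\<close> is
        \<open>2 * t * (norm ?w)\<^sup>2\<close>, and this \<open>t\<close> is so small that the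
        quadratic right side cannot reach it unless \<open>?w\<close> is 0.\<close>
      define t where "t = 1 / (N + 1)"
      have "0 < t" "t * N < 1" using \<open>0 \<le> N\<close> by (auto simp: t_def field_simps)
      have "2 * (t * (norm ?w)\<^sup>2) \<le> (t * norm ?w)\<^sup>2 * N"
      proof -
        have "Re (complex_of_real t * cnj ?w * ?w) = t * (norm ?w)\<^sup>2"
          by (simp add: mult.assoc complex_norm_square[symmetric] mult.commute[of "cnj _"] del: of_real_power
              flip: of_real_mult of_real_power)
        then show ?thesis
          using var[of "of_real t * cnj ?w"] \<open>0 < t\<close> by (simp add: N_def norm_mult)
      qed
      then have "t * (2 - t * N) * (norm ?w)\<^sup>2 \<le> 0" by (simp add: power2_eq_square algebra_simps)
      moreover have "0 < t * (2 - t * N)" using \<open>0 < t\<close> \<open>t * N < 1\<close> by simp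
      ultimately have "(norm ?w)\<^sup>2 \<le> 0"
        by (metis mult_le_0_iff not_less)
      then show ?thesis by simp
    qed
    have "(g, \<lambda>x. cnj z * g x) \<in> T"
    proof (rule self_adjointI[OF T sqg square_integrable_cmult[OF sqg]])
      fix p q assume p: "(p, q) \<in> T"
      note sq = self_adjoint_square_integrable[OF T p]
      show "l2_inner M g q = l2_inner M (\<lambda>x. cnj z * g x) p"
        using orth[OF p] 
        unfolding l2_inner_diff_right[OF sqg sq(2) square_integrable_cmult[OF sq(1)]]
          l2_inner_cmult_right l2_inner_cmult_left by simp
    qed
    from C'[OF this] have "l2_norm M g = 0"
      using l2_norm_nonneg[of M g] by (simp add: l2_norm_zero)
    then have "AE x in M. g x = 0" by (rule l2_norm_eq_0_AE[OF sqg])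
    then have "AE x in M. (u x + z * f x) - z * f x = k x" 
      by eventually_elim (simp add: g_def)
    then show ?thesis
      by (intro bexI[OF _ fT]) (simp only: split_conv)
  qed
  moreover have "\<exists>C. \<forall>(f, h)\<in>T. l2_norm M f \<le> C * l2_norm M (\<lambda>x. h x - z * f x)"
    using C by (intro exI[of _ C]) auto
  ultimately show ?thesis unfolding resolvent_set_def by blast
qed

text \<open>Symmetry makes the inner product of \<open>f\<close> and \<open>h\<close> real, so the
  imaginary part of that of \<open>f\<close> and \<open>h - z f\<close> comes from \<open>z\<close>
  alone; Cauchy-Schwarz finishes.\<close>

lemma self_adjoint_nonreal_bound:
  assumes T: "self_adjoint_operator M T" and f: "(f, h) \<in> T"
  shows "\<bar>Im z\<bar> * l2_norm M f \<le> l2_norm M (\<lambda>x. h x - z * f x)"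
proof (cases "l2_norm M f = 0")
  case False
  then have pos: "0 < l2_norm M f" using l2_norm_nonneg[of M f] by simp
  note sq = self_adjoint_square_integrable[OF T f]
  have "l2_inner M f h = cnj (l2_inner M f h)"
    using self_adjoint_symmetric[OF T f f] l2_inner_commute[of M f h] by simp
  then have im: "Im (l2_inner M f h) = 0" by (metis Im_complex_of_real complex_cnj_cancel_iff complex_is_Real_iff Reals_cnj_iff)
  have "l2_inner M f (\<lambda>x. h x - z * f x) = l2_inner M f h - z * of_real ((l2_norm M f)\<^sup>2)"
    using sq by (simp only: l2_inner_diff_right square_integrable_cmult l2_inner_cmult_right l2_inner_self)
  then have "Im (l2_inner M f (\<lambda>x. h x - z * f x)) = - Im z * (l2_norm M f)\<^sup>2"
    using im by (simp del: of_real_power)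
  then have "\<bar>Im z\<bar> * (l2_norm M f)\<^sup>2 \<le> norm (l2_inner M f (\<lambda>x. h x - z * f x))"
    using abs_Im_le_cmod[of "l2_inner M f (\<lambda>x. h x - z * f x)"] by (simp add: abs_mult)
  also have "\<dots> \<le> l2_norm M f * l2_norm M (\<lambda>x. h x - z * f x)"
    by (intro l2_Cauchy_Schwarz square_integrable_diff square_integrable_cmult sq)
  finally have "l2_norm M f * (\<bar>Im z\<bar> * l2_norm M f) \<le> l2_norm M f * l2_norm M (\<lambda>x. h x - z * f x)"
    by (simp add: power2_eq_square mult.left_commute)
  then show ?thesis using pos by (simp only: mult_le_cancel_left_pos)
qed (simp add: l2_norm_nonneg)

lemma self_adjoint_nonreal_resolvent:
  assumes T: "self_adjoint_operator M T" and z: "Im z \<noteq> 0"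
  shows "z \<in> resolvent_set M T"
proof (rule self_adjoint_resolventI[OF T])
  fix f h assume f: "(f, h) \<in> T"
  show "l2_norm M f \<le> (1 / \<bar>Im z\<bar>) * l2_norm M (\<lambda>x. h x - z * f x)"
    using self_adjoint_nonreal_bound[OF T f, of z] z by (simp add: field_simps)
  show "l2_norm M f \<le> (1 / \<bar>Im z\<bar>) * l2_norm M (\<lambda>x. h x - cnj z * f x)"
    using self_adjoint_nonreal_bound[OF T f, of "cnj z"] z by (simp add: field_simps)
qed

lemma resolvent_set_bound:
  assumes "z \<in> resolvent_set M T"
  obtains C where "0 < C" "\<And>f h. (f, h) \<in> T \<Longrightarrow> l2_norm M f \<le> C * l2_norm M (\<lambda>x. h x - z * f x)"
proof -
  obtain C where C: "\<And>f h. (f, h) \<in> T \<Longrightarrow> l2_norm M f \<le> C * l2_norm M (\<lambda>x. h x - z * f x)"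
    using assms unfolding resolvent_set_def by blast
  have "l2_norm M f \<le> (\<bar>C\<bar> + 1) * l2_norm M (\<lambda>x. h x - z * f x)" if "(f, h) \<in> T" for f h
    by (rule order_trans[OF C[OF that]], rule mult_right_mono) (auto simp: l2_norm_nonneg)
  with that[of "\<bar>C\<bar> + 1"] show ?thesis by auto
qed

text \<open>Nonreal points always belong to the resolvent set, so only real \<open>z\<close> near
  \<open>z0\<close> need work. There \<open>cnj z = z\<close>, and the bound at \<open>z0\<close>,
  once perturbed, serves as both hypotheses of \<open>self_adjoint_resolventI\<close>.\<close>

lemma self_adjoint_resolvent_open:
  assumes T: "self_adjoint_operator M T"
  shows "open (resolvent_set M T)"
  unfolding open_contains_ball
proof
  fix z0 assume "z0 \<in> resolvent_set M T"
  then obtain C where C: "0 < C" "\<And>f h. (f, h) \<in> T \<Longrightarrow> l2_norm M f \<le> C * l2_norm M (\<lambda>x. h x - z0 * f x)"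
    using resolvent_set_bound by metis
  show "\<exists>e>0. ball z0 e \<subseteq> resolvent_set M T"
  \<comment> \<open>With this radius the perturbation costs at most half of
    \<open>l2_norm M f\<close>, which is absorbed on the left by doubling \<open>C\<close>.\<close>
  proof (intro exI[of _ "1 / (2 * C)"] conjI subsetI)
    fix z assume z: "z \<in> ball z0 (1 / (2 * C))"
    show "z \<in> resolvent_set M T"
    proof (cases "Im z = 0")
      case True
      then have "cnj z = z" by (simp add: complex_eq_iff)
      have "l2_norm M f \<le> (2 * C) * l2_norm M (\<lambda>x. h x - z * f x)" if f: "(f, h) \<in> T" for f h
      proof -
        note sq = self_adjoint_square_integrable[OF T f]
        have "(\<lambda>x. h x - z0 * f x) = (\<lambda>x. (h x - z * f x) + (z - z0) * f x)"
          by (auto simp: algebra_simps)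
        then have "l2_norm M (\<lambda>x. h x - z0 * f x) \<le> l2_norm M (\<lambda>x. h x - z * f x) + norm (z - z0) * l2_norm M f"
          using l2_norm_triangle[OF square_integrable_diff[OF sq(2) square_integrable_cmult[OF sq(1)]]
              square_integrable_cmult[OF sq(1)], of z "z - z0"] by (simp only: l2_norm_cmult)
        also have "norm (z - z0) * l2_norm M f \<le> 1 / (2 * C) * l2_norm M f"
          using z by (intro mult_right_mono) (auto simp: dist_norm norm_minus_commute l2_norm_nonneg)
        finally have "C * l2_norm M (\<lambda>x. h x - z0 * f x) \<le> C * (l2_norm M (\<lambda>x. h x - z * f x) + 1 / (2 * C) * l2_norm M f)"
          using C(1) by simp
        also have "\<dots> = C * l2_norm M (\<lambda>x. h x - z * f x) + l2_norm M f / 2"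
          using C(1) by (simp add: field_simps)
        finally show ?thesis using C(2)[OF f] by simp
      qed
      then show ?thesis
        using self_adjoint_resolventI[OF T, of "2 * C" z "2 * C"] \<open>cnj z = z\<close> by simp
    qed (rule self_adjoint_nonreal_resolvent[OF T])
  qed (use C in simp)
qed

section \<open>Locally absolutely continuous functions\<close>

lemma set_integrable_continuous_mult:
  fixes f g :: "real \<Rightarrow> complex"
  assumes f: "continuous_on {c..d} f" and g: "set_integrable lebesgue {c..d} g"
  shows "set_integrable lebesgue {c..d} (\<lambda>x. f x * g x)"
proof -
  have "bounded (f ` {c..d})"
    using f by (intro compact_imp_bounded compact_continuous_image) auto
  then obtain B where "\<forall>y\<in>f ` {c..d}. norm y \<le> B" by (auto simp: bounded_iff)
  then have B: "\<And>x. x \<in> {c..d} \<Longrightarrow> norm (f x) \<le> B" by blast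
  have m: "(\<lambda>x. indicator {c..d} x *\<^sub>R f x) \<in> borel_measurable lebesgue"
    using borel_measurable_continuous_on_indicator[OF _ f] by (auto intro: measurable_completion)
  have "(\<lambda>x. (indicator {c..d} x *\<^sub>R f x) * (indicator {c..d} x *\<^sub>R g x)) \<in> borel_measurable lebesgue"
    using m g unfolding set_integrable_def by (intro borel_measurable_times) auto
  also have "(\<lambda>x. (indicator {c..d} x *\<^sub>R f x) * (indicator {c..d} x *\<^sub>R g x))
      = (\<lambda>x. indicator {c..d} x *\<^sub>R (f x * g x))"
    by (auto simp: indicator_def)
  finally have meas: "(\<lambda>x. indicator {c..d} x *\<^sub>R (f x * g x)) \<in> borel_measurable lebesgue" .
  have "integrable lebesgue (\<lambda>x. B * norm (indicator {c..d} x *\<^sub>R g x))"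
    using g unfolding set_integrable_def by (intro integrable_mult_right integrable_norm)
  then show ?thesis unfolding set_integrable_def
  proof (rule Bochner_Integration.integrable_bound[OF _ meas])
    show "AE x in lebesgue. norm (indicator {c..d} x *\<^sub>R (f x * g x)) \<le> norm (B * norm (indicator {c..d} x *\<^sub>R g x))"
    proof (rule AE_I2)
      fix x show "norm (indicator {c..d} x *\<^sub>R (f x * g x)) \<le> norm (B * norm (indicator {c..d} x *\<^sub>R g x))"
      proof (cases "x \<in> {c..d}")
        case True
        then have "norm (f x) * norm (g x) \<le> \<bar>B\<bar> * norm (g x)"
          using B[OF True] by (intro mult_right_mono) auto
        then show ?thesis using True by (simp add: norm_mult abs_mult)
      qed simp
    qed
  qed
qed

context
  fixes a b :: ereal
begin

lemma ac_has_integral: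
  "ac_derivative a b f g \<Longrightarrow> a < ereal c \<Longrightarrow> c \<le> d \<Longrightarrow> ereal d < b \<Longrightarrow> (g has_integral (f d - f c)) {c..d}"
  by (auto simp: ac_derivative_def)

lemma ac_set_integrable:
  "ac_derivative a b f g \<Longrightarrow> a < ereal c \<Longrightarrow> ereal d < b \<Longrightarrow> set_integrable lebesgue {c..d} g"
  by (auto simp: ac_derivative_def locally_integrable_def)

lemma einterval_nbhd:
  assumes "x \<in> einterval a b"
  obtains c d where "a < ereal c" "c < x" "x < d" "ereal d < b"
proof -
  obtain c where "a < ereal c" "ereal c < ereal x" using assms ereal_dense2 by (force simp: einterval_def)
  moreover obtain d where "ereal x < ereal d" "ereal d < b" using assms ereal_dense2 by (force simp: einterval_def)
  ultimately show ?thesis using that[of c d] by simp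
qed

lemma Icc_subset_einterval: "a < ereal c \<Longrightarrow> ereal d < b \<Longrightarrow> {c..d} \<subseteq> einterval a b"
  by (auto simp: einterval_def intro: less_le_trans[of a "ereal c"] le_less_trans[of _ "ereal d" b])

lemma ac_continuous_at:
  assumes f: "ac_derivative a b f g" and x: "x \<in> einterval a b"
  shows "isCont f x"
proof -
  obtain c d where cd: "a < ereal c" "c < x" "x < d" "ereal d < b" by (rule einterval_nbhd[OF x])
  have eq: "f y = f c + integral {c..y} g" if "y \<in> {c..d}" for y
  proof -
    have "ereal y < b" using that cd(4) by (meson atLeastAtMost_iff ereal_less_eq(3) le_less_trans)
    then have "(g has_integral (f y - f c)) {c..y}"
      using that cd by (intro ac_has_integral[OF f]) auto
    then show ?thesis by (simp add: integral_unique)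
  qed
  have "g integrable_on {c..d}" using ac_has_integral[OF f, of c d] cd by (auto simp: integrable_on_def)
  then have "continuous_on {c..d} (\<lambda>y. f c + integral {c..y} g)"
    by (intro continuous_intros indefinite_integral_continuous_1)
  then have "continuous_on {c..d} f" by (rule continuous_on_eq) (rule eq[symmetric])
  then have "continuous_on {c<..<d} f" by (rule continuous_on_subset) auto
  then show ?thesis using cd by (simp add: continuous_on_eq_continuous_at)
qed

lemma ac_continuous_on: "ac_derivative a b f g \<Longrightarrow> continuous_on (einterval a b) f"
  by (intro continuous_at_imp_continuous_on ballI ac_continuous_at)

lemma ac_cong:
  assumes f: "ac_derivative a b f g" and "\<And>x. x \<in> einterval a b \<Longrightarrow> f x = f' x"
    "\<And>x. x \<in> einterval a b \<Longrightarrow> g x = g' x"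
  shows "ac_derivative a b f' g'"
  unfolding ac_derivative_def locally_integrable_def
proof (intro conjI allI impI)
  fix c d assume cd: "a < ereal c" "ereal d < b"
  show "set_integrable lebesgue {c..d} g'"
    using ac_set_integrable[OF f cd] Icc_subset_einterval[OF cd] assms(3)
    by (subst set_integrable_cong[OF refl refl, of _ _ g]) auto
next
  fix c d assume cd: "a < ereal c" "c \<le> d" "ereal d < b"
  have sub: "{c..d} \<subseteq> einterval a b" by (rule Icc_subset_einterval) (use cd in auto)
  then have "c \<in> einterval a b" "d \<in> einterval a b" using cd(2) by auto
  with ac_has_integral[OF f cd] have "(g has_integral (f' d - f' c)) {c..d}" by (simp add: assms(2))
  then show "(g' has_integral (f' d - f' c)) {c..d}"
    by (rule has_integral_eq[rotated]) (use sub assms(3) in auto)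
qed

lemma ac_add:
  assumes "ac_derivative a b f f'" "ac_derivative a b g g'"
  shows "ac_derivative a b (\<lambda>x. f x + g x) (\<lambda>x. f' x + g' x)"
  unfolding ac_derivative_def locally_integrable_def
proof (intro conjI allI impI)
  fix c d assume "a < ereal c" "ereal d < b"
  then show "set_integrable lebesgue {c..d} (\<lambda>x. f' x + g' x)"
    by (intro set_integral_add ac_set_integrable[OF assms(1)] ac_set_integrable[OF assms(2)])
next
  fix c d assume "a < ereal c" "c \<le> d" "ereal d < b"
  from has_integral_add[OF ac_has_integral[OF assms(1) this] ac_has_integral[OF assms(2) this]]
  show "((\<lambda>x. f' x + g' x) has_integral (f d + g d - (f c + g c))) {c..d}"
    by (simp add: algebra_simps)
qed

lemma ac_cmult:
  assumes "ac_derivative a b f f'"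
  shows "ac_derivative a b (\<lambda>x. k * f x) (\<lambda>x. k * f' x)"
  unfolding ac_derivative_def locally_integrable_def
proof (intro conjI allI impI)
  fix c d assume "a < ereal c" "ereal d < b"
  then show "set_integrable lebesgue {c..d} (\<lambda>x. k * f' x)"
    by (intro set_integrable_mult_right ac_set_integrable[OF assms])
next
  fix c d assume "a < ereal c" "c \<le> d" "ereal d < b"
  from has_integral_mult_right[OF ac_has_integral[OF assms this], of k]
  show "((\<lambda>x. k * f' x) has_integral (k * f d - k * f c)) {c..d}"
    by (simp add: algebra_simps)
qed

lemma ac_cnj:
  assumes "ac_derivative a b f f'"
  shows "ac_derivative a b (\<lambda>x. cnj (f x)) (\<lambda>x. cnj (f' x))"
  unfolding ac_derivative_def locally_integrable_def
proof (intro conjI allI impI)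
  fix c d assume "a < ereal c" "ereal d < b"
  then have "integrable lebesgue (\<lambda>x. cnj (indicator {c..d} x *\<^sub>R f' x))"
    using ac_set_integrable[OF assms] unfolding set_integrable_def complex_integrable_cnj by blast
  then show "set_integrable lebesgue {c..d} (\<lambda>x. cnj (f' x))"
    unfolding set_integrable_def by simp
next
  fix c d assume "a < ereal c" "c \<le> d" "ereal d < b"
  from ac_has_integral[OF assms this]
  show "((\<lambda>x. cnj (f' x)) has_integral (cnj (f d) - cnj (f c))) {c..d}"
    by (subst complex_cnj_diff[symmetric], subst (asm) has_integral_cnj[symmetric]) (simp add: o_def)
qed

text \<open>On a short interval \<open>[s,t]\<close> the defect in the product rule is at most \<open>e\<close> times the integral
  of \<open>|f'| + |g'|\<close>, where \<open>e\<close> bounds the oscillation of \<open>f\<close> and \<open>g\<close>; such bounds add up.\<close>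

lemma ac_mult:
  fixes f g :: "real \<Rightarrow> complex"
  assumes f: "ac_derivative a b f f'" and g: "ac_derivative a b g g'"
  shows "ac_derivative a b (\<lambda>x. f x * g x) (\<lambda>x. f' x * g x + f x * g' x)"
proof -
  have si: "set_integrable lebesgue {c..d} (\<lambda>x. f' x * g x + f x * g' x)"
    if "a < ereal c" "ereal d < b" for c d
  proof -
    have sub: "{c..d} \<subseteq> einterval a b" using that by (rule Icc_subset_einterval)
    have "set_integrable lebesgue {c..d} (\<lambda>x. g x * f' x)"
      by (rule set_integrable_continuous_mult[OF continuous_on_subset[OF ac_continuous_on[OF g] sub]
            ac_set_integrable[OF f that]])
    moreover have "set_integrable lebesgue {c..d} (\<lambda>x. f x * g' x)"
      by (rule set_integrable_continuous_mult[OF continuous_on_subset[OF ac_continuous_on[OF f] sub]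
            ac_set_integrable[OF g that]])
    ultimately show ?thesis using set_integral_add(1) by (simp add: mult.commute)
  qed
  have "((\<lambda>x. f' x * g x + f x * g' x) has_integral (f d * g d - f c * g c)) {c..d}"
    if cd: "a < ereal c" "c \<le> d" "ereal d < b" for c d
  proof -
    let ?p = "\<lambda>x. f' x * g x + f x * g' x"
    let ?v = "\<lambda>x. norm (f' x) + norm (g' x)"
    have ins: "a < ereal s" "ereal t < b" if "c \<le> s" "t \<le> d" for s t
      using that cd by (auto intro: less_le_trans[of a "ereal c"] le_less_trans[of _ "ereal d" b])
    have pint: "?p integrable_on {s..t}" if "c \<le> s" "t \<le> d" for s t
      using si[OF ins[OF that]] by (rule set_lebesgue_integral_eq_integral)
    have vint: "?v integrable_on {s..t}" if "c \<le> s" "t \<le> d" for s t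
      using ac_set_integrable[OF f ins[OF that]] ac_set_integrable[OF g ins[OF that]]
      by (intro integrable_add) (auto simp: absolutely_integrable_on_def)
    have main: "norm (f d * g d - f c * g c - integral {c..d} ?p) \<le> e * integral {c..d} ?v" if e: "0 < e" for e
    proof -
      define P where "P = (\<lambda>s t. c \<le> s \<and> s \<le> t \<and> t \<le> d \<longrightarrow>
         norm (f t * g t - f s * g s - integral {s..t} ?p) \<le> e * integral {s..t} ?v)"
      \<comment> \<open>The defect estimate is additive over adjacent intervals, so it is enough to
        prove it on short intervals around each point.\<close>
      have "P c d" using cd(2)
      proof (induction rule: Bolzano)
        case (trans s r t)
        show ?case unfolding P_def
        proof (intro impI)
          assume st: "c \<le> s \<and> s \<le> t \<and> t \<le> d"
          have 1: "integral {s..t} ?p = integral {s..r} ?p + integral {r..t} ?p"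
            by (rule Henstock_Kurzweil_Integration.integral_combine[symmetric]) (use trans st pint in auto)
          have 2: "integral {s..t} ?v = integral {s..r} ?v + integral {r..t} ?v"
            by (rule Henstock_Kurzweil_Integration.integral_combine[symmetric]) (use trans st vint in auto)
          have "norm (f t * g t - f s * g s - integral {s..t} ?p)
             \<le> norm (f r * g r - f s * g s - integral {s..r} ?p) + norm (f t * g t - f r * g r - integral {r..t} ?p)"
            unfolding 1 by (rule order_trans[OF eq_refl norm_triangle_ineq]) (simp add: algebra_simps)
          also have "\<dots> \<le> e * integral {s..r} ?v + e * integral {r..t} ?v"
            using trans st unfolding P_def by (intro add_mono) auto
          finally show "norm (f t * g t - f s * g s - integral {s..t} ?p) \<le> e * integral {s..t} ?v"
            unfolding 2 by (simp add: distrib_left)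
        qed
      next
        case (local x)
        have xin: "x \<in> einterval a b" using local ins by (auto simp: einterval_def)
        obtain d1 where d1: "d1 > 0" "\<And>y. dist y x < d1 \<Longrightarrow> dist (f y) (f x) < e / 2"
          using ac_continuous_at[OF f xin] e unfolding continuous_at_eps_delta by (meson half_gt_zero)
        obtain d2 where d2: "d2 > 0" "\<And>y. dist y x < d2 \<Longrightarrow> dist (g y) (g x) < e / 2"
          using ac_continuous_at[OF g xin] e unfolding continuous_at_eps_delta by (meson half_gt_zero)
        have "P s t" if st: "s \<le> x" "x \<le> t" "t - s < min d1 d2" for s t
          unfolding P_def
        proof (intro impI)
          assume A: "c \<le> s \<and> s \<le> t \<and> t \<le> d"
          have near: "norm (f y - f y') \<le> e" "norm (g y - g y') \<le> e" if "y \<in> {s..t}" "y' \<in> {s..t}" for y y'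
          proof -
            have "dist y x < d1" "dist y' x < d1" "dist y x < d2" "dist y' x < d2"
              using that st by (auto simp: dist_real_def)
            then have "dist (f y) (f x) < e / 2" "dist (f y') (f x) < e / 2"
              "dist (g y) (g x) < e / 2" "dist (g y') (g x) < e / 2"
              using d1(2) d2(2) by auto
            then have "dist (f y) (f y') < e" "dist (g y) (g y') < e"
              by (auto intro: dist_triangle_half_l)
            then show "norm (f y - f y') \<le> e" "norm (g y - g y') \<le> e" by (auto simp: dist_norm)
          qed
          have F: "(f' has_integral (f t - f s)) {s..t}" and G: "(g' has_integral (g t - g s)) {s..t}"
            using A ins by (auto intro!: ac_has_integral[OF f] ac_has_integral[OF g])
          \<comment> \<open>Freezing \<open>g\<close> at the right end and \<open>f\<close> at the
            left end makes the first two terms telescope to \<open>f t * g t - f s * g s\<close>;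
            what remains is controlled by the oscillation.\<close>
          have "((\<lambda>r. f' r * g t + f s * g' r - ?p r) has_integral
             ((f t - f s) * g t + f s * (g t - g s) - integral {s..t} ?p)) {s..t}"
            using A pint by (intro has_integral_diff has_integral_add has_integral_mult_left has_integral_mult_right
                F G integrable_integral) auto
          then have I: "((\<lambda>r. f' r * g t + f s * g' r - ?p r) has_integral
             (f t * g t - f s * g s - integral {s..t} ?p)) {s..t}" by (simp add: algebra_simps)
          have "norm (f' r * g t + f s * g' r - ?p r) \<le> e * ?v r" if r: "r \<in> {s..t}" for r
          proof -
            have "f' r * g t + f s * g' r - ?p r = f' r * (g t - g r) + (f s - f r) * g' r"
              by (simp add: algebra_simps)
            also have "norm \<dots> \<le> norm (f' r) * norm (g t - g r) + norm (f s - f r) * norm (g' r)"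
              by (rule order_trans[OF norm_triangle_ineq]) (simp add: norm_mult)
            also have "\<dots> \<le> norm (f' r) * e + e * norm (g' r)"
              using near[of s r] near[of t r] r A by (intro add_mono mult_left_mono mult_right_mono) auto
            finally show ?thesis by (simp add: algebra_simps)
          qed
          then have "norm (integral {s..t} (\<lambda>r. f' r * g t + f s * g' r - ?p r)) \<le> integral {s..t} (\<lambda>r. e * ?v r)"
            using I A vint by (intro Henstock_Kurzweil_Integration.integral_norm_bound_integral integrable_on_mult_right)
              (auto simp: integrable_on_def)
          then show "norm (f t * g t - f s * g s - integral {s..t} ?p) \<le> e * integral {s..t} ?v"
            unfolding integral_unique[OF I] integral_mult_right by simp
        qed
        then show ?case using d1(1) d2(1) by (intro exI[of _ "min d1 d2"]) auto
      qed
      then show ?thesis using cd(2) by (simp add: P_def)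
    qed
    have "f d * g d - f c * g c - integral {c..d} ?p = 0"
    proof (rule ccontr)
      let ?D = "norm (f d * g d - f c * g c - integral {c..d} ?p)" and ?V = "integral {c..d} ?v"
      assume "f d * g d - f c * g c - integral {c..d} ?p \<noteq> 0"
      then have D: "0 < ?D" by simp
      have V: "0 \<le> ?V" by (rule integral_nonneg) (use vint in auto)
      \<comment> \<open>This \<open>e\<close> makes the bound at most \<open>?D / 2\<close>; the
        summand 1 keeps the denominator positive when \<open>?V = 0\<close>.\<close>
      have "?D \<le> ?D / (2 * (?V + 1)) * ?V" using main[of "?D / (2 * (?V + 1))"] D V by simp
      also have "\<dots> \<le> ?D / 2" using D V by (simp add: field_simps)
      finally show False using D by simp
    qed
    then show ?thesis using integrable_integral[OF pint[of c d]] by simp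
  qed
  then show ?thesis using si unfolding ac_derivative_def locally_integrable_def by blast
qed

lemma ac_has_vector_derivative:
  assumes u: "ac_derivative a b u u'" and c: "continuous_on (einterval a b) u'"
    and x: "x \<in> einterval a b"
  shows "(u has_vector_derivative u' x) (at x)"
proof -
  obtain c d where cd: "a < ereal c" "c < x" "x < d" "ereal d < b" by (rule einterval_nbhd[OF x])
  have sub: "{c..d} \<subseteq> einterval a b" by (rule Icc_subset_einterval) (use cd in auto)
  have eq: "u y = u c + integral {c..y} u'" if "y \<in> {c..d}" for y
  proof -
    have "ereal y < b" using that cd(4) by (meson atLeastAtMost_iff ereal_less_eq(3) le_less_trans)
    then have "(u' has_integral (u y - u c)) {c..y}"
      using that cd by (intro ac_has_integral[OF u]) auto
    then show ?thesis by (simp add: integral_unique)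
  qed
  have "((\<lambda>y. integral {c..y} u') has_vector_derivative u' x) (at x within {c..d})"
    by (rule integral_has_vector_derivative) (use cd sub c in \<open>auto intro: continuous_on_subset\<close>)
  then have "((\<lambda>y. u c + integral {c..y} u') has_vector_derivative 0 + u' x) (at x within {c..d})"
    by (rule has_vector_derivative_add[OF has_vector_derivative_const])
  then have "((\<lambda>y. u c + integral {c..y} u') has_vector_derivative u' x) (at x)"
    using cd by (simp add: at_within_Icc_at)
  then show ?thesis
  proof (rule has_vector_derivative_transform_within_open[where S="{c<..<d}"])
    show "u c + integral {c..y} u' = u y" if "y \<in> {c<..<d}" for y
      by (rule eq[symmetric]) (use that in auto)
  qed (use cd in auto)
qed

lemma ac_C1:
  assumes f: "\<And>x. (f has_vector_derivative f' x) (at x)" and c: "continuous_on UNIV f'"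
  shows "ac_derivative a b f f'"
  unfolding ac_derivative_def locally_integrable_def
proof (intro conjI allI impI)
  fix c d
  show "set_integrable lebesgue {c..d} f'"
    by (intro absolutely_integrable_continuous_real continuous_on_subset[OF c]) auto
next
  fix c d :: real assume "c \<le> d"
  then show "(f' has_integral (f d - f c)) {c..d}"
    by (rule fundamental_theorem_of_calculus) (rule has_vector_derivative_at_within[OF f])
qed

end

text \<open>Puts almost-everywhere statements into the form that \<open>has_integral_spike\<close>
  consumes.\<close>

lemma AE_lebesgue_on_negligible:
  assumes "AE x in lebesgue_on S. P x" "S \<in> sets lebesgue"
  obtains N where "negligible N" "\<forall>x\<in>S - N. P x"
proof -
  have "AE x in lebesgue. x \<in> S \<longrightarrow> P x" using assms by (simp add: AE_restrict_space_iff)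
  then obtain N where N: "N \<in> null_sets lebesgue" "{x \<in> space lebesgue. \<not> (x \<in> S \<longrightarrow> P x)} \<subseteq> N"
    by (auto simp: eventually_ae_filter)
  then have "negligible N" by (simp add: negligible_iff_null_sets)
  then show ?thesis using that[of N] N(2) by auto
qed

lemma einterval_lebesgue [simp]: "einterval a b \<in> sets lebesgue"
  by (simp add: borel_open)

section \<open>Solutions of the differential equation and Lagrange's identity\<close>

lemma D1_cong_open:
  assumes "open S" "x \<in> S" "\<And>y. y \<in> S \<Longrightarrow> f y = g y"
  shows "D1 f x = D1 g x"
  using assms by (intro vector_derivative_cong_eq) (auto simp: eventually_nhds)

text \<open>The Wronskian of the conjugate of \<open>f\<close> with \<open>g\<close>: this is the
  boundary term that integration by parts produces for the sesquilinear form
  \<open>l2_inner\<close>.\<close>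

definition cnj_wronskian :: "(real \<Rightarrow> complex) \<Rightarrow> (real \<Rightarrow> complex) \<Rightarrow> real \<Rightarrow> complex" where
  "cnj_wronskian f g x = cnj (f x) * D1 g x - cnj (D1 f x) * g x"

context
  fixes a b :: ereal and q :: "real \<Rightarrow> real"
begin

text \<open>\<open>tau_eq\<close> is phrased with \<open>D1 u\<close>, which is under control only
  inside the interval. A candidate \<open>u1\<close> is itself continuous there, hence is the
  classical derivative, and \<open>ac_cong\<close> exchanges the two.\<close>

lemma tau_eqI:
  assumes u: "ac_derivative a b u u1" "ac_derivative a b u1 u2"
    and h: "AE x in lebesgue_ival a b. - u2 x + complex_of_real (q x) * u x = h x"
  shows "tau_eq a b q u h" "\<And>x. x \<in> einterval a b \<Longrightarrow> D1 u x = u1 x"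
proof -
  show D: "D1 u x = u1 x" if "x \<in> einterval a b" for x
    by (rule vector_derivative_at) (rule ac_has_vector_derivative[OF u(1) ac_continuous_on[OF u(2)] that])
  have "ac_derivative a b u (D1 u)" by (rule ac_cong[OF u(1)]) (simp_all add: D)
  moreover have "ac_derivative a b (D1 u) u2" by (rule ac_cong[OF u(2)]) (simp_all add: D)
  ultimately show "tau_eq a b q u h" using h unfolding tau_eq_def by blast
qed

lemma tau_eqE:
  assumes "tau_eq a b q u h"
  obtains u2 where "ac_derivative a b u (D1 u)" "ac_derivative a b (D1 u) u2"
    "AE x in lebesgue_ival a b. - u2 x + complex_of_real (q x) * u x = h x"
  using assms unfolding tau_eq_def by blast

lemma tau_eq_continuous:
  assumes "tau_eq a b q u h"
  shows "continuous_on (einterval a b) u" "continuous_on (einterval a b) (D1 u)"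
  using assms by (auto elim!: tau_eqE intro: ac_continuous_on)

lemma tau_eq_lincomb:
  assumes u: "tau_eq a b q u h" and p: "tau_eq a b q p k"
  shows "tau_eq a b q (\<lambda>x. u x + c * p x) (\<lambda>x. h x + c * k x)"
    and "\<And>x. x \<in> einterval a b \<Longrightarrow> D1 (\<lambda>x. u x + c * p x) x = D1 u x + c * D1 p x"
proof -
  obtain u2 where u2: "ac_derivative a b u (D1 u)" "ac_derivative a b (D1 u) u2"
    "AE x in lebesgue_ival a b. - u2 x + complex_of_real (q x) * u x = h x" using u by (rule tau_eqE)
  obtain p2 where p2: "ac_derivative a b p (D1 p)" "ac_derivative a b (D1 p) p2"
    "AE x in lebesgue_ival a b. - p2 x + complex_of_real (q x) * p x = k x" using p by (rule tau_eqE)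
  have AE: "AE x in lebesgue_ival a b.
      - (u2 x + c * p2 x) + complex_of_real (q x) * (u x + c * p x) = h x + c * k x"
    using u2(3) p2(3) by eventually_elim (auto simp: algebra_simps)
  note * = tau_eqI[OF ac_add[OF u2(1) ac_cmult[OF p2(1)]] ac_add[OF u2(2) ac_cmult[OF p2(2)]] AE]
  show "tau_eq a b q (\<lambda>x. u x + c * p x) (\<lambda>x. h x + c * k x)" by (rule *(1))
  show "D1 (\<lambda>x. u x + c * p x) x = D1 u x + c * D1 p x" if "x \<in> einterval a b" for x
    by (rule *(2)[OF that])
qed

lemma tau_eq_cnj:
  assumes u: "tau_eq a b q u h"
  shows "tau_eq a b q (\<lambda>x. cnj (u x)) (\<lambda>x. cnj (h x))"
    and "\<And>x. x \<in> einterval a b \<Longrightarrow> D1 (\<lambda>x. cnj (u x)) x = cnj (D1 u x)"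
proof -
  obtain u2 where u2: "ac_derivative a b u (D1 u)" "ac_derivative a b (D1 u) u2"
    "AE x in lebesgue_ival a b. - u2 x + complex_of_real (q x) * u x = h x" using u by (rule tau_eqE)
  have AE: "AE x in lebesgue_ival a b. - cnj (u2 x) + complex_of_real (q x) * cnj (u x) = cnj (h x)"
    using u2(3)
  proof eventually_elim
    case (elim x)
    show ?case unfolding elim[symmetric] by simp
  qed
  note * = tau_eqI[OF ac_cnj[OF u2(1)] ac_cnj[OF u2(2)] AE]
  show "tau_eq a b q (\<lambda>x. cnj (u x)) (\<lambda>x. cnj (h x))" by (rule *(1))
  show "D1 (\<lambda>x. cnj (u x)) x = cnj (D1 u x)" if "x \<in> einterval a b" for x
    by (rule *(2)[OF that])
qed

text \<open>In the difference of the two product rules the products of first derivatives cancel, and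
  the potential terms cancel because \<open>q\<close> is real.\<close>

lemma Lagrange_identity:
  assumes p: "tau_eq a b q p k" and u: "tau_eq a b q u h"
    and st: "a < ereal s" "s \<le> t" "ereal t < b"
  shows "((\<lambda>x. cnj (p x) * h x - cnj (k x) * u x) has_integral
           (cnj_wronskian p u s - cnj_wronskian p u t)) {s..t}"
proof -
  obtain u2 where u2: "ac_derivative a b u (D1 u)" "ac_derivative a b (D1 u) u2"
    "AE x in lebesgue_ival a b. - u2 x + complex_of_real (q x) * u x = h x" using u by (rule tau_eqE)
  obtain p2 where p2: "ac_derivative a b p (D1 p)" "ac_derivative a b (D1 p) p2"
    "AE x in lebesgue_ival a b. - p2 x + complex_of_real (q x) * p x = k x" using p by (rule tau_eqE)
  have 1: "((\<lambda>x. cnj (D1 p x) * D1 u x + cnj (p x) * u2 x) has_integral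
      (cnj (p t) * D1 u t - cnj (p s) * D1 u s)) {s..t}"
    by (rule ac_has_integral[OF ac_mult[OF ac_cnj[OF p2(1)] u2(2)] st])
  have 2: "((\<lambda>x. cnj (p2 x) * u x + cnj (D1 p x) * D1 u x) has_integral
      (cnj (D1 p t) * u t - cnj (D1 p s) * u s)) {s..t}"
    by (rule ac_has_integral[OF ac_mult[OF ac_cnj[OF p2(2)] u2(1)] st])
  have 3: "((\<lambda>x. (cnj (p2 x) * u x + cnj (D1 p x) * D1 u x) - (cnj (D1 p x) * D1 u x + cnj (p x) * u2 x))
     has_integral (cnj_wronskian p u s - cnj_wronskian p u t)) {s..t}"
    using has_integral_diff[OF 2 1] by (simp add: cnj_wronskian_def algebra_simps)
  have "AE x in lebesgue_ival a b. cnj (p x) * h x - cnj (k x) * u x =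
      (cnj (p2 x) * u x + cnj (D1 p x) * D1 u x) - (cnj (D1 p x) * D1 u x + cnj (p x) * u2 x)"
    using u2(3) p2(3)
  proof eventually_elim
    case (elim x)
    show ?case unfolding elim(1)[symmetric] elim(2)[symmetric] by (simp add: algebra_simps)
  qed
  then obtain N where N: "negligible N" "\<forall>x\<in>einterval a b - N. cnj (p x) * h x - cnj (k x) * u x =
      (cnj (p2 x) * u x + cnj (D1 p x) * D1 u x) - (cnj (D1 p x) * D1 u x + cnj (p x) * u2 x)"
    by (rule AE_lebesgue_on_negligible[OF _ einterval_lebesgue])
  show ?thesis
    by (rule has_integral_spike[OF N(1) _ 3])
       (use N(2) Icc_subset_einterval[OF st(1,3)] in blast)
qed

lemma tau_eq_cutoff:
  fixes k0 k1 k2 :: "real \<Rightarrow> real" and y k :: "real \<Rightarrow> complex"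
  assumes d1: "\<And>x. (k0 has_real_derivative k1 x) (at x)" and d2: "\<And>x. (k1 has_real_derivative k2 x) (at x)"
    and c: "continuous_on UNIV k2" and y: "tau_eq a b q y k"
  shows "tau_eq a b q (\<lambda>x. k0 x * y x) (\<lambda>x. k0 x * k x - 2 * k1 x * D1 y x - k2 x * y x)"
proof -
  obtain y2 where y2: "ac_derivative a b y (D1 y)" "ac_derivative a b (D1 y) y2"
    "AE x in lebesgue_ival a b. - y2 x + complex_of_real (q x) * y x = k x" using y by (rule tau_eqE)
  have c': "continuous_on UNIV k1" using d2 by (meson DERIV_continuous_on has_field_derivative_at_within)
  have vd: "((\<lambda>x. complex_of_real (f x)) has_vector_derivative complex_of_real (f' x)) (at x)"
    if "(f has_real_derivative f' x) (at x)" for f f' :: "real \<Rightarrow> real" and x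
    using that by (intro has_vector_derivative_of_real) (simp add: has_real_derivative_iff_has_vector_derivative)
  have ac1: "ac_derivative a b (\<lambda>x. complex_of_real (k0 x)) (\<lambda>x. complex_of_real (k1 x))"
    by (intro ac_C1 vd d1 continuous_on_of_real c')
  have ac2: "ac_derivative a b (\<lambda>x. complex_of_real (k1 x)) (\<lambda>x. complex_of_real (k2 x))"
    by (intro ac_C1 vd d2 continuous_on_of_real c)
  have AE: "AE x in lebesgue_ival a b.
     - ((k2 x * y x + k1 x * D1 y x) + (k1 x * D1 y x + k0 x * y2 x)) + complex_of_real (q x) * (k0 x * y x)
     = k0 x * k x - 2 * k1 x * D1 y x - k2 x * y x"
    using y2(3)
  proof eventually_elim
    case (elim x)
    show ?case unfolding elim[symmetric] by (simp add: algebra_simps)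
  qed
  show ?thesis
    by (rule tau_eqI[OF ac_mult[OF ac1 y2(1)] ac_add[OF ac_mult[OF ac2 y2(1)] ac_mult[OF ac1 y2(2)]] AE])
qed

end

section \<open>Smooth cutoff functions and square integrability of truncations\<close>

lemma has_real_derivative_clamp:
  fixes p p' :: "real \<Rightarrow> real"
  assumes p: "\<And>x. (p has_real_derivative p' x) (at x)" and 0: "p' 0 = 0" and 1: "p' 1 = 0"
  shows "((\<lambda>t. p (max 0 (min 1 t))) has_real_derivative p' (max 0 (min 1 t))) (at t)"
proof -
  \<comment> \<open>Near an edge point the clamped argument is either \<open>y\<close> or
    \<open>t\<close>, so the new difference quotient is either the old one or 0; both tend to 0
    because \<open>p'\<close> vanishes there.\<close>
  have edge: "((\<lambda>t. p (max 0 (min 1 t))) has_real_derivative p' t) (at t)" if t: "t = 0 \<or> t = 1" for t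
  proof -
    have z: "p' t = 0" and tt: "max 0 (min 1 t) = t" using t 0 1 by auto
    have "((\<lambda>y. (p y - p t) / (y - t)) \<longlongrightarrow> 0) (at t)"
      using p[of t] by (simp add: has_field_derivative_iff z)
    then have "((\<lambda>y. norm ((p y - p t) / (y - t))) \<longlongrightarrow> 0) (at t)" by (simp only: tendsto_norm_zero)
    moreover have "\<forall>\<^sub>F y in at t. norm ((p (max 0 (min 1 y)) - p t) / (y - t)) \<le> norm ((p y - p t) / (y - t))"
      unfolding eventually_at
    proof (intro exI[of _ "1::real"] conjI ballI impI)
      fix y assume y: "y \<noteq> t \<and> dist y t < 1"
      have "max 0 (min 1 y) = y \<or> max 0 (min 1 y) = t" using t y by (auto simp: dist_real_def)
      then show "norm ((p (max 0 (min 1 y)) - p t) / (y - t)) \<le> norm ((p y - p t) / (y - t))" by auto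
    qed simp
    ultimately have "((\<lambda>y. (p (max 0 (min 1 y)) - p t) / (y - t)) \<longlongrightarrow> 0) (at t)"
      by (rule Lim_null_comparison[rotated])
    then show ?thesis by (simp add: has_field_derivative_iff z tt)
  qed
  have const: "((\<lambda>t. p (max 0 (min 1 t))) has_real_derivative 0) (at t)"
    if "open S" "t \<in> S" "\<And>y. y \<in> S \<Longrightarrow> max 0 (min 1 y) = c" for S c
    by (rule has_field_derivative_transform_within_open[OF DERIV_const[of "p c"] that(1,2)]) (simp add: that(3))
  consider "t < 0" | "t = 0 \<or> t = 1" | "0 < t" "t < 1" | "1 < t" by linarith
  then show ?thesis
  proof cases
    case 1 then show ?thesis using const[of "{..<0}" 0] 0 by simp
  next
    case 2 then show ?thesis using edge by auto
  next
    case 3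
    then have "((\<lambda>t. p (max 0 (min 1 t))) has_real_derivative p' t) (at t)"
      by (intro has_field_derivative_transform_within_open[OF p, of "{0<..<1}"]) auto
    then show ?thesis using 3 by simp
  next
    case 4 then show ?thesis using const[of "{1<..}" 1] 1 by simp
  qed
qed

lemma cutoff_exists:
  fixes \<alpha> \<beta> :: real
  assumes "\<alpha> < \<beta>"
  obtains k0 k1 k2 :: "real \<Rightarrow> real"
  where "\<And>x. (k0 has_real_derivative k1 x) (at x)" "\<And>x. (k1 has_real_derivative k2 x) (at x)"
    "continuous_on UNIV k2" "\<And>x. \<bar>k0 x\<bar> \<le> 32"
    "\<And>x. x \<le> \<alpha> \<Longrightarrow> k0 x = 1" "\<And>x. \<beta> \<le> x \<Longrightarrow> k0 x = 0"
    "\<And>x. x \<le> \<alpha> \<or> \<beta> \<le> x \<Longrightarrow> k1 x = 0" "\<And>x. x \<le> \<alpha> \<or> \<beta> \<le> x \<Longrightarrow> k2 x = 0"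
proof -
  define \<gamma> where "\<gamma> = 1 / (\<beta> - \<alpha>)"
  have g: "0 < \<gamma>" using assms by (simp add: \<gamma>_def)
  define c where "c = (\<lambda>x. max 0 (min 1 ((x - \<alpha>) * \<gamma>)))"
  have c01: "0 \<le> c x" "c x \<le> 1" for x by (auto simp: c_def)
  have cl: "c x = 0" if "x \<le> \<alpha>" for x
  proof -
    have "(x - \<alpha>) * \<gamma> \<le> 0" using that g by (intro mult_nonpos_nonneg) auto
    then show ?thesis by (simp add: c_def)
  qed
  have cr: "c x = 1" if "\<beta> \<le> x" for x
    using that assms by (simp add: c_def \<gamma>_def max_def min_def)
  \<comment> \<open>The quintic falling from 1 to 0 on the unit interval with two vanishing
    derivatives at both ends: \<open>p1 t = - 30 * t^2 * (1 - t)^2\<close> and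
    \<open>p2 t = - 60 * t * (1 - t) * (1 - 2 * t)\<close>. This is what keeps the clamped function
    twice continuously differentiable.\<close>
  define p where "p = (\<lambda>t::real. 1 - 10 * t^3 + 15 * t^4 - 6 * t^5)"
  define p1 where "p1 = (\<lambda>t::real. - 30 * t^2 + 60 * t^3 - 30 * t^4)"
  define p2 where "p2 = (\<lambda>t::real. - 60 * t + 180 * t^2 - 120 * t^3)"
  have dp: "(p has_real_derivative p1 x) (at x)" for x
    unfolding p_def p1_def by (auto intro!: derivative_eq_intros)
  have dp1: "(p1 has_real_derivative p2 x) (at x)" for x
    unfolding p1_def p2_def by (auto intro!: derivative_eq_intros)
  have lin: "((\<lambda>x. (x - \<alpha>) * \<gamma>) has_real_derivative \<gamma>) (at x)" for x
    by (auto intro!: derivative_eq_intros)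
  have A: "((\<lambda>x. p (c x)) has_real_derivative p1 (c x) * \<gamma>) (at x)" for x
    unfolding c_def
    by (rule DERIV_chain'[OF lin has_real_derivative_clamp[of p p1]]) (use dp in \<open>auto simp: p1_def\<close>)
  have B: "((\<lambda>x. p1 (c x)) has_real_derivative p2 (c x) * \<gamma>) (at x)" for x
    unfolding c_def
    by (rule DERIV_chain'[OF lin has_real_derivative_clamp[of p1 p2]]) (use dp1 in \<open>auto simp: p2_def\<close>)
  show ?thesis
  proof (rule that[of "\<lambda>x. p (c x)" "\<lambda>x. p1 (c x) * \<gamma>" "\<lambda>x. p2 (c x) * \<gamma> * \<gamma>"])
    show "((\<lambda>x. p1 (c x) * \<gamma>) has_real_derivative p2 (c x) * \<gamma> * \<gamma>) (at x)" for x
      by (rule DERIV_cmult_right[OF B])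
    show "continuous_on UNIV (\<lambda>x. p2 (c x) * \<gamma> * \<gamma>)"
      unfolding p2_def c_def by (intro continuous_intros)
    fix x
    \<comment> \<open>The constant 32 is just the sum \<open>1 + 10 + 15 + 6\<close> of the absolute
      coefficients; only boundedness of the cutoff matters.\<close>
    have "\<bar>p (c x)\<bar> \<le> \<bar>1\<bar> + 10 * \<bar>c x\<bar>^3 + 15 * \<bar>c x\<bar>^4 + 6 * \<bar>c x\<bar>^5"
      unfolding p_def power_abs[symmetric] by arith
    also have "\<dots> \<le> 1 + 10 * 1 + 15 * 1 + 6 * 1"
      using c01[of x] by (intro add_mono mult_left_mono power_le_one) auto
    finally show "\<bar>p (c x)\<bar> \<le> 32" by simp
  next
    fix x show "x \<le> \<alpha> \<Longrightarrow> p (c x) = 1" "\<beta> \<le> x \<Longrightarrow> p (c x) = 0"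
      by (auto simp: cl cr p_def)
  next
    fix x assume "x \<le> \<alpha> \<or> \<beta> \<le> x"
    then show "p1 (c x) * \<gamma> = 0" "p2 (c x) * \<gamma> * \<gamma> = 0"
      by (auto simp: cl cr p1_def p2_def)
  qed (rule A)
qed

text \<open>The interval splits into a part \<open>S\<close> (near an endpoint in the applications)
  where \<open>y\<close> dominates, a compact part where continuity bounds \<open>g\<close>, and a
  rest where \<open>g\<close> vanishes.\<close>

lemma square_integrable_einterval_extend:
  fixes g y :: "real \<Rightarrow> complex"
  assumes g: "continuous_on (einterval a b) g" and S: "S \<in> sets lebesgue" "S \<subseteq> einterval a b"
    and y: "square_integrable (lebesgue_on S) y"
    and bnd: "\<And>x. x \<in> S \<Longrightarrow> norm (g x) \<le> B * norm (y x)"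
    and ab: "a < ereal \<alpha>" "ereal \<beta> < b"
    and zero: "\<And>x. x \<in> einterval a b \<Longrightarrow> x \<notin> S \<Longrightarrow> x \<notin> {\<alpha>..\<beta>} \<Longrightarrow> g x = 0"
  shows "square_integrable (lebesgue_ival a b) g"
proof -
  have m: "g \<in> borel_measurable (lebesgue_ival a b)"
    by (rule continuous_imp_measurable_on_sets_lebesgue[OF g einterval_lebesgue])
  have sub: "{\<alpha>..\<beta>} \<subseteq> einterval a b" by (rule Icc_subset_einterval[OF ab])
  have "bounded (g ` {\<alpha>..\<beta>})"
    using continuous_on_subset[OF g sub] by (intro compact_imp_bounded compact_continuous_image) auto
  then obtain K where "\<forall>y\<in>g ` {\<alpha>..\<beta>}. norm y \<le> K" by (auto simp: bounded_iff)
  then have K: "\<And>x. x \<in> {\<alpha>..\<beta>} \<Longrightarrow> norm (g x) \<le> K" by blast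
  have "integrable lebesgue (\<lambda>x. indicator S x *\<^sub>R (norm (y x))\<^sup>2)"
    using square_integrable_norm_sq[OF y] S(1) by (subst (asm) integrable_restrict_space) auto
  then have "integrable lebesgue (\<lambda>x. B\<^sup>2 * (indicator S x *\<^sub>R (norm (y x))\<^sup>2))"
    by (rule integrable_mult_right)
  moreover have "integrable lebesgue (\<lambda>x. K\<^sup>2 * indicator {\<alpha>..\<beta>} x)"
    by (intro integrable_mult_right integrable_real_indicator) (auto simp: emeasure_lborel_Icc_eq)
  ultimately have I: "integrable lebesgue (\<lambda>x. B\<^sup>2 * (indicator S x *\<^sub>R (norm (y x))\<^sup>2) + K\<^sup>2 * indicator {\<alpha>..\<beta>} x)"
    by (rule Bochner_Integration.integrable_add)
  have "integrable lebesgue (\<lambda>x. indicator (einterval a b) x *\<^sub>R (norm (g x))\<^sup>2)"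
  proof (rule Bochner_Integration.integrable_bound[OF I])
    have "(\<lambda>x. (norm (g x))\<^sup>2) \<in> borel_measurable (lebesgue_ival a b)" using m by measurable
    then show "(\<lambda>x. indicator (einterval a b) x *\<^sub>R (norm (g x))\<^sup>2) \<in> borel_measurable lebesgue"
      by (subst (asm) borel_measurable_restrict_space_iff) auto
    show "AE x in lebesgue. norm (indicator (einterval a b) x *\<^sub>R (norm (g x))\<^sup>2)
      \<le> norm (B\<^sup>2 * (indicator S x *\<^sub>R (norm (y x))\<^sup>2) + K\<^sup>2 * indicator {\<alpha>..\<beta>} x)"
    proof (rule AE_I2)
      fix x
      have b1: "(norm (g x))\<^sup>2 \<le> B\<^sup>2 * (norm (y x))\<^sup>2" if "x \<in> S"
        using power_mono[OF bnd[OF that] norm_ge_zero, of 2] by (simp add: power_mult_distrib)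
      have b2: "(norm (g x))\<^sup>2 \<le> K\<^sup>2" if "x \<in> {\<alpha>..\<beta>}"
        using power_mono[OF K[OF that] norm_ge_zero, of 2] .
      have "indicator (einterval a b) x * (norm (g x))\<^sup>2
         \<le> B\<^sup>2 * (indicator S x * (norm (y x))\<^sup>2) + K\<^sup>2 * indicator {\<alpha>..\<beta>} x"
      proof (cases "x \<in> einterval a b")
        case True
        consider "x \<in> S" | "x \<notin> S" "x \<in> {\<alpha>..\<beta>}" | "x \<notin> S" "x \<notin> {\<alpha>..\<beta>}" by blast
        then show ?thesis
        proof cases
          case 1
          have "0 \<le> K\<^sup>2 * indicator {\<alpha>..\<beta>} x" by simp
          with b1[OF 1] True 1 show ?thesis by (simp add: add_increasing2)
        next
          case 2 then show ?thesis using b2[OF 2(2)] True by simp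
        next
          case 3 then show ?thesis using zero[OF True 3] by simp
        qed
      qed simp
      then show "norm (indicator (einterval a b) x *\<^sub>R (norm (g x))\<^sup>2)
      \<le> norm (B\<^sup>2 * (indicator S x *\<^sub>R (norm (y x))\<^sup>2) + K\<^sup>2 * indicator {\<alpha>..\<beta>} x)"
        by simp
    qed
  qed
  then have "integrable (lebesgue_ival a b) (\<lambda>x. (norm (g x))\<^sup>2)"
    by (subst integrable_restrict_space) auto
  with m show ?thesis by (simp add: square_integrable_def)
qed

lemma square_integrable_empty: "square_integrable (lebesgue_on {}) f"
  unfolding square_integrable_def by (auto intro: integrableI_bounded simp: nn_integral_restrict_space measurable_def)

lemma square_integrable_compact_support:
  fixes g :: "real \<Rightarrow> complex"
  assumes g: "continuous_on (einterval a b) g"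
    and ab: "a < ereal \<alpha>" "ereal \<beta> < b"
    and zero: "\<And>x. x \<in> einterval a b \<Longrightarrow> x \<notin> {\<alpha>..\<beta>} \<Longrightarrow> g x = 0"
  shows "square_integrable (lebesgue_ival a b) g"
  by (rule square_integrable_einterval_extend[OF g _ _ square_integrable_empty _ ab]) (use zero in auto)

section \<open>Truncated solutions as elements of the operator\<close>

context
  fixes a b :: ereal and q :: "real \<Rightarrow> real"
begin

text \<open>\<open>D1 y\<close> is not known to be square integrable near an endpoint; it enters
  only multiplied by \<open>k1\<close>, which vanishes outside a compact interval.\<close>

lemma cutoff_square_integrable:
  fixes k0 k1 k2 :: "real \<Rightarrow> real" and y :: "real \<Rightarrow> complex"
  assumes c: "continuous_on UNIV k0" "continuous_on UNIV k1" "continuous_on UNIV k2"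
    and B: "\<And>x. \<bar>k0 x\<bar> \<le> B" and y: "tau_eq a b q y (\<lambda>x. z * y x)"
    and S: "S \<in> sets lebesgue" "S \<subseteq> einterval a b" "square_integrable (lebesgue_on S) y"
    and ab: "a < ereal \<alpha>" "ereal \<beta> < b"
    and zero: "\<And>x. x \<in> einterval a b \<Longrightarrow> x \<notin> S \<Longrightarrow> x \<notin> {\<alpha>..\<beta>} \<Longrightarrow> k0 x = 0"
    and zero': "\<And>x. x \<notin> {\<alpha>..\<beta>} \<Longrightarrow> k1 x = 0 \<and> k2 x = 0"
  shows "square_integrable (lebesgue_ival a b) (\<lambda>x. k0 x * y x)"
    and "square_integrable (lebesgue_ival a b) (\<lambda>x. k0 x * (z * y x) - 2 * k1 x * D1 y x - k2 x * y x)"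
proof -
  note cont = tau_eq_continuous[OF y]
  have sub: "continuous_on (einterval a b) k" if "continuous_on UNIV k" for k :: "real \<Rightarrow> real"
    using that by (rule continuous_on_subset) simp
  show 1: "square_integrable (lebesgue_ival a b) (\<lambda>x. k0 x * y x)"
  proof (rule square_integrable_einterval_extend[OF _ S _ ab])
    show "continuous_on (einterval a b) (\<lambda>x. complex_of_real (k0 x) * y x)"
      by (intro continuous_intros sub c cont)
    show "norm (complex_of_real (k0 x) * y x) \<le> B * norm (y x)" for x
      using B[of x] by (simp add: norm_mult mult_right_mono)
  qed (use zero in auto)
  have 2: "square_integrable (lebesgue_ival a b) (\<lambda>x. 2 * k1 x * D1 y x)"
    by (rule square_integrable_compact_support[OF _ ab])
      (use zero' in \<open>auto intro!: continuous_intros sub c cont\<close>)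
  have 3: "square_integrable (lebesgue_ival a b) (\<lambda>x. k2 x * y x)"
    by (rule square_integrable_compact_support[OF _ ab])
      (use zero' in \<open>auto intro!: continuous_intros sub c cont\<close>)
  have "square_integrable (lebesgue_ival a b) (\<lambda>x. k0 x * (z * y x))"
    using square_integrable_cmult[OF 1, of z] by (simp add: mult.left_commute)
  from square_integrable_diff[OF square_integrable_diff[OF this 2] 3]
  show "square_integrable (lebesgue_ival a b) (\<lambda>x. k0 x * (z * y x) - 2 * k1 x * D1 y x - k2 x * y x)" .
qed

lemma bc_left_cong:
  assumes "bc_left a b q v y" "\<And>x. a < ereal x \<Longrightarrow> x < \<alpha> \<Longrightarrow> p x = y x" "a < ereal \<alpha>"
  shows "bc_left a b q v p"
  unfolding bc_left_def wronskian_left_def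
proof
  assume "limit_circle_left a b q"
  then have lim: "((\<lambda>x. wronskian v y (real_of_ereal x)) \<longlongrightarrow> 0) (at_right a)"
    using assms(1) by (simp add: bc_left_def wronskian_left_def)
  have "eventually (\<lambda>e. wronskian v p (real_of_ereal e) = wronskian v y (real_of_ereal e)) (at_right a)"
    unfolding eventually_at_right[OF assms(3)]
  proof (intro exI[of _ "ereal \<alpha>"] conjI allI impI assms(3))
    fix e assume e: "a < e" "e < ereal \<alpha>"
    then obtain r where r: "e = ereal r" by (cases e) auto
    then have "D1 p r = D1 y r"
      using e assms(2) by (intro D1_cong_open[OF open_einterval[of a "ereal \<alpha>"]]) (auto simp: einterval_def)
    then show "wronskian v p (real_of_ereal e) = wronskian v y (real_of_ereal e)"
      using e assms(2) r by (simp add: wronskian_def)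
  qed
  from tendsto_cong[OF this] lim show "((\<lambda>x. wronskian v p (real_of_ereal x)) \<longlongrightarrow> 0) (at_right a)" by blast
qed

lemma bc_right_cong:
  assumes "bc_right a b q v y" "\<And>x. \<beta> < x \<Longrightarrow> ereal x < b \<Longrightarrow> p x = y x" "ereal \<beta> < b"
  shows "bc_right a b q v p"
  unfolding bc_right_def wronskian_right_def
proof
  assume "limit_circle_right a b q"
  then have lim: "((\<lambda>x. wronskian v y (real_of_ereal x)) \<longlongrightarrow> 0) (at_left b)"
    using assms(1) by (simp add: bc_right_def wronskian_right_def)
  have "eventually (\<lambda>e. wronskian v p (real_of_ereal e) = wronskian v y (real_of_ereal e)) (at_left b)"
    unfolding eventually_at_left[OF assms(3)]
  proof (intro exI[of _ "ereal \<beta>"] conjI allI impI assms(3))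
    fix e assume e: "ereal \<beta> < e" "e < b"
    then obtain r where r: "e = ereal r" by (cases e) auto
    then have "D1 p r = D1 y r"
      using e assms(2) by (intro D1_cong_open[OF open_einterval[of "ereal \<beta>" b]]) (auto simp: einterval_def)
    then show "wronskian v p (real_of_ereal e) = wronskian v y (real_of_ereal e)"
      using e assms(2) r by (simp add: wronskian_def)
  qed
  from tendsto_cong[OF this] lim show "((\<lambda>x. wronskian v p (real_of_ereal x)) \<longlongrightarrow> 0) (at_left b)" by blast
qed

lemma bc_left_zero: "bc_left a b q v (\<lambda>_. 0)"
  by (simp add: bc_left_def wronskian_left_def wronskian_def)

lemma bc_right_zero: "bc_right a b q v (\<lambda>_. 0)"
  by (simp add: bc_right_def wronskian_right_def wronskian_def)

text \<open>Supplies the test elements of the operator: they follow a solution near \<open>a\<close>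
  and vanish near \<open>b\<close>. Both boundary conditions are inherited, since they only see a
  neighbourhood of their endpoint.\<close>

lemma cutoff_left_mem:
  assumes y: "tau_eq a b q y (\<lambda>x. z * y x)" and dom: "in_domain_near_left a b q v y"
    and ab: "a < ereal \<alpha>" "\<alpha> < \<beta>" "ereal \<beta> < b"
  obtains p hp where "(p, hp) \<in> sl_operator a b q v w" "tau_eq a b q p hp"
    "\<And>x. x \<le> \<alpha> \<Longrightarrow> p x = y x \<and> hp x = z * y x" "\<And>x. \<beta> \<le> x \<Longrightarrow> p x = 0 \<and> hp x = 0"
proof -
  obtain k0 k1 k2 :: "real \<Rightarrow> real" where k:
    "\<And>x. (k0 has_real_derivative k1 x) (at x)" "\<And>x. (k1 has_real_derivative k2 x) (at x)"
    "continuous_on UNIV k2" "\<And>x. \<bar>k0 x\<bar> \<le> 32"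
    "\<And>x. x \<le> \<alpha> \<Longrightarrow> k0 x = 1" "\<And>x. \<beta> \<le> x \<Longrightarrow> k0 x = 0"
    "\<And>x. x \<le> \<alpha> \<or> \<beta> \<le> x \<Longrightarrow> k1 x = 0" "\<And>x. x \<le> \<alpha> \<or> \<beta> \<le> x \<Longrightarrow> k2 x = 0"
    using cutoff_exists[OF ab(2)] by metis
  have c: "continuous_on UNIV k0" "continuous_on UNIV k1"
    using k(1,2) by (meson DERIV_continuous_on has_field_derivative_at_within)+
  define p where "p = (\<lambda>x. complex_of_real (k0 x) * y x)"
  define hp where "hp = (\<lambda>x. k0 x * (z * y x) - 2 * k1 x * D1 y x - k2 x * y x)"
  have tau: "tau_eq a b q p hp" unfolding p_def hp_def by (rule tau_eq_cutoff[OF k(1-3) y])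
  obtain c where cc: "a < ereal c" "ereal c < b" "square_integrable (lebesgue_ival a (ereal c)) y"
    using dom by (auto simp: in_domain_near_left_def sq_int_near_left_def)
  \<comment> \<open>The compact part has to contain the region between \<open>\<alpha>\<close> and
    \<open>\<beta>\<close>, where the cutoff varies, and also everything between \<open>c\<close>,
    where the known square integrability of \<open>y\<close> ends, and
    \<open>\<beta>\<close>.\<close>
  define m where "m = min \<alpha> c"
  have m: "a < ereal m" using ab cc by (simp add: m_def min_def)
  have S: "einterval a (ereal c) \<subseteq> einterval a b"
    using cc by (auto simp: einterval_def intro: less_trans[of _ "ereal c" b])
  have zero: "k0 x = 0" if "x \<in> einterval a b" "x \<notin> einterval a (ereal c)" "x \<notin> {m..\<beta>}" for x
    using that k(6) by (auto simp: einterval_def m_def)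
  have zero': "k1 x = 0 \<and> k2 x = 0" if "x \<notin> {m..\<beta>}" for x
    using that k(7,8)[of x] by (auto simp: m_def min_def split: if_splits)
  note sq = cutoff_square_integrable[OF c k(3,4) y einterval_lebesgue S cc(3) m ab(3) zero zero']
  have "bc_left a b q v p"
    by (rule bc_left_cong[of v y \<alpha>]) (use dom k(5) ab in \<open>auto simp: p_def in_domain_near_left_def\<close>)
  moreover have "bc_right a b q w p"
    by (rule bc_right_cong[OF bc_right_zero, of \<beta>]) (use k(6) ab in \<open>auto simp: p_def\<close>)
  ultimately have "(p, hp) \<in> sl_operator a b q v w"
    unfolding sl_operator_def sl_realisation_def using sq tau unfolding p_def[symmetric] hp_def[symmetric]
    by (auto intro!: exI[of _ p])
  then show ?thesis
    by (rule that[OF _ tau]) (auto simp: p_def hp_def k(5-8))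
qed

lemma cutoff_right_mem:
  assumes y: "tau_eq a b q y (\<lambda>x. z * y x)" and dom: "in_domain_near_right a b q w y"
    and ab: "a < ereal \<alpha>" "\<alpha> < \<beta>" "ereal \<beta> < b"
  obtains p hp where "(p, hp) \<in> sl_operator a b q v w" "tau_eq a b q p hp"
    "\<And>x. \<beta> \<le> x \<Longrightarrow> p x = y x \<and> hp x = z * y x" "\<And>x. x \<le> \<alpha> \<Longrightarrow> p x = 0 \<and> hp x = 0"
proof -
  obtain l0 l1 l2 :: "real \<Rightarrow> real" where l:
    "\<And>x. (l0 has_real_derivative l1 x) (at x)" "\<And>x. (l1 has_real_derivative l2 x) (at x)"
    "continuous_on UNIV l2" "\<And>x. \<bar>l0 x\<bar> \<le> 32"
    "\<And>x. x \<le> \<alpha> \<Longrightarrow> l0 x = 1" "\<And>x. \<beta> \<le> x \<Longrightarrow> l0 x = 0"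
    "\<And>x. x \<le> \<alpha> \<or> \<beta> \<le> x \<Longrightarrow> l1 x = 0" "\<And>x. x \<le> \<alpha> \<or> \<beta> \<le> x \<Longrightarrow> l2 x = 0"
    using cutoff_exists[OF ab(2)] by metis
  \<comment> \<open>The mirrored cutoff is the complement of the left one, whence the bound 33
    instead of 32.\<close>
  define k0 k1 k2 where "k0 = (\<lambda>x. 1 - l0 x)" and "k1 = (\<lambda>x. - l1 x)" and "k2 = (\<lambda>x. - l2 x)"
  have k: "\<And>x. (k0 has_real_derivative k1 x) (at x)" "\<And>x. (k1 has_real_derivative k2 x) (at x)"
    "continuous_on UNIV k2"
    unfolding k0_def k1_def k2_def using l(1,2)
    by (auto intro!: derivative_eq_intros continuous_intros l(3))
  have kb: "\<bar>k0 x\<bar> \<le> 33" for x using l(4)[of x] unfolding k0_def by linarith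
  have c: "continuous_on UNIV k0" "continuous_on UNIV k1"
    using k(1,2) by (meson DERIV_continuous_on has_field_derivative_at_within)+
  define p where "p = (\<lambda>x. complex_of_real (k0 x) * y x)"
  define hp where "hp = (\<lambda>x. k0 x * (z * y x) - 2 * k1 x * D1 y x - k2 x * y x)"
  have tau: "tau_eq a b q p hp" unfolding p_def hp_def by (rule tau_eq_cutoff[OF k(1-3) y])
  obtain c where cc: "a < ereal c" "ereal c < b" "square_integrable (lebesgue_ival (ereal c) b) y"
    using dom by (auto simp: in_domain_near_right_def sq_int_near_right_def)
  define m where "m = max \<beta> c"
  have m: "ereal m < b" using ab cc by (simp add: m_def max_def)
  have S: "einterval (ereal c) b \<subseteq> einterval a b"
    using cc by (auto simp: einterval_def intro: less_trans[of a "ereal c"])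
  have zero: "k0 x = 0" if "x \<in> einterval a b" "x \<notin> einterval (ereal c) b" "x \<notin> {\<alpha>..m}" for x
    using that l(5) by (auto simp: einterval_def m_def k0_def)
  have zero': "k1 x = 0 \<and> k2 x = 0" if "x \<notin> {\<alpha>..m}" for x
    using that l(7,8)[of x] by (auto simp: m_def k1_def k2_def max_def split: if_splits)
  note sq = cutoff_square_integrable[OF c k(3) kb y einterval_lebesgue S cc(3) ab(1) m zero zero']
  have "bc_right a b q w p"
    by (rule bc_right_cong[of w y \<beta>]) (use dom l(6) ab in \<open>auto simp: p_def k0_def in_domain_near_right_def\<close>)
  moreover have "bc_left a b q v p"
    by (rule bc_left_cong[OF bc_left_zero, of \<alpha>]) (use l(5) ab in \<open>auto simp: p_def k0_def\<close>)
  ultimately have "(p, hp) \<in> sl_operator a b q v w"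
    unfolding sl_operator_def sl_realisation_def using sq tau unfolding p_def[symmetric] hp_def[symmetric]
    by (auto intro!: exI[of _ p])
  then show ?thesis
    by (rule that[OF _ tau]) (auto simp: p_def hp_def k0_def k1_def k2_def l(5-8))
qed

text \<open>The truncation of \<open>y\<close> to \<open>S\<close> need not lie in the domain.
  Subtracting the pairing with \<open>(p, hp)\<close>, which is 0 by symmetry, leaves an integrand
  supported in \<open>{s..t}\<close>: \<open>p\<close> copies \<open>y\<close> on the rest of
  \<open>S\<close> and vanishes off \<open>S\<close>. So Lagrange's identity on a compact interval
  suffices, without any limit at an endpoint.\<close>

lemma Lagrange_piece:
  assumes T: "self_adjoint_operator (lebesgue_ival a b) T" and f: "(f, h) \<in> T" and p: "(p, hp) \<in> T"
    and u: "tau_eq a b q u h" "AE x in lebesgue_ival a b. u x = f x"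
    and tp: "tau_eq a b q p hp" and ty: "tau_eq a b q y (\<lambda>x. z * y x)"
    and st: "a < ereal s" "s \<le> t" "ereal t < b" "{s..t} \<subseteq> S"
    and sq: "square_integrable (lebesgue_ival a b) (\<lambda>x. indicator S x * y x)"
    and S1: "\<And>x. x \<in> einterval a b \<Longrightarrow> x \<in> S \<Longrightarrow> x \<notin> {s..t} \<Longrightarrow> p x = y x \<and> hp x = z * y x"
    and S2: "\<And>x. x \<in> einterval a b \<Longrightarrow> x \<notin> S \<Longrightarrow> p x = 0 \<and> hp x = 0"
  shows "l2_inner (lebesgue_ival a b) (\<lambda>x. indicator S x * y x) h
       - l2_inner (lebesgue_ival a b) (\<lambda>x. z * (indicator S x * y x)) f
       = cnj_wronskian (\<lambda>x. y x - p x) u s - cnj_wronskian (\<lambda>x. y x - p x) u t"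
proof -
  let ?M = "lebesgue_ival a b"
  let ?Y = "\<lambda>x. indicator S x * y x"
  note sqf = self_adjoint_square_integrable[OF T f] and sqp = self_adjoint_square_integrable[OF T p]
  let ?L = "\<lambda>x. cnj (y x - p x) * h x - cnj (z * y x - hp x) * u x"
  let ?F = "\<lambda>x. (cnj (?Y x) * h x - cnj (z * ?Y x) * f x) - (cnj (p x) * h x - cnj (hp x) * f x)"
  note i = l2_inner_integrable[OF sq sqf(2)] l2_inner_integrable[OF square_integrable_cmult[OF sq, of z] sqf(1)]
    l2_inner_integrable[OF sqp(1) sqf(2)] l2_inner_integrable[OF sqp(2) sqf(1)]
  have intF: "integrable ?M ?F"
    by (intro Bochner_Integration.integrable_diff i)
  have "integral\<^sup>L ?M ?F = (l2_inner ?M ?Y h - l2_inner ?M (\<lambda>x. z * ?Y x) f) - (l2_inner ?M p h - l2_inner ?M hp f)"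
    unfolding l2_inner_def
    by (subst Bochner_Integration.integral_diff[OF Bochner_Integration.integrable_diff[OF i(1,2)]
          Bochner_Integration.integrable_diff[OF i(3,4)]],
        subst Bochner_Integration.integral_diff[OF i(1,2)], subst Bochner_Integration.integral_diff[OF i(3,4)], rule refl)
  also have "l2_inner ?M p h - l2_inner ?M hp f = 0"
    using self_adjoint_symmetric[OF T f p] by simp
  finally have eq1: "integral\<^sup>L ?M ?F = l2_inner ?M ?Y h - l2_inner ?M (\<lambda>x. z * ?Y x) f" by simp
  have tl: "tau_eq a b q (\<lambda>x. y x - p x) (\<lambda>x. z * y x - hp x)"
    using tau_eq_lincomb(1)[OF ty tp, of "-1"] by simp
  have hasL: "(?L has_integral (cnj_wronskian (\<lambda>x. y x - p x) u s - cnj_wronskian (\<lambda>x. y x - p x) u t)) {s..t}"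
    by (rule Lagrange_identity[OF tl u(1) st(1-3)])
  have sub: "{s..t} \<subseteq> einterval a b" by (rule Icc_subset_einterval[OF st(1,3)])
  obtain N where N: "negligible N" "\<forall>x\<in>einterval a b - N. u x = f x"
    using AE_lebesgue_on_negligible[OF u(2) einterval_lebesgue] by blast
  have "(?F has_integral integral\<^sup>L ?M ?F) (einterval a b)"
    by (rule has_integral_integral_lebesgue_on[OF intF einterval_lebesgue])
  then have "((\<lambda>x. if x \<in> {s..t} then ?L x else 0) has_integral integral\<^sup>L ?M ?F) (einterval a b)"
  proof (rule has_integral_spike[OF N(1), rotated])
    fix x assume x: "x \<in> einterval a b - N"
    then have "u x = f x" using N(2) by blast
    then show "(if x \<in> {s..t} then ?L x else 0) = ?F x"
      using S1[of x] S2[of x] x st(4) by (cases "x \<in> S"; cases "x \<in> {s..t}") (auto simp: algebra_simps)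
  qed
  then have "(?L has_integral integral\<^sup>L ?M ?F) {s..t}"
    using has_integral_restrict[OF sub] by blast
  from has_integral_unique[OF this hasL] eq1 show ?thesis by simp
qed

end

section \<open>The Weyl function on the resolvent set\<close>

text \<open>Identity theorem: \<open>f\<close> and its reflection agree on the real axis, which
  accumulates at 0.\<close>

lemma real_entire_cnj:
  assumes "real_entire f"
  shows "f (cnj z) = cnj (f z)"
proof -
  have hol: "(\<lambda>z. f z - (cnj \<circ> f \<circ> cnj) z) holomorphic_on UNIV"
    using assms holomorphic_on_compose_cnj_cnj[of f UNIV]
    by (intro holomorphic_on_diff) (auto simp: real_entire_def o_def surjI[of cnj cnj])
  have lim: "(0::complex) islimpt \<real>"
    unfolding islimpt_approachable
  proof (intro allI impI)
    fix e :: real assume "0 < e"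
    then show "\<exists>x'\<in>\<real>. x' \<noteq> 0 \<and> dist x' (0::complex) < e"
      by (intro bexI[of _ "complex_of_real (e / 2)"] conjI) (simp_all add: dist_norm del: of_real_divide)
  qed
  have "f z - (cnj \<circ> f \<circ> cnj) z = 0"
  proof (rule analytic_continuation[OF hol open_UNIV connected_UNIV _ _ lim])
    fix x :: complex assume "x \<in> \<real>"
    then obtain t :: real where "x = complex_of_real t" by (auto elim: Reals_cases)
    then show "f x - (cnj \<circ> f \<circ> cnj) x = 0"
      using assms by (auto simp: real_entire_def Reals_cnj_iff)
  qed auto
  then show ?thesis by simp
qed

lemma square_integrable_indicator:
  assumes f: "square_integrable (lebesgue_ival a b) f" and A: "A \<in> sets borel"
  shows "square_integrable (lebesgue_ival a b) (\<lambda>x. indicator A x * f x)"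
  unfolding square_integrable_def
proof (rule conjI)
  have ind: "indicator A \<in> borel_measurable (lebesgue_ival a b)"
    using A by (intro measurable_restrict_space1 borel_measurable_indicator) auto
  then have ind': "(\<lambda>x. indicator A x :: complex) \<in> borel_measurable (lebesgue_ival a b)"
    by simp
  show m: "(\<lambda>x. indicator A x * f x) \<in> borel_measurable (lebesgue_ival a b)"
    using f ind' by (intro borel_measurable_times) (auto simp: square_integrable_def)
  show "integrable (lebesgue_ival a b) (\<lambda>x. (norm (indicator A x * f x))\<^sup>2)"
  proof (rule Bochner_Integration.integrable_bound[OF square_integrable_norm_sq[OF f]])
    show "(\<lambda>x. (norm (indicator A x * f x))\<^sup>2) \<in> borel_measurable (lebesgue_ival a b)"
      using m by measurable
  qed (auto simp: indicator_def)
qed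

locale weyl_system =
  fixes a b :: ereal
    and q :: "real \<Rightarrow> real"
    and v w :: "real \<Rightarrow> complex"
    and H :: "real operator"
    and \<phi> \<theta> :: "complex \<Rightarrow> real \<Rightarrow> complex"
    and M :: "complex \<Rightarrow> complex"
  assumes ab: "a < b"
    and H_def: "H = sl_operator a b q v w"
    and sa: "self_adjoint_operator (lebesgue_ival a b) H"
    and sys: "entire_system a b q v \<phi> \<theta>"
    and M: "singular_weyl_function a b q w H \<phi> \<theta> M"
begin

abbreviation \<mu> :: "real measure" where "\<mu> \<equiv> lebesgue_ival a b"
abbreviation R :: "complex set" where "R \<equiv> resolvent_set \<mu> H"

text \<open>The Weyl solution, in the domain of \<open>H\<close> near \<open>b\<close> for
  \<open>z\<close> in the resolvent set. It is the partner of \<open>\<phi>\<close>, which satisfies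
  the condition at \<open>a\<close>.\<close>

definition \<psi> :: "complex \<Rightarrow> real \<Rightarrow> complex" where
  "\<psi> z = (\<lambda>x. \<theta> z x + M z * \<phi> z x)"

lemma tau_phi: "tau_eq a b q (\<phi> z) (\<lambda>x. z * \<phi> z x)"
  using sys by (simp add: entire_system_def tau_solution_def)

lemma tau_theta: "tau_eq a b q (\<theta> z) (\<lambda>x. z * \<theta> z x)"
  using sys by (simp add: entire_system_def tau_solution_def)

lemma tau_psi: "tau_eq a b q (\<psi> z) (\<lambda>x. z * \<psi> z x)"
proof -
  have "(\<lambda>x. z * \<theta> z x + M z * (z * \<phi> z x)) = (\<lambda>x. z * \<psi> z x)"
    by (auto simp: \<psi>_def algebra_simps)
  with tau_eq_lincomb(1)[OF tau_theta tau_phi, of z "M z" z] show ?thesis by (simp add: \<psi>_def)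
qed

lemma D1_psi: "x \<in> einterval a b \<Longrightarrow> D1 (\<psi> z) x = D1 (\<theta> z) x + M z * D1 (\<phi> z) x"
  unfolding \<psi>_def by (rule tau_eq_lincomb(2)[OF tau_theta tau_phi])

lemma phi_domain: "in_domain_near_left a b q v (\<phi> z)"
  using sys by (simp add: entire_system_def)

lemma psi_domain: "z \<in> R \<Longrightarrow> in_domain_near_right a b q w (\<psi> z)"
  using M by (simp add: singular_weyl_function_def op_spectrum_def \<psi>_def)

lemma wronskian_theta_phi:
  "x \<in> einterval a b \<Longrightarrow> \<theta> z x * D1 (\<phi> z) x - D1 (\<theta> z) x * \<phi> z x = 1"
  using sys by (simp add: entire_system_def wronskian_def)

lemma wronskian_psi_phi:
  assumes x: "x \<in> einterval a b"
  shows "\<psi> z x * D1 (\<phi> z) x - D1 (\<psi> z) x * \<phi> z x = 1"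
  unfolding D1_psi[OF x] unfolding \<psi>_def
  using wronskian_theta_phi[OF x, of z] by (simp add: algebra_simps)

lemma real_entire_phi: "x \<in> einterval a b \<Longrightarrow> real_entire (\<lambda>z. \<phi> z x)"
  and real_entire_theta: "x \<in> einterval a b \<Longrightarrow> real_entire (\<lambda>z. \<theta> z x)"
  using sys by (simp_all add: entire_system_def)

lemma phi_cnj: "x \<in> einterval a b \<Longrightarrow> \<phi> (cnj z) x = cnj (\<phi> z x)"
  and theta_cnj: "x \<in> einterval a b \<Longrightarrow> \<theta> (cnj z) x = cnj (\<theta> z x)"
  by (rule real_entire_cnj[OF real_entire_phi], assumption)
     (rule real_entire_cnj[OF real_entire_theta], assumption)

lemma D1_phi_cnj: "x \<in> einterval a b \<Longrightarrow> D1 (\<phi> (cnj z)) x = cnj (D1 (\<phi> z) x)"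
  using D1_cong_open[OF open_einterval, of x a b "\<phi> (cnj z)" "\<lambda>x. cnj (\<phi> z x)"]
    tau_eq_cnj(2)[OF tau_phi] by (simp add: phi_cnj)

lemma D1_theta_cnj: "x \<in> einterval a b \<Longrightarrow> D1 (\<theta> (cnj z)) x = cnj (D1 (\<theta> z) x)"
  using D1_cong_open[OF open_einterval, of x a b "\<theta> (cnj z)" "\<lambda>x. cnj (\<theta> z x)"]
    tau_eq_cnj(2)[OF tau_theta] by (simp add: theta_cnj)

lemma nonreal_in_R: "Im z \<noteq> 0 \<Longrightarrow> z \<in> R"
  by (rule self_adjoint_nonreal_resolvent[OF sa])

lemma R_cnj: "z \<in> R \<Longrightarrow> cnj z \<in> R"
proof (cases "Im z = 0")
  case True
  then have "cnj z = z" by (simp add: complex_eq_iff)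
  then show "z \<in> R \<Longrightarrow> cnj z \<in> R" by simp
qed (simp add: nonreal_in_R)

section \<open>The Green function and its reproducing property\<close>

lemma rep:
  assumes "(f, h) \<in> H"
  obtains u where "AE x in \<mu>. u x = f x" "tau_eq a b q u h"
  using assms unfolding H_def sl_operator_def sl_realisation_def by auto

text \<open>The two halves of the Green function before scaling. Both half-lines are closed; the
  overlap at \<open>x0\<close> is a null set.\<close>

definition gL :: "real \<Rightarrow> complex \<Rightarrow> real \<Rightarrow> complex" where
  "gL x0 z = (\<lambda>x. indicator {..x0} x * \<phi> z x)"
definition gR :: "real \<Rightarrow> complex \<Rightarrow> real \<Rightarrow> complex" where
  "gR x0 z = (\<lambda>x. indicator {x0..} x * \<psi> z x)"

text \<open>Room for a cutoff strictly to the left of \<open>x0\<close>: it will vary between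
  \<open>\<alpha>\<close> and \<open>\<beta>\<close>, and at \<open>s\<close> it is already
  constant.\<close>

lemma left_of:
  assumes "x0 \<in> einterval a b"
  obtains s \<alpha> \<beta> where "a < ereal s" "s < \<alpha>" "\<alpha> < \<beta>" "\<beta> < x0" "ereal x0 < b"
proof -
  obtain c d where c: "a < ereal c" "c < x0" using einterval_nbhd[OF assms] by blast
  show ?thesis
    by (rule that[of c "c + (x0 - c) / 3" "c + 2 * (x0 - c) / 3"]) (use c assms in \<open>auto simp: field_simps einterval_def\<close>)
qed

lemma right_of:
  assumes "x0 \<in> einterval a b"
  obtains \<alpha> \<beta> t where "a < ereal x0" "x0 < \<alpha>" "\<alpha> < \<beta>" "\<beta> < t" "ereal t < b"
proof -
  obtain c d where c: "x0 < d" "ereal d < b" using einterval_nbhd[OF assms] by blast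
  show ?thesis
    by (rule that[of "x0 + (d - x0) / 3" "x0 + 2 * (d - x0) / 3" d]) (use c assms in \<open>auto simp: field_simps einterval_def\<close>)
qed

text \<open>Borrowed from an element of \<open>H\<close> that agrees with \<open>\<phi> z\<close> up
  to \<open>x0\<close>.\<close>

lemma sq_gL:
  assumes x0: "x0 \<in> einterval a b"
  shows "square_integrable \<mu> (gL x0 z)"
proof -
  obtain \<alpha> \<beta> t where r: "a < ereal x0" "x0 < \<alpha>" "\<alpha> < \<beta>" "\<beta> < t" "ereal t < b" by (rule right_of[OF x0])
  have "ereal \<alpha> < b" using r by (auto intro: less_trans[of _ "ereal t"])
  with r obtain p hp where p: "(p, hp) \<in> H" "\<And>x. x \<le> x0 \<Longrightarrow> p x = \<phi> z x \<and> hp x = z * \<phi> z x"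
    unfolding H_def using cutoff_left_mem[OF tau_phi[of z] phi_domain r(1,2), where w=w] by metis
  have "square_integrable \<mu> (\<lambda>x. indicator {..x0} x * p x)"
    by (intro square_integrable_indicator self_adjoint_square_integrable[OF sa p(1)]) auto
  also have "(\<lambda>x. indicator {..x0} x * p x) = gL x0 z"
    using p(2) by (auto simp: gL_def indicator_def)
  finally show ?thesis .
qed

lemma sq_gR:
  assumes x0: "x0 \<in> einterval a b" and z: "z \<in> R"
  shows "square_integrable \<mu> (gR x0 z)"
proof -
  obtain s \<alpha> \<beta> where r: "a < ereal s" "s < \<alpha>" "\<alpha> < \<beta>" "\<beta> < x0" "ereal x0 < b" by (rule left_of[OF x0])
  have "a < ereal \<alpha>" "\<alpha> < x0" using r by (auto intro: less_trans[of a "ereal s"])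
  then obtain p hp where p: "(p, hp) \<in> H" "\<And>x. x0 \<le> x \<Longrightarrow> p x = \<psi> z x \<and> hp x = z * \<psi> z x"
    unfolding H_def using cutoff_right_mem[OF tau_psi[of z] psi_domain[OF z] _ _ r(5), of \<alpha>, where v=v] by metis
  have "square_integrable \<mu> (\<lambda>x. indicator {x0..} x * p x)"
    by (intro square_integrable_indicator self_adjoint_square_integrable[OF sa p(1)]) auto
  also have "(\<lambda>x. indicator {x0..} x * p x) = gR x0 z"
    using p(2) by (auto simp: gR_def indicator_def)
  finally show ?thesis .
qed

lemma cnj_wronskian_local:
  assumes "open S" "x \<in> S" "\<And>y. y \<in> S \<Longrightarrow> f y = g y"
  shows "cnj_wronskian f u x = cnj_wronskian g u x" "cnj_wronskian u f x = cnj_wronskian u g x"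
  using D1_cong_open[OF assms] assms(2,3) by (auto simp: cnj_wronskian_def)

text \<open>\<open>Lagrange_piece\<close> with a cutoff that is finished before \<open>x0\<close>:
  the difference of solution and truncation vanishes near \<open>s\<close> and is the full solution
  near \<open>x0\<close>, so only the boundary term at \<open>x0\<close> survives.\<close>

lemma green_left:
  assumes x0: "x0 \<in> einterval a b" and f: "(f, h) \<in> H"
    and u: "tau_eq a b q u h" "AE x in \<mu>. u x = f x"
  shows "l2_inner \<mu> (gL x0 z) h - l2_inner \<mu> (\<lambda>x. z * gL x0 z x) f = - cnj_wronskian (\<phi> z) u x0"
proof -
  obtain s \<alpha> \<beta> where r: "a < ereal s" "s < \<alpha>" "\<alpha> < \<beta>" "\<beta> < x0" "ereal x0 < b" by (rule left_of[OF x0])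
  have al: "a < ereal \<alpha>" "ereal \<beta> < b"
    using r by (auto intro: less_trans[of a "ereal s"] less_trans[of _ "ereal x0"])
  obtain p hp where p: "(p, hp) \<in> H" "tau_eq a b q p hp"
    "\<And>x. x \<le> \<alpha> \<Longrightarrow> p x = \<phi> z x \<and> hp x = z * \<phi> z x" "\<And>x. \<beta> \<le> x \<Longrightarrow> p x = 0 \<and> hp x = 0"
    unfolding H_def using cutoff_left_mem[OF tau_phi[of z] phi_domain al(1) r(3) al(2), where w=w] by metis
  have "l2_inner \<mu> (gL x0 z) h - l2_inner \<mu> (\<lambda>x. z * gL x0 z x) f
      = cnj_wronskian (\<lambda>x. \<phi> z x - p x) u s - cnj_wronskian (\<lambda>x. \<phi> z x - p x) u x0"
    unfolding gL_def
    by (rule Lagrange_piece[OF sa f p(1) u p(2) tau_phi])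
       (use r p(3,4) sq_gL[OF x0] in \<open>auto simp: gL_def\<close>)
  also have "cnj_wronskian (\<lambda>x. \<phi> z x - p x) u s = cnj_wronskian (\<lambda>x. 0) u s"
    by (rule cnj_wronskian_local(1)[of "{..<\<alpha>}"]) (use r p(3) in auto)
  also have "cnj_wronskian (\<lambda>x. \<phi> z x - p x) u x0 = cnj_wronskian (\<phi> z) u x0"
    by (rule cnj_wronskian_local(1)[of "{\<beta><..}"]) (use r p(4) in auto)
  finally show ?thesis by (simp add: cnj_wronskian_def)
qed

lemma green_right:
  assumes x0: "x0 \<in> einterval a b" and z: "z \<in> R" and f: "(f, h) \<in> H"
    and u: "tau_eq a b q u h" "AE x in \<mu>. u x = f x"
  shows "l2_inner \<mu> (gR x0 z) h - l2_inner \<mu> (\<lambda>x. z * gR x0 z x) f = cnj_wronskian (\<psi> z) u x0"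
proof -
  obtain \<alpha> \<beta> t where r: "a < ereal x0" "x0 < \<alpha>" "\<alpha> < \<beta>" "\<beta> < t" "ereal t < b" by (rule right_of[OF x0])
  have al: "a < ereal \<alpha>" "ereal \<beta> < b"
    using r by (auto intro: less_trans[of a "ereal x0"] less_trans[of _ "ereal t"])
  obtain p hp where p: "(p, hp) \<in> H" "tau_eq a b q p hp"
    "\<And>x. \<beta> \<le> x \<Longrightarrow> p x = \<psi> z x \<and> hp x = z * \<psi> z x" "\<And>x. x \<le> \<alpha> \<Longrightarrow> p x = 0 \<and> hp x = 0"
    unfolding H_def using cutoff_right_mem[OF tau_psi[of z] psi_domain[OF z] al(1) r(3) al(2), where v=v] by metis
  have "l2_inner \<mu> (gR x0 z) h - l2_inner \<mu> (\<lambda>x. z * gR x0 z x) f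
      = cnj_wronskian (\<lambda>x. \<psi> z x - p x) u x0 - cnj_wronskian (\<lambda>x. \<psi> z x - p x) u t"
    unfolding gR_def
    by (rule Lagrange_piece[OF sa f p(1) u p(2) tau_psi])
       (use r p(3,4) sq_gR[OF x0 z] in \<open>auto simp: gR_def\<close>)
  also have "cnj_wronskian (\<lambda>x. \<psi> z x - p x) u t = cnj_wronskian (\<lambda>x. 0) u t"
    by (rule cnj_wronskian_local(1)[of "{\<beta><..}"]) (use r p(3) in auto)
  also have "cnj_wronskian (\<lambda>x. \<psi> z x - p x) u x0 = cnj_wronskian (\<psi> z) u x0"
    by (rule cnj_wronskian_local(1)[of "{..<\<alpha>}"]) (use r p(4) in auto)
  finally show ?thesis by (simp add: cnj_wronskian_def)
qed

text \<open>The Wronskian of the conjugate of \<open>\<psi> z\<close> and \<open>\<psi> (cnj z)\<close> is constant and vanishes at \<open>b\<close>.\<close>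

lemma M_cnj:
  assumes z: "z \<in> R"
  shows "M (cnj z) = cnj (M z)"
proof -
  obtain x0 :: real where "a < ereal x0" "ereal x0 < b" using ab ereal_dense2 by blast
  then have x0: "x0 \<in> einterval a b" by (simp add: einterval_def)
  obtain s \<alpha> \<beta> where r: "a < ereal s" "s < \<alpha>" "\<alpha> < \<beta>" "\<beta> < x0" "ereal x0 < b" by (rule left_of[OF x0])
  have al: "a < ereal \<alpha>" "ereal \<beta> < b"
    using r by (auto intro: less_trans[of a "ereal s"] less_trans[of _ "ereal x0"])
  obtain p hp where p: "(p, hp) \<in> H" "tau_eq a b q p hp"
    "\<And>x. \<beta> \<le> x \<Longrightarrow> p x = \<psi> (cnj z) x \<and> hp x = cnj z * \<psi> (cnj z) x"
    unfolding H_def using cutoff_right_mem[OF tau_psi[of "cnj z"] psi_domain[OF R_cnj[OF z]] al(1) r(3) al(2), where v=v] by metis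
  \<comment> \<open>From \<open>x0\<close> on, \<open>hp\<close> is \<open>cnj z\<close> times
    \<open>p\<close>, so both sides of the pairing in \<open>green_right\<close> coincide pointwise
    and its boundary term must be 0.\<close>
  have "(\<lambda>x. cnj (gR x0 z x) * hp x) = (\<lambda>x. cnj (z * gR x0 z x) * p x)"
    using p(3) r by (auto simp: gR_def indicator_def)
  then have "l2_inner \<mu> (gR x0 z) hp = l2_inner \<mu> (\<lambda>x. z * gR x0 z x) p"
    unfolding l2_inner_def by simp
  with green_right[OF x0 z p(1) p(2)] have "cnj_wronskian (\<psi> z) p x0 = 0" by simp
  moreover have "cnj_wronskian (\<psi> z) p x0 = cnj_wronskian (\<psi> z) (\<psi> (cnj z)) x0"
    by (rule cnj_wronskian_local(2)[of "{\<beta><..}"]) (use r p(3) in auto)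
  \<comment> \<open>The conjugate of \<open>\<psi> z\<close> is built from the same solutions at
    \<open>cnj z\<close> with coefficient \<open>cnj (M z)\<close>; only the mixed terms of
    \<open>\<theta>\<close> and \<open>\<phi>\<close> survive.\<close>
  moreover have "cnj_wronskian (\<psi> z) (\<psi> (cnj z)) x0
     = (M (cnj z) - cnj (M z)) * (\<theta> (cnj z) x0 * D1 (\<phi> (cnj z)) x0 - D1 (\<theta> (cnj z)) x0 * \<phi> (cnj z) x0)"
    unfolding cnj_wronskian_def D1_psi[OF x0] 
    unfolding \<psi>_def phi_cnj[OF x0] theta_cnj[OF x0] D1_phi_cnj[OF x0] D1_theta_cnj[OF x0]
    by (simp add: algebra_simps)
  ultimately show ?thesis unfolding wronskian_theta_phi[OF x0] by simp
qed

lemma psi_cnj: "z \<in> R \<Longrightarrow> x \<in> einterval a b \<Longrightarrow> \<psi> (cnj z) x = cnj (\<psi> z x)"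
  by (simp add: \<psi>_def phi_cnj theta_cnj M_cnj)

text \<open>Up to the value at \<open>x0\<close>, this is the Green function with one argument equal to \<open>x0\<close>.\<close>

definition G :: "real \<Rightarrow> complex \<Rightarrow> real \<Rightarrow> complex" where
  "G x0 z = (\<lambda>x. \<psi> z x0 * gL x0 z x + \<phi> z x0 * gR x0 z x)"

lemma G_cnj:
  assumes "z \<in> R" "x0 \<in> einterval a b" "x \<in> einterval a b"
  shows "G x0 (cnj z) x = cnj (G x0 z x)"
  unfolding G_def gL_def gR_def using assms by (simp add: phi_cnj psi_cnj indicator_def)

lemma sq_G: "x0 \<in> einterval a b \<Longrightarrow> z \<in> R \<Longrightarrow> square_integrable \<mu> (G x0 z)"
  unfolding G_def by (intro square_integrable_add square_integrable_cmult sq_gL sq_gR)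

text \<open>The coefficients of \<open>gL\<close> and \<open>gR\<close> are chosen so that the terms
  with \<open>D1 u x0\<close> cancel, while \<open>u x0\<close> is multiplied by the conjugated
  Wronskian of \<open>\<psi>\<close> and \<open>\<phi>\<close>, which is 1. Thus \<open>G\<close>
  evaluates functions of the domain at the point \<open>x0\<close>.\<close>

lemma green:
  assumes x0: "x0 \<in> einterval a b" and z: "z \<in> R" and f: "(f, h) \<in> H"
    and u: "tau_eq a b q u h" "AE x in \<mu>. u x = f x"
  shows "l2_inner \<mu> (G x0 z) h - l2_inner \<mu> (\<lambda>x. z * G x0 z x) f = u x0"
proof -
  note sqf = self_adjoint_square_integrable[OF sa f]
  note sL = sq_gL[OF x0, of z] and sR = sq_gR[OF x0 z]
  have 1: "l2_inner \<mu> (G x0 z) k = cnj (\<psi> z x0) * l2_inner \<mu> (gL x0 z) k + cnj (\<phi> z x0) * l2_inner \<mu> (gR x0 z) k"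
    if "square_integrable \<mu> k" for k
    unfolding G_def l2_inner_add_left[OF that square_integrable_cmult[OF sL] square_integrable_cmult[OF sR]]
      l2_inner_cmult_left ..
  have "l2_inner \<mu> (G x0 z) h - l2_inner \<mu> (\<lambda>x. z * G x0 z x) f
      = cnj (\<psi> z x0) * (l2_inner \<mu> (gL x0 z) h - l2_inner \<mu> (\<lambda>x. z * gL x0 z x) f)
      + cnj (\<phi> z x0) * (l2_inner \<mu> (gR x0 z) h - l2_inner \<mu> (\<lambda>x. z * gR x0 z x) f)"
    unfolding l2_inner_cmult_left 1[OF sqf(1)] 1[OF sqf(2)] by (simp add: algebra_simps)
  also have "\<dots> = u x0 * cnj (\<psi> z x0 * D1 (\<phi> z) x0 - D1 (\<psi> z) x0 * \<phi> z x0)"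
    unfolding green_left[OF x0 f u] green_right[OF x0 z f u] cnj_wronskian_def by (simp add: algebra_simps)
  finally show ?thesis unfolding wronskian_psi_phi[OF x0] by simp
qed

text \<open>In the difference the two point evaluations given by \<open>green\<close> cancel, and
  \<open>self_adjointI\<close> applies; a single \<open>G x0 z\<close> retains the evaluation
  term.\<close>

lemma G_diff_mem:
  assumes x0: "x0 \<in> einterval a b" and z: "z \<in> R" and s: "s \<in> R"
  shows "(\<lambda>x. G x0 z x - G x0 s x, \<lambda>x. z * G x0 z x - s * G x0 s x) \<in> H"
proof (rule self_adjointI[OF sa])
  note sq = sq_G[OF x0 z] sq_G[OF x0 s]
  show "square_integrable \<mu> (\<lambda>x. G x0 z x - G x0 s x)" "square_integrable \<mu> (\<lambda>x. z * G x0 z x - s * G x0 s x)"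
    by (intro square_integrable_diff square_integrable_cmult sq)+
  fix f h assume f: "(f, h) \<in> H"
  obtain u where u: "AE x in \<mu>. u x = f x" "tau_eq a b q u h" by (rule rep[OF f])
  note sqf = self_adjoint_square_integrable[OF sa f]
  show "l2_inner \<mu> (\<lambda>x. G x0 z x - G x0 s x) h = l2_inner \<mu> (\<lambda>x. z * G x0 z x - s * G x0 s x) f"
    unfolding l2_inner_diff_left[OF sqf(2) sq]
      l2_inner_diff_left[OF sqf(1) square_integrable_cmult[OF sq(1)] square_integrable_cmult[OF sq(2)]]
    using green[OF x0 z f u(2,1)] green[OF x0 s f u(2,1)] by (simp add: algebra_simps)
qed

section \<open>The diagonal of the Green function\<close>

definition N :: "real \<Rightarrow> complex \<Rightarrow> complex" where
  "N x0 z = \<phi> z x0 * \<psi> z x0"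

text \<open>The first resolvent identity on the diagonal: \<open>green\<close> at
  \<open>cnj z\<close> is applied to the difference \<open>G x0 z - G x0 s\<close>, where passing to
  \<open>cnj z\<close> undoes the conjugation in \<open>l2_inner\<close>.\<close>

lemma N_diff:
  assumes x0: "x0 \<in> einterval a b" and z: "z \<in> R" and s: "s \<in> R"
  shows "N x0 z - N x0 s = (z - s) * (LINT x|\<mu>. G x0 z x * G x0 s x)"
proof -
  let ?f = "\<lambda>x. G x0 z x - G x0 s x" and ?h = "\<lambda>x. z * G x0 z x - s * G x0 s x"
  note mem = G_diff_mem[OF x0 z s]
  obtain u where u: "AE x in \<mu>. u x = ?f x" "tau_eq a b q u ?h" by (rule rep[OF mem])
  note sq = sq_G[OF x0 z] sq_G[OF x0 s]
  obtain NN where NN: "negligible NN" "\<forall>x\<in>einterval a b - NN. u x = ?f x"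
    using AE_lebesgue_on_negligible[OF u(1) einterval_lebesgue] by blast
  \<comment> \<open>The operator provides only some representative \<open>u\<close>, known almost
    everywhere. Left of \<open>x0\<close> only the halves \<open>gL\<close> contribute, so
    \<open>e\<close> vanishes at points arbitrarily close to \<open>x0\<close>, and continuity gives
    the value at \<open>x0\<close> itself.\<close>
  define e where "e = (\<lambda>x. u x - (\<psi> z x0 * \<phi> z x - \<psi> s x0 * \<phi> s x))"
  have cont: "isCont e x0"
    using continuous_on_interior[OF tau_eq_continuous(1)[OF u(2)]]
      continuous_on_interior[OF tau_eq_continuous(1)[OF tau_phi[of z]]]
      continuous_on_interior[OF tau_eq_continuous(1)[OF tau_phi[of s]]] x0
    unfolding e_def by (intro continuous_intros) (auto simp: interior_open)
  have "e x0 = 0"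
  proof (rule ccontr)
    assume "e x0 \<noteq> 0"
    then obtain d where d: "d > 0" "\<And>y. dist y x0 < d \<Longrightarrow> dist (e y) (e x0) < norm (e x0)"
      using cont unfolding continuous_at_eps_delta by (meson zero_less_norm_iff)
    obtain c where c: "a < ereal c" "c < x0" using einterval_nbhd[OF x0] by blast
    define l where "l = max c (x0 - d)"
    have "l < x0" using c d by (simp add: l_def)
    then have "\<not> negligible {l<..<x0}"
      using negligible_interval(2)[of l x0] by (simp add: box_real)
    then have "\<not> {l<..<x0} \<subseteq> NN" using negligible_subset[OF NN(1)] by blast
    then obtain y where "y \<in> {l<..<x0}" "y \<notin> NN" by blast
    then have y: "l < y" "y < x0" "y \<notin> NN" by auto
    have yin: "y \<in> einterval a b"
      using y c x0 by (auto simp: l_def einterval_def intro: less_trans[of a "ereal c"] less_trans[of _ "ereal x0"])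
    have "u y = ?f y" using NN(2) yin y by blast
    then have "e y = 0" using y by (simp add: e_def G_def gL_def gR_def)
    moreover have "dist y x0 < d" using y by (auto simp: l_def dist_real_def)
    ultimately show False using d(2)[of y] by simp
  qed
  then have ux: "u x0 = N x0 z - N x0 s" by (simp add: e_def N_def algebra_simps)
  have "u x0 = l2_inner \<mu> (G x0 (cnj z)) ?h - l2_inner \<mu> (\<lambda>x. cnj z * G x0 (cnj z) x) ?f"
    by (rule green[OF x0 R_cnj[OF z] mem u(2,1), symmetric])
  also have "l2_inner \<mu> (G x0 (cnj z)) ?h = (LINT x|\<mu>. G x0 z x * ?h x)"
    unfolding l2_inner_def by (intro Bochner_Integration.integral_cong refl) (auto simp: G_cnj[OF z x0])
  also have "l2_inner \<mu> (\<lambda>x. cnj z * G x0 (cnj z) x) ?f = (LINT x|\<mu>. z * G x0 z x * ?f x)"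
    unfolding l2_inner_def by (intro Bochner_Integration.integral_cong refl) (auto simp: G_cnj[OF z x0])
  also have "(LINT x|\<mu>. G x0 z x * ?h x) - (LINT x|\<mu>. z * G x0 z x * ?f x)
      = (LINT x|\<mu>. G x0 z x * ?h x - z * G x0 z x * ?f x)"
    by (rule Bochner_Integration.integral_diff[symmetric])
       (rule square_integrable_mult[OF sq(1) square_integrable_diff[OF square_integrable_cmult[OF sq(1)] square_integrable_cmult[OF sq(2)]]],
        rule square_integrable_mult[OF square_integrable_cmult[OF sq(1)] square_integrable_diff[OF sq]])
  also have "\<dots> = (LINT x|\<mu>. (z - s) * (G x0 z x * G x0 s x))"
    by (intro Bochner_Integration.integral_cong refl) (simp add: algebra_simps)
  finally show ?thesis by (simp add: ux)
qed

end

section \<open>Analyticity of \<open>M\<close> and its growth at the real axis\<close>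

context weyl_system
begin

text \<open>\<open>H - z\<close> maps the difference to \<open>(z - s)\<close> times
  \<open>G x0 s\<close>, and for nonreal \<open>z\<close> its inverse is bounded by
  \<open>1 / \<bar>Im z\<bar>\<close>.\<close>

lemma G_diff_norm_nonreal:
  assumes x0: "x0 \<in> einterval a b" and z: "z \<in> R" and s: "s \<in> R"
  shows "\<bar>Im z\<bar> * l2_norm \<mu> (\<lambda>x. G x0 z x - G x0 s x) \<le> norm (z - s) * l2_norm \<mu> (G x0 s)"
proof -
  have "(\<lambda>x. (z * G x0 z x - s * G x0 s x) - z * (G x0 z x - G x0 s x)) = (\<lambda>x. (z - s) * G x0 s x)"
    by (auto simp: algebra_simps)
  with self_adjoint_nonreal_bound[OF sa G_diff_mem[OF x0 z s], of z] show ?thesis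
    by (simp only: l2_norm_cmult)
qed

text \<open>Here \<open>H - s\<close> is inverted, with a constant belonging to \<open>s\<close>, so
  that real points of the resolvent set are covered too. The price is \<open>G x0 z\<close> on the
  right-hand side, which is absorbed for \<open>z\<close> close to \<open>s\<close>.\<close>

lemma G_diff_norm_local:
  assumes x0: "x0 \<in> einterval a b" and s: "s \<in> R"
  shows "\<exists>C>0. \<forall>z\<in>R. C * norm (z - s) \<le> 1 / 2 \<longrightarrow>
    l2_norm \<mu> (\<lambda>x. G x0 z x - G x0 s x) \<le> 2 * C * norm (z - s) * l2_norm \<mu> (G x0 s)"
proof -
  obtain C where C: "0 < C" "\<And>f h. (f, h) \<in> H \<Longrightarrow> l2_norm \<mu> f \<le> C * l2_norm \<mu> (\<lambda>x. h x - s * f x)"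
    using resolvent_set_bound[OF s] by metis
  have "l2_norm \<mu> (\<lambda>x. G x0 z x - G x0 s x) \<le> 2 * C * norm (z - s) * l2_norm \<mu> (G x0 s)"
    if z: "z \<in> R" and small: "C * norm (z - s) \<le> 1 / 2" for z
  proof -
    let ?D = "l2_norm \<mu> (\<lambda>x. G x0 z x - G x0 s x)"
    have "(\<lambda>x. (z * G x0 z x - s * G x0 s x) - s * (G x0 z x - G x0 s x)) = (\<lambda>x. (z - s) * G x0 z x)"
      by (auto simp: algebra_simps)
    with C(2)[OF G_diff_mem[OF x0 z s]] have "?D \<le> C * (norm (z - s) * l2_norm \<mu> (G x0 z))"
      by (simp only: l2_norm_cmult)
    also have "\<dots> \<le> C * (norm (z - s) * (?D + l2_norm \<mu> (G x0 s)))"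
      using C(1) l2_norm_triangle_diff[OF sq_G[OF x0 z] sq_G[OF x0 s]]
      by (intro mult_left_mono) auto
    also have "\<dots> = C * norm (z - s) * ?D + C * norm (z - s) * l2_norm \<mu> (G x0 s)"
      by (simp add: algebra_simps)
    also have "C * norm (z - s) * ?D \<le> 1 / 2 * ?D"
      using small l2_norm_nonneg by (intro mult_right_mono) auto
    finally show ?thesis by simp
  qed
  with C(1) show ?thesis by blast
qed

text \<open>The difference quotient is the integral in \<open>N_diff\<close>; it converges because
  \<open>G x0 z\<close> tends to \<open>G x0 s\<close> in norm.\<close>

lemma N_has_derivative:
  assumes x0: "x0 \<in> einterval a b" and s: "s \<in> R"
  shows "(N x0 has_field_derivative (LINT x|\<mu>. G x0 s x * G x0 s x)) (at s)"
proof -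
  obtain C where C: "0 < C" "\<And>z. z \<in> R \<Longrightarrow> C * norm (z - s) \<le> 1 / 2 \<Longrightarrow>
    l2_norm \<mu> (\<lambda>x. G x0 z x - G x0 s x) \<le> 2 * C * norm (z - s) * l2_norm \<mu> (G x0 s)"
    using G_diff_norm_local[OF x0 s] by blast
  let ?I = "LINT x|\<mu>. G x0 s x * G x0 s x"
  let ?K = "2 * C * l2_norm \<mu> (G x0 s) * l2_norm \<mu> (G x0 s)"
  obtain d where d: "d > 0" "ball s d \<subseteq> R"
    using self_adjoint_resolvent_open[OF sa] s by (meson open_contains_ball)
  have "((\<lambda>z. (N x0 z - N x0 s) / (z - s) - ?I) \<longlongrightarrow> 0) (at s)"
  proof (rule Lim_null_comparison)
    show "\<forall>\<^sub>F z in at s. norm ((N x0 z - N x0 s) / (z - s) - ?I) \<le> norm (z - s) * ?K"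
      unfolding eventually_at
    proof (intro exI[of _ "min d (1 / (2 * C))"] conjI ballI impI)
      fix z assume z: "z \<noteq> s \<and> dist z s < min d (1 / (2 * C))"
      then have zR: "z \<in> R" using d by (auto simp: dist_commute)
      have "norm (z - s) \<le> 1 / (2 * C)" using z by (simp add: dist_norm)
      then have "C * norm (z - s) \<le> C * (1 / (2 * C))" using C(1) by (intro mult_left_mono) auto
      then have "C * norm (z - s) \<le> 1 / 2" using C(1) by simp
      note bnd = C(2)[OF zR this]
      note sq = sq_G[OF x0 zR] sq_G[OF x0 s]
      have "(N x0 z - N x0 s) / (z - s) - ?I = (LINT x|\<mu>. G x0 z x * G x0 s x) - ?I"
      proof -
        have "z - s \<noteq> 0" using z by simp
        then show ?thesis unfolding N_diff[OF x0 zR s] by (subst nonzero_mult_div_cancel_left) auto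
      qed
      also have "\<dots> = (LINT x|\<mu>. G x0 z x * G x0 s x - G x0 s x * G x0 s x)"
        by (rule Bochner_Integration.integral_diff[OF square_integrable_mult[OF sq] square_integrable_mult[OF sq(2) sq(2)], symmetric])
      also have "\<dots> = l2_inner \<mu> (\<lambda>x. cnj (G x0 s x)) (\<lambda>x. G x0 z x - G x0 s x)"
        unfolding l2_inner_def complex_cnj_cnj by (intro Bochner_Integration.integral_cong refl) (simp add: algebra_simps)
      finally have eq: "(N x0 z - N x0 s) / (z - s) - ?I
        = l2_inner \<mu> (\<lambda>x. cnj (G x0 s x)) (\<lambda>x. G x0 z x - G x0 s x)" .
      have "norm (l2_inner \<mu> (\<lambda>x. cnj (G x0 s x)) (\<lambda>x. G x0 z x - G x0 s x))
        \<le> l2_norm \<mu> (\<lambda>x. cnj (G x0 s x)) * l2_norm \<mu> (\<lambda>x. G x0 z x - G x0 s x)"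
        by (rule l2_Cauchy_Schwarz[OF square_integrable_cnj[OF sq(2)] square_integrable_diff[OF sq]])
      then have "norm ((N x0 z - N x0 s) / (z - s) - ?I)
        \<le> l2_norm \<mu> (G x0 s) * l2_norm \<mu> (\<lambda>x. G x0 z x - G x0 s x)"
        unfolding eq l2_norm_cnj .
      also have "\<dots> \<le> l2_norm \<mu> (G x0 s) * (2 * C * norm (z - s) * l2_norm \<mu> (G x0 s))"
        by (rule mult_left_mono[OF bnd l2_norm_nonneg])
      also have "\<dots> = norm (z - s) * ?K" by (simp only: mult_ac)
      finally show "norm ((N x0 z - N x0 s) / (z - s) - ?I) \<le> norm (z - s) * ?K" .
    qed (use d(1) C(1) in simp_all)
    have "((\<lambda>z. norm (z - s) * ?K) \<longlongrightarrow> norm (s - s) * ?K) (at s)"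
      by (intro tendsto_mult tendsto_norm tendsto_diff tendsto_ident_at tendsto_const)
    then show "((\<lambda>z. norm (z - s) * ?K) \<longlongrightarrow> 0) (at s)" by simp
  qed
  then show ?thesis by (simp add: has_field_derivative_iff LIM_zero_iff)
qed

text \<open>A solution vanishing on the whole interval would contradict the Wronskian being
  1.\<close>

lemma phi_nonzero_point:
  obtains x0 where "x0 \<in> einterval a b" "\<phi> z x0 \<noteq> 0"
proof -
  obtain x :: real where "a < ereal x" "ereal x < b" using ab ereal_dense2 by blast
  then have x: "x \<in> einterval a b" by (simp add: einterval_def)
  have "\<exists>x0\<in>einterval a b. \<phi> z x0 \<noteq> 0"
  proof (rule ccontr)
    assume "\<not> ?thesis"
    then have 0: "\<And>y. y \<in> einterval a b \<Longrightarrow> \<phi> z y = 0" by blast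
    then have "D1 (\<phi> z) x = D1 (\<lambda>_. 0) x"
      by (intro D1_cong_open[OF open_einterval x]) auto
    then show False using wronskian_theta_phi[OF x, of z] 0[OF x] by simp
  qed
  then show ?thesis using that by blast
qed

lemma holomorphic_phi: "x \<in> einterval a b \<Longrightarrow> (\<lambda>z. \<phi> z x) holomorphic_on S"
  and holomorphic_theta: "x \<in> einterval a b \<Longrightarrow> (\<lambda>z. \<theta> z x) holomorphic_on S"
proof -
  assume x: "x \<in> einterval a b"
  show "(\<lambda>z. \<phi> z x) holomorphic_on S" "(\<lambda>z. \<theta> z x) holomorphic_on S"
    using real_entire_phi[OF x] real_entire_theta[OF x] unfolding real_entire_def
    by (auto intro: holomorphic_on_subset[of _ UNIV S])
qed

lemma M_eq_N:
  assumes "\<phi> z x0 \<noteq> 0"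
  shows "M z = N x0 z * (1 / (\<phi> z x0)\<^sup>2) - \<theta> z x0 / \<phi> z x0"
  using assms by (simp add: N_def \<psi>_def field_simps power2_eq_square)

text \<open>The point \<open>x0\<close> is chosen separately for each \<open>s\<close> with
  \<open>\<phi> s x0 \<noteq> 0\<close>; this is harmless because \<open>M\<close> does not depend
  on it.\<close>

lemma holomorphic_M: "M holomorphic_on R"
proof -
  have oR: "open R" by (rule self_adjoint_resolvent_open[OF sa])
  have "M field_differentiable (at s)" if s: "s \<in> R" for s
  proof -
    obtain x0 where x0: "x0 \<in> einterval a b" "\<phi> s x0 \<noteq> 0" by (rule phi_nonzero_point)
    have diff: "(\<lambda>z. \<phi> z x0) field_differentiable at s" "(\<lambda>z. \<theta> z x0) field_differentiable at s"
      using holomorphic_on_imp_differentiable_at[OF holomorphic_phi[OF x0(1)] open_UNIV]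
        holomorphic_on_imp_differentiable_at[OF holomorphic_theta[OF x0(1)] open_UNIV] by auto
    have Nd: "N x0 field_differentiable at s"
      using N_has_derivative[OF x0(1) s] by (auto simp: field_differentiable_def)
    have "isCont (\<lambda>z. \<phi> z x0) s" using diff(1) by (rule field_differentiable_imp_continuous_at)
    then have "\<forall>\<^sub>F z in at s. \<phi> z x0 \<noteq> 0"
      using x0(2) tendsto_imp_eventually_ne by (auto simp: isCont_def)
    then obtain d where d: "d > 0" "\<And>z. z \<noteq> s \<Longrightarrow> dist z s < d \<Longrightarrow> \<phi> z x0 \<noteq> 0"
      by (auto simp: eventually_at)
    have nz: "\<phi> z x0 \<noteq> 0" if "z \<in> ball s d" for z
      using that x0(2) d(2)[of z] by (cases "z = s") (auto simp: dist_commute)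
    have "(\<lambda>z. N x0 z * (1 / (\<phi> z x0)\<^sup>2) - \<theta> z x0 / \<phi> z x0) field_differentiable at s"
      using x0(2) by (intro derivative_intros Nd diff) auto
    then obtain D where "((\<lambda>z. N x0 z * (1 / (\<phi> z x0)\<^sup>2) - \<theta> z x0 / \<phi> z x0) has_field_derivative D) (at s)"
      unfolding field_differentiable_def by blast
    then have "(M has_field_derivative D) (at s)"
    proof (rule has_field_derivative_transform_within_open[OF _ open_ball[of s d]])
      show "N x0 z * (1 / (\<phi> z x0)\<^sup>2) - \<theta> z x0 / \<phi> z x0 = M z" if "z \<in> ball s d" for z
        by (rule M_eq_N[OF nz[OF that], symmetric])
    qed (use d(1) in simp)
    then show ?thesis unfolding field_differentiable_def by blast
  qed
  then show ?thesis by (simp add: holomorphic_on_open oR field_differentiable_def)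
qed

text \<open>Comparison with the fixed point \<i>: in the resolvent identity only one factor varies
  with \<open>z\<close>, so only one power of \<open>1 / Im z\<close> is lost. The restriction
  \<open>Im z \<le> 1\<close> lets the constants be written as multiples of
  \<open>1 / Im z\<close>.\<close>

lemma N_bound:
  assumes x0: "x0 \<in> einterval a b"
  obtains C where "0 \<le> C" "\<And>z. 0 < Im z \<Longrightarrow> Im z \<le> 1 \<Longrightarrow> norm z \<le> K \<Longrightarrow> norm (N x0 z) \<le> C / Im z"
proof -
  define A where "A = l2_norm \<mu> (G x0 \<i>)"
  have A: "0 \<le> A" by (simp add: A_def l2_norm_nonneg)
  define L where "L = \<bar>K\<bar> + 1"
  define C where "C = norm (N x0 \<i>) + L * (A * A * (1 + L))"
  have iR: "\<i> \<in> R" by (rule nonreal_in_R) simp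
  have "norm (N x0 z) \<le> C / Im z" if z: "0 < Im z" "Im z \<le> 1" "norm z \<le> K" for z
  proof -
    have zR: "z \<in> R" using z by (intro nonreal_in_R) auto
    note sq = sq_G[OF x0 zR] sq_G[OF x0 iR]
    have zi: "norm (z - \<i>) \<le> L" using norm_triangle_ineq4[of z \<i>] z(3) by (simp add: L_def)
    have D: "l2_norm \<mu> (\<lambda>x. G x0 z x - G x0 \<i> x) \<le> L * A / Im z"
    proof -
      have "Im z * l2_norm \<mu> (\<lambda>x. G x0 z x - G x0 \<i> x) \<le> norm (z - \<i>) * A"
        using G_diff_norm_nonreal[OF x0 zR iR] z by (simp add: A_def)
      also have "\<dots> \<le> L * A" using zi A by (intro mult_right_mono)
      finally show ?thesis using z(1) by (simp add: field_simps)
    qed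
    have "l2_norm \<mu> (G x0 z) \<le> L * A / Im z + A"
      using l2_norm_triangle_diff[OF sq] D by (simp add: A_def)
    also have "\<dots> \<le> L * A / Im z + A / Im z"
    proof -
      have "A \<le> A / Im z" using z A by (simp add: le_divide_eq mult_left_le)
      then show ?thesis by simp
    qed
    finally have Gz: "l2_norm \<mu> (G x0 z) \<le> A * (1 + L) / Im z" by (simp add: distrib_left add_divide_distrib mult.commute)
    have "norm (LINT x|\<mu>. G x0 z x * G x0 \<i> x) \<le> l2_norm \<mu> (G x0 z) * A"
      using l2_Cauchy_Schwarz[OF square_integrable_cnj[OF sq(1)] sq(2)]
      unfolding l2_inner_def l2_norm_cnj A_def complex_cnj_cnj .
    also have "\<dots> \<le> A * (1 + L) / Im z * A" using Gz A by (intro mult_right_mono)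
    finally have I: "norm (LINT x|\<mu>. G x0 z x * G x0 \<i> x) \<le> A * A * (1 + L) / Im z"
      by (simp only: mult_ac times_divide_eq_left times_divide_eq_right)
    have "norm (N x0 z) \<le> norm (N x0 \<i>) + norm (N x0 z - N x0 \<i>)"
      using norm_triangle_ineq[of "N x0 \<i>" "N x0 z - N x0 \<i>"] by simp
    also have "norm (N x0 z - N x0 \<i>) \<le> L * (A * A * (1 + L) / Im z)"
      unfolding N_diff[OF x0 zR iR] norm_mult using zi I by (intro mult_mono) (auto simp: L_def)
    also have "norm (N x0 \<i>) \<le> norm (N x0 \<i>) / Im z"
      using z by (simp add: le_divide_eq mult_left_le)
    finally show ?thesis by (simp add: C_def add_divide_distrib)
  qed
  moreover have "0 \<le> C" using A by (simp add: C_def L_def)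
  ultimately show ?thesis using that by blast
qed

text \<open>The resolvent identity between \<open>z\<close> and \<open>cnj z\<close> gives
  \<open>Im (N x0 z) = Im z * (l2_norm \<mu> (G x0 z))\<^sup>2\<close>.\<close>

lemma Im_N_nonneg:
  assumes x0: "x0 \<in> einterval a b" and z: "0 < Im z"
  shows "0 \<le> Im (N x0 z)"
proof -
  have zR: "z \<in> R" using z by (intro nonreal_in_R) auto
  have "N x0 (cnj z) = cnj (N x0 z)" by (simp add: N_def phi_cnj[OF x0] psi_cnj[OF zR x0])
  then have "N x0 z - cnj (N x0 z) = (z - cnj z) * (LINT x|\<mu>. G x0 z x * G x0 (cnj z) x)"
    using N_diff[OF x0 zR R_cnj[OF zR]] by simp
  also have "(LINT x|\<mu>. G x0 z x * G x0 (cnj z) x) = l2_inner \<mu> (G x0 z) (G x0 z)"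
    unfolding l2_inner_def
    by (intro Bochner_Integration.integral_cong refl) (auto simp: G_cnj[OF zR x0])
  also have "\<dots> = complex_of_real ((l2_norm \<mu> (G x0 z))\<^sup>2)" by (rule l2_inner_self)
  finally have "Im (N x0 z - cnj (N x0 z)) = Im ((z - cnj z) * complex_of_real ((l2_norm \<mu> (G x0 z))\<^sup>2))"
    by simp
  then have "Im (N x0 z) = Im z * (l2_norm \<mu> (G x0 z))\<^sup>2"
    by (simp add: algebra_simps del: of_real_power)
  then show ?thesis using z by simp
qed

text \<open>Multiplying \<open>N\<close> by \<open>h = 1 / (P z)\<^sup>2\<close> could destroy
  positivity of the imaginary part. But \<open>h\<close> is real on the axis, so
  \<open>Im (h z)\<close> is \<open>O(Im z)\<close> and compensates the growth of
  \<open>Re N\<close>; the other term \<open>Im N * Re h\<close> is nonnegative as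
  \<open>Re h > 0\<close> near \<open>l\<close>.\<close>

lemma M_local_bound:
  fixes l :: real
  obtains d C where "d > 0" "0 \<le> C"
    "\<And>z. dist z (complex_of_real l) < d \<Longrightarrow> 0 < Im z \<Longrightarrow> norm (M z) \<le> C / Im z \<and> - C \<le> Im (M z)"
proof -
  let ?l = "complex_of_real l"
  obtain x0 where x0: "x0 \<in> einterval a b" "\<phi> ?l x0 \<noteq> 0" by (rule phi_nonzero_point)
  define P where "P = (\<lambda>z. \<phi> z x0)"
  define h where "h = (\<lambda>z. 1 / (P z)\<^sup>2)"
  have holP: "P holomorphic_on S" for S unfolding P_def by (rule holomorphic_phi[OF x0(1)])
  have contP: "isCont P ?l"
    using holomorphic_on_imp_continuous_on[OF holP[of UNIV]] by (simp add: continuous_on_eq_continuous_at)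
  have Preal: "P (complex_of_real t) \<in> \<real>" for t
    using real_entire_phi[OF x0(1)] by (simp add: real_entire_def P_def)
  have hreal: "h (complex_of_real t) \<in> \<real>" for t
    unfolding h_def by (intro Reals_divide Reals_power Preal) simp
  obtain c where c: "P ?l = complex_of_real c" using Preal by (auto elim: Reals_cases)
  have hl: "0 < Re (h ?l)"
  proof -
    have "c \<noteq> 0" using x0(2) c by (auto simp: P_def)
    moreover have "h ?l = complex_of_real (1 / c\<^sup>2)" by (simp add: h_def c)
    ultimately show ?thesis by simp
  qed
  have conth: "isCont h ?l" unfolding h_def using x0(2) contP
    by (intro continuous_intros) (auto simp: P_def)
  have opn: "open {z. P z \<noteq> 0}"
    using open_Collect_neq[of P "\<lambda>_. 0"] holomorphic_on_imp_continuous_on[OF holP[of UNIV]] by auto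
  have "\<forall>\<^sub>F z in nhds ?l. z \<in> {z. P z \<noteq> 0}"
    by (rule eventually_nhds_in_open[OF opn]) (use x0(2) in \<open>simp add: P_def\<close>)
  then have "\<forall>\<^sub>F z in nhds ?l. P z \<noteq> 0" by simp
  moreover have "\<forall>\<^sub>F z in nhds ?l. 0 < Re (h z)"
    by (rule order_tendstoD(1)[OF _ hl]) (use conth in \<open>auto simp: isCont_def tendsto_at_iff_tendsto_nhds intro!: tendsto_Re\<close>)
  ultimately have "\<forall>\<^sub>F z in nhds ?l. P z \<noteq> 0 \<and> 0 < Re (h z)" by (rule eventually_conj)
  then obtain e where e: "e > 0" "\<And>z. dist z ?l < e \<Longrightarrow> P z \<noteq> 0 \<and> 0 < Re (h z)"
    by (auto simp: eventually_nhds_metric)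
  \<comment> \<open>At most 1, as required by \<open>N_bound\<close>, and below \<open>e\<close>, so
    that \<open>P\<close> has no zero on the closed disc.\<close>
  define d where "d = min 1 (e / 2)"
  have d: "0 < d" "d \<le> 1" "d < e" using e(1) by (auto simp: d_def)
  have nz: "P z \<noteq> 0" "0 < Re (h z)" if "z \<in> cball ?l d" for z
    using e(2)[of z] that d(3) by (auto simp: dist_commute)
  have holh: "h holomorphic_on {z. P z \<noteq> 0}" unfolding h_def by (intro holomorphic_intros holP) auto
  have holdh: "continuous_on (cball ?l d) (deriv h)"
    using holomorphic_on_imp_continuous_on[OF holomorphic_deriv[OF holh opn]] nz(1)
    by (auto intro: continuous_on_subset)
  have holT: "continuous_on (cball ?l d) (\<lambda>z. \<theta> z x0 / P z)"
    using nz(1) by (intro holomorphic_on_imp_continuous_on holomorphic_intros holP holomorphic_theta[OF x0(1)])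
  have conh: "continuous_on (cball ?l d) h"
    using holomorphic_on_imp_continuous_on[OF holh] nz(1) by (auto intro: continuous_on_subset)
  have bd: "\<exists>B\<ge>0. \<forall>z\<in>cball ?l d. norm (f z) \<le> B" if "continuous_on (cball ?l d) f" for f :: "complex \<Rightarrow> complex"
  proof -
    have "bounded (f ` cball ?l d)"
      using that by (intro compact_imp_bounded compact_continuous_image) auto
    then obtain B where "\<forall>y\<in>f ` cball ?l d. norm y \<le> B" by (auto simp: bounded_iff)
    moreover have "B \<le> \<bar>B\<bar>" by simp
    ultimately show ?thesis by (intro exI[of _ "\<bar>B\<bar>"]) (auto intro: order_trans)
  qed
  obtain B1 where B1: "0 \<le> B1" "\<forall>z\<in>cball ?l d. norm (h z) \<le> B1" using bd[OF conh] by blast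
  obtain B2 where B2: "0 \<le> B2" "\<forall>z\<in>cball ?l d. norm (deriv h z) \<le> B2" using bd[OF holdh] by blast
  obtain B3 where B3: "0 \<le> B3" "\<forall>z\<in>cball ?l d. norm (\<theta> z x0 / P z) \<le> B3" using bd[OF holT] by blast
  obtain C1 where C1: "0 \<le> C1" "\<And>z. 0 < Im z \<Longrightarrow> Im z \<le> 1 \<Longrightarrow> norm z \<le> \<bar>l\<bar> + 1 \<Longrightarrow> norm (N x0 z) \<le> C1 / Im z"
    using N_bound[OF x0(1), of "\<bar>l\<bar> + 1"] by metis
  define C where "C = C1 * B1 + C1 * B2 + B3"
  have C0: "0 \<le> C" using C1 B1 B2 B3 by (simp add: C_def)
  show ?thesis
  proof (rule that[OF d(1) C0])
    fix z assume z: "dist z ?l < d" "0 < Im z"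
    have zin: "z \<in> cball ?l d" using z by (simp add: dist_commute)
    have Imd: "\<bar>Im z\<bar> < d" "\<bar>Re z - l\<bar> < d"
      using abs_Im_le_cmod[of "z - ?l"] abs_Re_le_cmod[of "z - ?l"] z(1) by (auto simp: dist_norm)
    have "norm z \<le> norm ?l + norm (z - ?l)" using norm_triangle_ineq[of ?l "z - ?l"] by simp
    then have zn: "norm z \<le> \<bar>l\<bar> + 1" using z(1) d(2) by (simp add: dist_norm)
    have Nz: "norm (N x0 z) \<le> C1 / Im z" using C1(2)[OF z(2) _ zn] Imd d by simp
    have Meq: "M z = N x0 z * h z - \<theta> z x0 / P z"
      using M_eq_N[of z x0] nz(1)[OF zin] by (simp add: h_def P_def)
    have "norm (M z) \<le> norm (N x0 z) * norm (h z) + norm (\<theta> z x0 / P z)"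
      unfolding Meq by (rule order_trans[OF norm_triangle_ineq4]) (simp add: norm_mult)
    also have "\<dots> \<le> C1 / Im z * B1 + B3"
      using Nz B1 B3 zin z C1(1) by (intro add_mono mult_mono) auto
    also have "\<dots> \<le> C1 / Im z * B1 + C1 / Im z * B2 + B3 / Im z"
    proof -
      have "B3 \<le> B3 / Im z" using z Imd d B3(1) by (simp add: le_divide_eq mult_left_le)
      moreover have "0 \<le> C1 / Im z * B2" using C1 B2 z by simp
      ultimately show ?thesis by simp
    qed
    also have "\<dots> = C / Im z" by (simp add: C_def add_divide_distrib)
    finally have 1: "norm (M z) \<le> C / Im z" .
    let ?r = "complex_of_real (Re z)"
    have rin: "?r \<in> cball ?l d" using Imd by (simp add: dist_norm abs_minus_commute flip: of_real_diff)
    \<comment> \<open>Comparison with the real point below \<open>z\<close>, at which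
      \<open>h\<close> is real.\<close>
    have hz: "norm (h z - h ?r) \<le> B2 * norm (z - ?r)"
    proof (rule field_differentiable_bound[OF convex_cball])
      fix y assume y: "y \<in> cball ?l d"
      then have "(h has_field_derivative deriv h y) (at y)"
        using holomorphic_derivI[OF holh opn, of y] nz(1) by auto
      then show "(h has_field_derivative deriv h y) (at y within cball ?l d)"
        by (rule has_field_derivative_at_within)
      show "norm (deriv h y) \<le> B2" using B2 y by blast
    qed (use zin rin in auto)
    have "z - ?r = \<i> * Im z" by (simp add: complex_eq_iff)
    then have nzr: "norm (z - ?r) = Im z" using z(2) by (simp add: norm_mult)
    have "Im (h ?r) = 0" using hreal[of "Re z"] by (simp add: complex_is_Real_iff)
    then have Imh: "\<bar>Im (h z)\<bar> \<le> B2 * Im z"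
      using abs_Im_le_cmod[of "h z - h ?r"] hz by (simp add: nzr)
    have "\<bar>Re (N x0 z) * Im (h z)\<bar> \<le> C1 / Im z * (B2 * Im z)"
      unfolding abs_mult using Imh Nz abs_Re_le_cmod[of "N x0 z"] B2 C1(1) z
      by (intro mult_mono) auto
    then have 2: "\<bar>Re (N x0 z) * Im (h z)\<bar> \<le> C1 * B2" using z by simp
    have 3: "\<bar>Im (\<theta> z x0 / P z)\<bar> \<le> B3"
      using abs_Im_le_cmod[of "\<theta> z x0 / P z"] B3 zin by (meson order_trans)
    have 4: "0 \<le> Im (N x0 z) * Re (h z)"
      using Im_N_nonneg[OF x0(1) z(2)] nz(2)[OF zin] by simp
    have "Im (M z) = Re (N x0 z) * Im (h z) + Im (N x0 z) * Re (h z) - Im (\<theta> z x0 / P z)"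
      by (simp add: Meq del: Im_divide)
    moreover have "0 \<le> C1 * B1" using C1 B1 by simp
    ultimately have "- C \<le> Im (M z)" using 2 3 4 unfolding C_def by linarith
    with 1 show "norm (M z) \<le> C / Im z \<and> - C \<le> Im (M z)" by blast
  qed
qed

end

section \<open>Local analytic continuation across the real axis\<close>

lemma has_field_derivative_integral_param:
  fixes f :: "'a \<Rightarrow> complex \<Rightarrow> complex" and w :: "'a \<Rightarrow> real"
  assumes U: "open U" "z0 \<in> U"
    and meas: "\<And>z. z \<in> U \<Longrightarrow> (\<lambda>t. f t z) \<in> borel_measurable \<mu>"
    and hol: "\<And>t. t \<in> space \<mu> \<Longrightarrow> f t holomorphic_on U"
    and w: "integrable \<mu> w"
    and bnd: "\<And>t z. t \<in> space \<mu> \<Longrightarrow> z \<in> U \<Longrightarrow> norm (f t z) \<le> w t"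
  shows "((\<lambda>z. LINT t|\<mu>. f t z) has_field_derivative (LINT t|\<mu>. deriv (f t) z0)) (at z0)"
proof -
  obtain r' where r': "r' > 0" "ball z0 r' \<subseteq> U" using U by (meson open_contains_ball)
  \<comment> \<open>A third, so that discs of radius \<open>r\<close> about points of
    \<open>cball z0 r\<close> remain in \<open>U\<close>.\<close>
  define r where "r = r' / 3"
  have r: "r > 0" using r' by (simp add: r_def)
  have sub: "cball z0 (2 * r) \<subseteq> U" using r' by (auto simp: r_def)
  have wn: "0 \<le> w t" if "t \<in> space \<mu>" for t using bnd[OF that U(2)] norm_ge_zero order_trans by blast
  have int: "integrable \<mu> (\<lambda>t. f t z)" if "z \<in> U" for z
    by (rule Bochner_Integration.integrable_bound[OF w meas[OF that]])
       (use bnd[OF _ that] wn in \<open>auto intro!: AE_I2\<close>)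
  \<comment> \<open>Cauchy's estimate turns the bound \<open>w\<close> on the functions into
    \<open>w t / r\<close> for their derivatives; the mean value inequality then dominates all
    difference quotients by the same function.\<close>
  have der: "norm (deriv (f t) z) \<le> w t / r" if t: "t \<in> space \<mu>" and z: "z \<in> cball z0 r" for t z
  proof -
    have s: "cball z r \<subseteq> U"
    proof
      fix y assume "y \<in> cball z r"
      then have "dist z0 y \<le> 2 * r" using z dist_triangle[of z0 y z] by auto
      then show "y \<in> U" using sub by auto
    qed
    have "norm ((deriv ^^ 1) (f t) z) \<le> fact 1 * w t / r ^ 1"
    proof (rule Cauchy_inequality)
      show "f t holomorphic_on ball z r"
        by (rule holomorphic_on_subset[OF hol[OF t]]) (use s in auto)
      show "continuous_on (cball z r) (f t)"
        using holomorphic_on_imp_continuous_on[OF hol[OF t]] s by (rule continuous_on_subset)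
      show "norm (f t x) \<le> w t" if "norm (z - x) = r" for x
        by (rule bnd[OF t]) (use s that in \<open>auto simp: dist_norm\<close>)
    qed (rule r)
    then show ?thesis by simp
  qed
  have fd: "(f t has_field_derivative deriv (f t) z) (at z)" if "t \<in> space \<mu>" "z \<in> U" for t z
    by (rule holomorphic_derivI[OF hol[OF that(1)] U(1) that(2)])
  have lip: "norm ((f t z - f t z0) / (z - z0)) \<le> w t / r" if t: "t \<in> space \<mu>" and z: "z \<in> cball z0 r" for t z
  proof (cases "z = z0")
    case False
    have "norm (f t z - f t z0) \<le> w t / r * norm (z - z0)"
    proof (rule field_differentiable_bound[OF convex_cball])
      show "(f t has_field_derivative deriv (f t) y) (at y within cball z0 r)" if "y \<in> cball z0 r" for y
        by (rule has_field_derivative_at_within[OF fd[OF t]]) (use sub that r in auto)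
      show "norm (deriv (f t) y) \<le> w t / r" if "y \<in> cball z0 r" for y by (rule der[OF t that])
    qed (use z r in auto)
    then show ?thesis using False by (simp add: norm_divide divide_le_eq)
  qed (use wn[OF t] r in simp)
  let ?F = "\<lambda>z. LINT t|\<mu>. f t z"
  have "((\<lambda>z. (?F z - ?F z0) / (z - z0)) \<longlongrightarrow> (LINT t|\<mu>. deriv (f t) z0)) (at z0)"
    unfolding tendsto_at_iff_sequentially
  proof (intro allI impI)
    fix X :: "nat \<Rightarrow> complex" assume X: "\<forall>i. X i \<in> UNIV - {z0}" and lim: "X \<longlonglongrightarrow> z0"
    obtain k where k: "\<And>n. n \<ge> k \<Longrightarrow> dist (X n) z0 < r"
      using lim r unfolding lim_sequentially by blast
    define Y where "Y = (\<lambda>n. X (n + k))"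
    have Yin: "Y n \<in> cball z0 r" for n using k[of "n + k"] by (simp add: Y_def dist_commute)
    have "cball z0 r \<subseteq> cball z0 (2 * r)" using r by (intro subset_cball) simp
    then have YU: "Y n \<in> U" for n using sub Yin[of n] by blast
    have Yn: "Y n \<noteq> z0" for n using X by (simp add: Y_def)
    have Ylim: "Y \<longlonglongrightarrow> z0" unfolding Y_def by (rule LIMSEQ_ignore_initial_segment[OF lim])
    let ?s = "\<lambda>n t. (f t (Y n) - f t z0) / (Y n - z0)"
    have ptw: "(\<lambda>n. ?s n t) \<longlonglongrightarrow> deriv (f t) z0" if "t \<in> space \<mu>" for t
    proof -
      have 1: "((\<lambda>y. (f t y - f t z0) / (y - z0)) \<longlongrightarrow> deriv (f t) z0) (at z0)"
        using fd[OF that U(2)] by (simp only: has_field_derivative_iff)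
      have 2: "filterlim Y (at z0) sequentially"
        using Ylim Yn by (simp add: filterlim_at)
      show ?thesis by (rule filterlim_compose[OF 1 2])
    qed
    have sm: "?s n \<in> borel_measurable \<mu>" for n
      using meas[OF YU[of n]] meas[OF U(2)] by (intro borel_measurable_divide borel_measurable_diff) auto
    have "(\<lambda>n. integral\<^sup>L \<mu> (?s n)) \<longlonglongrightarrow> (LINT t|\<mu>. deriv (f t) z0)"
    proof (rule integral_dominated_convergence[where w="\<lambda>t. w t / r"])
      show "(\<lambda>t. deriv (f t) z0) \<in> borel_measurable \<mu>"
        by (rule borel_measurable_LIMSEQ_metric[OF sm ptw])
      show "integrable \<mu> (\<lambda>t. w t / r)" using w by simp
    qed (use sm ptw lip Yin in \<open>auto intro!: AE_I2\<close>)
    moreover have "integral\<^sup>L \<mu> (?s n) = (?F (Y n) - ?F z0) / (Y n - z0)" for n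
      using int[OF YU[of n]] int[OF U(2)] by simp
    ultimately have "(\<lambda>n. (?F (X (n + k)) - ?F z0) / (X (n + k) - z0)) \<longlonglongrightarrow> (LINT t|\<mu>. deriv (f t) z0)"
      by (simp only: Y_def)
    then have "(\<lambda>n. (?F (X n) - ?F z0) / (X n - z0)) \<longlonglongrightarrow> (LINT t|\<mu>. deriv (f t) z0)"
      by (rule LIMSEQ_offset)
    then show "((\<lambda>z. (?F z - ?F z0) / (z - z0)) \<circ> X) \<longlonglongrightarrow> (LINT t|\<mu>. deriv (f t) z0)"
      by (simp add: o_def)
  qed
  then show ?thesis by (simp add: has_field_derivative_iff)
qed

lemma holomorphic_integral_param:
  fixes f :: "'a \<Rightarrow> complex \<Rightarrow> complex" and w :: "'a \<Rightarrow> real"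
  assumes U: "open U"
    and meas: "\<And>z. z \<in> U \<Longrightarrow> (\<lambda>t. f t z) \<in> borel_measurable \<mu>"
    and hol: "\<And>t. t \<in> space \<mu> \<Longrightarrow> f t holomorphic_on U"
    and w: "integrable \<mu> w"
    and bnd: "\<And>t z. t \<in> space \<mu> \<Longrightarrow> z \<in> U \<Longrightarrow> norm (f t z) \<le> w t"
  shows "(\<lambda>z. LINT t|\<mu>. f t z) holomorphic_on U"
  unfolding holomorphic_on_open[OF U]
  using has_field_derivative_integral_param[OF U _ meas hol w bnd] by blast

text \<open>Both conclusions are again of the form required of \<open>u\<close>, a uniform bound and
  a pointwise limit 0, so the lemma can be iterated for repeated primitives normalised at
  \<open>c\<close>.\<close>

lemma dominated_primitive:
  fixes U u :: "nat \<Rightarrow> real \<Rightarrow> real"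
  assumes der: "\<And>n t. t \<in> {p..r} \<Longrightarrow> (U n has_real_derivative u n t) (at t within {p..r})"
    and bnd: "\<And>n t. t \<in> {p..r} \<Longrightarrow> \<bar>u n t\<bar> \<le> B"
    and lim: "\<And>t. t \<in> {p..r} \<Longrightarrow> (\<lambda>n. u n t) \<longlonglongrightarrow> 0"
    and c: "c \<in> {p..r}" "\<And>n. U n c = 0" and t: "t \<in> {p..r}"
  shows "(\<lambda>n. U n t) \<longlonglongrightarrow> 0" and "\<bar>U n t\<bar> \<le> B * (r - p)"
proof -
  have *: "(\<lambda>n. U n y - U n x) \<longlonglongrightarrow> 0" if xy: "p \<le> x" "x \<le> y" "y \<le> r" for x y
  proof -
    have I: "(u n has_integral (U n y - U n x)) {x..y}" for n
    proof (rule fundamental_theorem_of_calculus[OF xy(2)])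
      fix s assume s: "s \<in> {x..y}"
      then have "s \<in> {p..r}" using xy by auto
      from der[OF this, of n] have "(U n has_real_derivative u n s) (at s within {x..y})"
        by (rule has_field_derivative_subset) (use xy in auto)
      then show "(U n has_vector_derivative u n s) (at s within {x..y})"
        by (simp add: has_real_derivative_iff_has_vector_derivative)
    qed
    have "(\<lambda>n. integral {x..y} (u n)) \<longlonglongrightarrow> integral {x..y} (\<lambda>_. 0)"
    proof (rule dominated_convergence(2)[where h="\<lambda>_. B"])
      show "u n integrable_on {x..y}" for n using I by (auto simp: integrable_on_def)
      show "(\<lambda>_. B) integrable_on {x..y}" by (rule integrable_const_ivl)
    qed (use bnd lim xy in auto)
    moreover have "integral {x..y} (u n) = U n y - U n x" for n using I by (rule integral_unique)
    ultimately show ?thesis by simp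
  qed
  show "(\<lambda>n. U n t) \<longlonglongrightarrow> 0"
  proof (cases "c \<le> t")
    case True
    then show ?thesis using *[of c t] c t by simp
  next
    case False
    then have "(\<lambda>n. - (- U n t)) \<longlonglongrightarrow> - 0" using *[of t c] c t by (intro tendsto_minus) simp
    then show ?thesis by simp
  qed
  have B: "0 \<le> B" using bnd[OF c(1), of n] by linarith
  have "norm (U n t - U n c) \<le> B * norm (t - c)"
    by (rule field_differentiable_bound[OF convex_real_interval(5) der])
       (use bnd t c in auto)
  also have "\<dots> \<le> B * (r - p)" using t c B by (intro mult_left_mono) auto
  finally show "\<bar>U n t\<bar> \<le> B * (r - p)" using c(2) by simp
qed

section \<open>Reflection across the real axis\<close>

lemma deriv_cnj_symmetric:
  assumes f: "f holomorphic_on S" and S: "open S" "\<And>z. z \<in> S \<Longrightarrow> cnj z \<in> S"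
    and sym: "\<And>z. z \<in> S \<Longrightarrow> f (cnj z) = cnj (f z)" and z: "z \<in> S"
  shows "deriv f (cnj z) = cnj (deriv f z)"
proof -
  have "(f has_field_derivative deriv f (cnj (cnj z))) (at (cnj (cnj z)))"
    using holomorphic_derivI[OF f S(1) z] by simp
  then have "((cnj \<circ> f \<circ> cnj) has_field_derivative cnj (deriv f z)) (at (cnj z))"
    using has_field_derivative_cnj_cnj[of f "deriv f (cnj (cnj z))" "cnj z"] by simp
  then have "(f has_field_derivative cnj (deriv f z)) (at (cnj z))"
    by (rule has_field_derivative_transform_within_open[OF _ S(1) S(2)[OF z]]) (simp add: sym[OF S(2)] sym)
  then show ?thesis by (rule DERIV_imp_deriv)
qed

text \<open>A triple primitive of \<open>D\<close> is Lipschitz on the box, and its imaginary part is a quadratic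
  polynomial on the real axis; so the reflection principle applies to it.\<close>

lemma reflection_extension:
  fixes D :: "complex \<Rightarrow> complex" and x0 \<delta> :: real and eps :: "nat \<Rightarrow> real"
  defines "Q \<equiv> {z. \<bar>Re z - x0\<bar> < \<delta> \<and> 0 < Im z \<and> Im z < \<delta>}"
  assumes d: "0 < \<delta>"
    and hol: "D holomorphic_on Q" and bound: "\<And>z. z \<in> Q \<Longrightarrow> norm (D z) \<le> C / Im z"
    and eps: "\<And>n. 0 < eps n" "\<And>n. eps n < \<delta>" "eps \<longlonglongrightarrow> 0"
    and int_bound: "\<And>n s t. x0 - \<delta> < s \<Longrightarrow> s \<le> t \<Longrightarrow> t < x0 + \<delta> \<Longrightarrow>
        \<bar>integral {s..t} (\<lambda>l. Im (D (Complex l (eps n))))\<bar> \<le> B"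
    and int_lim: "\<And>s t. x0 - \<delta> < s \<Longrightarrow> s \<le> t \<Longrightarrow> t < x0 + \<delta> \<Longrightarrow>
        (\<lambda>n. integral {s..t} (\<lambda>l. Im (D (Complex l (eps n))))) \<longlonglongrightarrow> 0"
  shows "\<exists>e r. 0 < r \<and> e holomorphic_on ball (complex_of_real x0) r \<and>
    (\<forall>z\<in>ball (complex_of_real x0) r. 0 < Im z \<longrightarrow> e z = D z) \<and>
    (\<forall>z\<in>ball (complex_of_real x0) r. e (cnj z) = cnj (e z))"
proof -
  have Qeq: "Q = {z. Re z > x0 - \<delta>} \<inter> {z. Re z < x0 + \<delta>} \<inter> ({z. Im z > 0} \<inter> {z. Im z < \<delta>})"
    by (auto simp: Q_def)
  have oQ: "open Q" unfolding Qeq by (intro open_Int open_halfspace_Re_gt open_halfspace_Re_lt open_halfspace_Im_gt open_halfspace_Im_lt)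
  have cQ: "convex Q" unfolding Qeq
    by (intro convex_Int convex_halfspace_Re_gt convex_halfspace_Re_lt convex_halfspace_Im_gt convex_halfspace_Im_lt)
  have prim: "\<exists>g. \<forall>z\<in>Q. (g has_field_derivative f z) (at z)" if fh: "f holomorphic_on Q" for f
  proof -
    obtain g where "\<And>z. z \<in> Q \<Longrightarrow> (g has_field_derivative f z) (at z within Q)"
      by (rule holomorphic_convex_primitive'[OF cQ oQ fh]) blast
    then have "\<And>z. z \<in> Q \<Longrightarrow> (g has_field_derivative f z) (at z)"
      using at_within_open[OF _ oQ] by metis
    then show ?thesis by blast
  qed
  have hol': "g holomorphic_on Q" if "\<forall>z\<in>Q. (g has_field_derivative f z) (at z)" for f g
    using that by (auto simp: holomorphic_on_open[OF oQ])
  \<comment> \<open>One primitive of a function of size \<open>1 / Im z\<close> may still grow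
    logarithmically, the second is bounded, and the third is Lipschitz and so extends to the
    axis.\<close>
  obtain F where F: "\<forall>z\<in>Q. (F has_field_derivative D z) (at z)" using prim[OF hol] by blast
  obtain F2 where F2: "\<forall>z\<in>Q. (F2 has_field_derivative F z) (at z)" using prim[OF hol'[OF F]] by blast
  obtain F3 where F3: "\<forall>z\<in>Q. (F3 has_field_derivative F2 z) (at z)" using prim[OF hol'[OF F2]] by blast
  \<comment> \<open>Halving keeps the horizontal segment at height \<open>\<eta>\<close> compactly
    inside \<open>Q\<close>, where \<open>F\<close> and \<open>F2\<close> are bounded.\<close>
  define \<eta> where "\<eta> = \<delta> / 2"
  have eta: "0 < \<eta>" "\<eta> < \<delta>" using d by (auto simp: \<eta>_def)
  have C0: "0 \<le> C"
  proof -
    have "Complex x0 \<eta> \<in> Q" using eta by (simp add: Q_def)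
    from order_trans[OF norm_ge_zero bound[OF this]] have "0 \<le> C / \<eta>" by simp
    then show ?thesis using eta by (simp add: zero_le_divide_iff)
  qed
  \<comment> \<open>First order Taylor formula downwards from height \<open>\<eta>\<close>. The
    derivative of \<open>F2 w + F w * (z - w)\<close> is \<open>D w * (z - w)\<close>, and the
    length \<open>Im w - Im z\<close> of the second factor compensates \<open>1 / Im w\<close>, so
    no logarithm appears.\<close>
  have taylor: "norm (F2 (Complex x y) - (F2 (Complex x \<eta>) + F (Complex x \<eta>) * (Complex x y - Complex x \<eta>))) \<le> C * \<eta>"
    if x: "\<bar>x - x0\<bar> < \<delta>" and y: "0 < y" "y \<le> \<eta>" for x y
  proof -
    let ?z = "Complex x y" and ?S = "closed_segment (Complex x \<eta>) (Complex x y)"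
    let ?h = "\<lambda>w. F2 w + F w * (?z - w)"
    have S: "Re w = x \<and> y \<le> Im w \<and> Im w \<le> \<eta>" if wS: "w \<in> ?S" for w
    proof -
      obtain u where u: "0 \<le> u" "u \<le> 1" "w = (1 - u) *\<^sub>R Complex x \<eta> + u *\<^sub>R Complex x y"
        using wS unfolding closed_segment_def by blast
      have "Im w = (1 - u) * \<eta> + u * y" "Re w = (1 - u) * x + u * x" by (simp_all add: u(3))
      moreover have "(1 - u) * y \<le> (1 - u) * \<eta>" "u * y \<le> u * \<eta>"
        using u y by (auto intro: mult_left_mono)
      ultimately show ?thesis by (simp add: algebra_simps)
    qed
    have SQ: "w \<in> Q" if "w \<in> ?S" for w using S[OF that] x y eta by (auto simp: Q_def)
    have "norm (?h ?z - ?h (Complex x \<eta>)) \<le> C * norm (?z - Complex x \<eta>)"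
    proof (rule field_differentiable_bound[OF convex_closed_segment[of "Complex x \<eta>" "Complex x y"]])
      fix w assume w: "w \<in> ?S"
      have "(?h has_field_derivative (F w + (D w * (?z - w) + (0 - 1) * F w))) (at w)"
        using F F2 SQ[OF w] by (intro DERIV_add DERIV_mult DERIV_diff DERIV_const DERIV_ident) auto
      then have "(?h has_field_derivative D w * (?z - w)) (at w)" by simp
      then show "(?h has_field_derivative D w * (?z - w)) (at w within ?S)"
        by (rule has_field_derivative_at_within)
      have "?z - w = Complex 0 (y - Im w)" using S[OF w] by (simp add: complex_eq_iff)
      then have "norm (?z - w) = Im w - y" using S[OF w] by (simp add: complex_norm)
      then have "norm (D w * (?z - w)) \<le> C / Im w * (Im w - y)"
        unfolding norm_mult using bound[OF SQ[OF w]] S[OF w] y C0 by (intro mult_mono) auto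
      also have "\<dots> \<le> C / Im w * Im w" using S[OF w] y C0 by (intro mult_left_mono) auto
      also have "\<dots> = C" using S[OF w] y by simp
      finally show "norm (D w * (?z - w)) \<le> C" .
    qed auto
    moreover have "?z - Complex x \<eta> = Complex 0 (y - \<eta>)" by (simp add: complex_eq_iff)
    then have "norm (?z - Complex x \<eta>) \<le> \<eta>" using y by (simp add: complex_norm)
    then have "C * norm (?z - Complex x \<eta>) \<le> C * \<eta>" using C0 by (rule mult_left_mono)
    ultimately show ?thesis by simp
  qed
  have "\<exists>K. \<forall>z. \<bar>Re z - x0\<bar> \<le> \<eta> \<longrightarrow> 0 < Im z \<longrightarrow> Im z \<le> \<eta> \<longrightarrow> norm (F2 z) \<le> K"
  proof -
    let ?L = "closed_segment (Complex (x0 - \<eta>) \<eta>) (Complex (x0 + \<eta>) \<eta>)"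
    have LQ: "?L \<subseteq> Q" using cQ by (rule closed_segment_subset[rotated 2]) (use eta in \<open>auto simp: Q_def\<close>)
    have bd: "\<exists>K. \<forall>z\<in>?L. norm (f z) \<le> K" if "f holomorphic_on Q" for f
    proof -
      have "bounded (f ` ?L)"
        using holomorphic_on_imp_continuous_on[OF that] LQ
        by (intro compact_imp_bounded compact_continuous_image) (auto intro: continuous_on_subset)
      then show ?thesis by (auto simp: bounded_iff)
    qed
    obtain K1 where K1: "\<forall>z\<in>?L. norm (F z) \<le> K1" using bd[OF hol'[OF F]] by blast
    obtain K2 where K2: "\<forall>z\<in>?L. norm (F2 z) \<le> K2" using bd[OF hol'[OF F2]] by blast
    have "norm (F2 z) \<le> C * \<eta> + (K2 + K1 * \<eta>)" if z: "\<bar>Re z - x0\<bar> \<le> \<eta>" "0 < Im z" "Im z \<le> \<eta>" for z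
    proof -
      have "\<bar>Re z - x0\<bar> < \<delta>" using z eta by simp
      from taylor[OF this z(2,3)] have
        t: "norm (F2 z - (F2 (Complex (Re z) \<eta>) + F (Complex (Re z) \<eta>) * (z - Complex (Re z) \<eta>))) \<le> C * \<eta>" by simp
      have L: "Complex (Re z) \<eta> \<in> ?L"
        unfolding closed_segment_same_Im by (use z eta in \<open>auto simp: closed_segment_same_Im closed_segment_eq_real_ivl\<close>)
      have "z - Complex (Re z) \<eta> = Complex 0 (Im z - \<eta>)" by (simp add: complex_eq_iff)
      then have "norm (z - Complex (Re z) \<eta>) \<le> \<eta>" using z by (simp add: complex_norm)
      moreover have "0 \<le> K1" using K1 L norm_ge_zero order_trans by blast
      ultimately have "norm (F (Complex (Re z) \<eta>) * (z - Complex (Re z) \<eta>)) \<le> K1 * \<eta>"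
        unfolding norm_mult using K1 L by (intro mult_mono) auto
      moreover have "norm (F2 (Complex (Re z) \<eta>)) \<le> K2" using K2 L by blast
      ultimately have "norm (F2 (Complex (Re z) \<eta>) + F (Complex (Re z) \<eta>) * (z - Complex (Re z) \<eta>)) \<le> K2 + K1 * \<eta>"
        using norm_triangle_mono by blast
      then show ?thesis using t norm_triangle_sub[of "F2 z" "F2 (Complex (Re z) \<eta>) + F (Complex (Re z) \<eta>) * (z - Complex (Re z) \<eta>)"]
        by linarith
    qed
    then show ?thesis by blast
  qed
  then obtain K where K: "\<And>z. \<bar>Re z - x0\<bar> \<le> \<eta> \<Longrightarrow> 0 < Im z \<Longrightarrow> Im z \<le> \<eta> \<Longrightarrow> norm (F2 z) \<le> K" by blast
  define X where "X = {z. \<bar>Re z - x0\<bar> < \<eta> \<and> 0 < Im z \<and> Im z < \<eta>}"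
  have Xeq: "X = {z. Re z > x0 - \<eta>} \<inter> {z. Re z < x0 + \<eta>} \<inter> ({z. Im z > 0} \<inter> {z. Im z < \<eta>})"
    by (auto simp: X_def)
  have cX: "convex X" unfolding Xeq
    by (intro convex_Int convex_halfspace_Re_gt convex_halfspace_Re_lt convex_halfspace_Im_gt convex_halfspace_Im_lt)
  have XQ: "X \<subseteq> Q" using eta by (auto simp: X_def Q_def)
  have lip: "norm (F3 z - F3 z') \<le> K * norm (z - z')" if "z \<in> X" "z' \<in> X" for z z'
  proof (rule field_differentiable_bound[OF cX _ _ that])
    fix y assume y: "y \<in> X"
    then show "(F3 has_field_derivative F2 y) (at y within X)"
      using F3 XQ by (intro has_field_derivative_subset[of F3 "F2 y" y UNIV X]) auto
    show "norm (F2 y) \<le> K" using y by (intro K) (auto simp: X_def)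
  qed
  \<comment> \<open>Uniform continuity is what provides continuous boundary values \<open>g\<close>
    on the real axis.\<close>
  have "uniformly_continuous_on X F3"
    unfolding uniformly_continuous_on_def
  proof (intro allI impI)
    fix e :: real assume e: "0 < e"
    show "\<exists>d>0. \<forall>x\<in>X. \<forall>x'\<in>X. dist x' x < d \<longrightarrow> dist (F3 x') (F3 x) < e"
    proof (intro exI[of _ "e / (\<bar>K\<bar> + 1)"] conjI ballI impI)
      fix x x' assume x: "x \<in> X" "x' \<in> X" "dist x' x < e / (\<bar>K\<bar> + 1)"
      have "norm (F3 x' - F3 x) \<le> K * norm (x' - x)" using lip x by blast
      also have "\<dots> \<le> (\<bar>K\<bar> + 1) * norm (x' - x)" by (intro mult_right_mono) auto
      also have "\<dots> < e" using x(3) by (simp add: dist_norm field_simps)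
      finally show "dist (F3 x') (F3 x) < e" by (simp add: dist_norm)
    qed (use e in simp)
  qed
  then obtain g where g: "uniformly_continuous_on (closure X) g" "\<And>z. z \<in> X \<Longrightarrow> F3 z = g z"
    by (rule uniformly_continuous_on_extension_on_closure) blast
  have cg: "continuous_on (closure X) g" using g(1) by (rule uniformly_continuous_imp_continuous)
  have "eventually (\<lambda>n. eps n < \<eta>) sequentially"
    using eps(3) eta(1) by (rule order_tendstoD(2))
  have seqlim: "(\<lambda>n. F3 (Complex t (eps n))) \<longlonglongrightarrow> g (complex_of_real t) \<and> complex_of_real t \<in> closure X"
    if t: "\<bar>t - x0\<bar> < \<eta>" for t
  proof -
    have ev: "\<forall>\<^sub>F n in sequentially. Complex t (eps n) \<in> X"
      using \<open>eventually (\<lambda>n. eps n < \<eta>) sequentially\<close> by eventually_elim (use t eps in \<open>auto simp: X_def\<close>)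
    have "(\<lambda>n. Complex t (eps n)) \<longlonglongrightarrow> Complex t 0"
      by (intro tendsto_Complex tendsto_const eps)
    then have lim: "(\<lambda>n. Complex t (eps n)) \<longlonglongrightarrow> complex_of_real t" by (simp add: complex_of_real_def)
    have cl: "complex_of_real t \<in> closure X"
      by (rule Lim_in_closed_set[OF closed_closure _ _ lim])
         (use ev closure_subset in \<open>auto elim!: eventually_mono\<close>)
    have "(\<lambda>n. g (Complex t (eps n))) \<longlonglongrightarrow> g (complex_of_real t)"
      by (rule continuous_on_tendsto_compose[OF cg lim cl])
         (use ev closure_subset in \<open>auto elim!: eventually_mono\<close>)
    moreover have "\<forall>\<^sub>F n in sequentially. g (Complex t (eps n)) = F3 (Complex t (eps n))"
      using ev by eventually_elim (simp add: g(2))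
    ultimately show ?thesis using cl by (auto dest: Lim_transform_eventually)
  qed
  \<comment> \<open>The integral hypotheses fix imaginary parts only up to integration constants
    depending on \<open>n\<close>. Subtracting them makes \<open>u1\<close>, \<open>u2\<close>,
    \<open>u3\<close> vanish at \<open>x0\<close>, and each is the derivative of the next.\<close>
  define c1 c2 c3 where "c1 = (\<lambda>n. Im (F (Complex x0 (eps n))))" and "c2 = (\<lambda>n. Im (F2 (Complex x0 (eps n))))"
    and "c3 = (\<lambda>n. Im (F3 (Complex x0 (eps n))))"
  define u1 where "u1 = (\<lambda>n t. Im (F (Complex t (eps n))) - c1 n)"
  define u2 where "u2 = (\<lambda>n t. Im (F2 (Complex t (eps n))) - c2 n - (t - x0) * c1 n)"
  define u3 where "u3 = (\<lambda>n t. Im (F3 (Complex t (eps n))) - c3 n - (t - x0) * c2 n - (t - x0)\<^sup>2 / 2 * c1 n)"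
  let ?I = "{x0 - \<eta>..x0 + \<eta>}"
  have horiz: "((\<lambda>t. Im (f (Complex t (eps n)))) has_real_derivative Im (f' (Complex t (eps n)))) (at t)"
    if f: "\<forall>z\<in>Q. (f has_field_derivative f' z) (at z)" and t: "x0 - \<delta> < t" "t < x0 + \<delta>" for f f' n t
  proof -
    have "Complex t (eps n) \<in> Q" using eps t by (auto simp: Q_def)
    then have 1: "(f has_field_derivative f' (Complex t (eps n))) (at (Complex t (eps n)))" using f by blast
    have "((\<lambda>t. Complex t (eps n)) has_vector_derivative 1) (at t)"
      unfolding Complex_eq by (auto intro!: derivative_eq_intros)
    from field_vector_diff_chain_at[OF this 1]
    have "((\<lambda>t. f (Complex t (eps n))) has_vector_derivative f' (Complex t (eps n))) (at t)"
      by (simp add: o_def)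
    from bounded_linear.has_vector_derivative[OF bounded_linear_Im this] show ?thesis
      by (simp only: has_real_derivative_iff_has_vector_derivative)
  qed
  have d1: "((\<lambda>t. Im (F (Complex t (eps n)))) has_real_derivative Im (D (Complex t (eps n)))) (at t)"
    if "x0 - \<delta> < t" "t < x0 + \<delta>" for t n by (rule horiz[OF F that])
  have d2: "(u2 n has_real_derivative u1 n t) (at t within ?I)" if "t \<in> ?I" for t n
  proof -
    have t: "x0 - \<delta> < t" "t < x0 + \<delta>" using that eta by auto
    have "(u2 n has_real_derivative u1 n t) (at t)"
      unfolding u2_def u1_def
      using DERIV_diff[OF DERIV_diff[OF horiz[OF F2 t, of n] DERIV_const[of "c2 n"]]
          DERIV_cmult_right[OF DERIV_diff[OF DERIV_ident DERIV_const[of x0]], of "c1 n"]] by simp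
    then show ?thesis by (rule has_field_derivative_at_within)
  qed
  have d3: "(u3 n has_real_derivative u2 n t) (at t within ?I)" if "t \<in> ?I" for t n
  proof -
    have t: "x0 - \<delta> < t" "t < x0 + \<delta>" using that eta by auto
    have "(u3 n has_real_derivative u2 n t) (at t)"
    proof -
      have "((\<lambda>t. (t - x0)\<^sup>2 / 2 * c1 n) has_real_derivative (t - x0) * c1 n) (at t)"
        by (auto intro!: derivative_eq_intros)
      from DERIV_diff[OF DERIV_diff[OF DERIV_diff[OF horiz[OF F3 t, of n] DERIV_const[of "c3 n"]]
          DERIV_cmult_right[OF DERIV_diff[OF DERIV_ident DERIV_const[of x0]], of "c2 n"]] this]
      show ?thesis unfolding u3_def u2_def by simp
    qed
    then show ?thesis by (rule has_field_derivative_at_within)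
  qed
  have ftc: "integral {s..t} (\<lambda>l. Im (D (Complex l (eps n)))) = Im (F (Complex t (eps n))) - Im (F (Complex s (eps n)))"
    if "x0 - \<delta> < s" "s \<le> t" "t < x0 + \<delta>" for s t n
  proof (rule integral_unique, rule fundamental_theorem_of_calculus[OF that(2)])
    fix l assume "l \<in> {s..t}"
    show "((\<lambda>t. Im (F (Complex t (eps n)))) has_vector_derivative Im (D (Complex l (eps n)))) (at l within {s..t})"
      unfolding has_real_derivative_iff_has_vector_derivative[symmetric]
      by (rule has_field_derivative_at_within[OF d1]) (use that \<open>l \<in> {s..t}\<close> in auto)
  qed
  have u1: "\<bar>u1 n t\<bar> \<le> B" "(\<lambda>n. u1 n t) \<longlonglongrightarrow> 0" if "t \<in> ?I" for n t
  proof -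
    have "\<bar>u1 n t\<bar> \<le> B \<and> (\<lambda>n. u1 n t) \<longlonglongrightarrow> 0"
    proof (cases "x0 \<le> t")
      case True
      have *: "x0 - \<delta> < x0" "x0 \<le> t" "t < x0 + \<delta>" using that True eta by auto
      have "u1 n t = integral {x0..t} (\<lambda>l. Im (D (Complex l (eps n))))" for n
        by (simp add: ftc[OF *] u1_def c1_def)
      then show ?thesis using int_bound[OF *] int_lim[OF *] by simp
    next
      case False
      then have *: "x0 - \<delta> < t" "t \<le> x0" "x0 < x0 + \<delta>" using that eta by auto
      have eq: "u1 n t = - integral {t..x0} (\<lambda>l. Im (D (Complex l (eps n))))" for n
        by (simp add: ftc[OF *] u1_def c1_def)
      have "(\<lambda>n. - integral {t..x0} (\<lambda>l. Im (D (Complex l (eps n))))) \<longlonglongrightarrow> - 0"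
        by (intro tendsto_minus int_lim[OF *])
      then show ?thesis using int_bound[OF *, of n] by (simp add: eq)
    qed
    then show "\<bar>u1 n t\<bar> \<le> B" "(\<lambda>n. u1 n t) \<longlonglongrightarrow> 0" by auto
  qed
  have mid: "x0 \<in> ?I" using eta by simp
  have z2: "u2 n x0 = 0" and z3: "u3 n x0 = 0" for n by (simp_all add: u2_def u3_def c2_def c3_def)
  note u2 = dominated_primitive[OF d2 u1 mid z2]
  note u3 = dominated_primitive(1)[OF d3 u2(2,1) mid z3]
  have u3lim: "(\<lambda>n. u3 n t) \<longlonglongrightarrow> 0" if "t \<in> ?I" for t using u3 that by blast
  define V where "V = (\<lambda>t. Im (g (complex_of_real t)) - Im (g (complex_of_real x0)))"
  \<comment> \<open>\<open>F3\<close> converges to \<open>g\<close> and \<open>u3\<close> to 0, so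
    the quadratic polynomials that were subtracted must converge as well.\<close>
  have Vlim: "(\<lambda>n. (t - x0) * c2 n + (t - x0)\<^sup>2 / 2 * c1 n) \<longlonglongrightarrow> V t" if t: "\<bar>t - x0\<bar> < \<eta>" for t
  proof -
    have tI: "t \<in> ?I" using t by auto
    have "(\<lambda>n. Im (F3 (Complex t (eps n))) - c3 n - u3 n t) \<longlonglongrightarrow> Im (g (complex_of_real t)) - Im (g (complex_of_real x0)) - 0"
      unfolding c3_def using seqlim[OF t] seqlim[of x0] eta
      by (intro tendsto_diff tendsto_Im u3lim[OF tI]) auto
    then show ?thesis by (simp add: u3_def V_def)
  qed
  \<comment> \<open>Values at \<open>x0 + m\<close> and \<open>x0 - m\<close> determine both
    coefficients of a quadratic without constant term; hence \<open>c2\<close> and \<open>c1\<close>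
    converge.\<close>
  define m where "m = \<eta> / 2"
  have m: "0 < m" "m < \<eta>" using eta by (auto simp: m_def)
  have Vp: "(\<lambda>n. m * c2 n + m\<^sup>2 / 2 * c1 n) \<longlonglongrightarrow> V (x0 + m)" using Vlim[of "x0 + m"] m by simp
  have Vm: "(\<lambda>n. - m * c2 n + m\<^sup>2 / 2 * c1 n) \<longlonglongrightarrow> V (x0 - m)" using Vlim[of "x0 - m"] m by simp
  define \<alpha> where "\<alpha> = (V (x0 + m) - V (x0 - m)) / (2 * m)"
  define \<gamma> where "\<gamma> = (V (x0 + m) + V (x0 - m)) / m\<^sup>2"
  have c2lim: "c2 \<longlonglongrightarrow> \<alpha>"
  proof -
    have "(\<lambda>n. ((m * c2 n + m\<^sup>2 / 2 * c1 n) - (- m * c2 n + m\<^sup>2 / 2 * c1 n)) / (2 * m)) \<longlonglongrightarrow> \<alpha>"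
      unfolding \<alpha>_def using m by (intro tendsto_divide tendsto_diff Vp Vm tendsto_const) auto
    moreover have "((m * c2 n + m\<^sup>2 / 2 * c1 n) - (- m * c2 n + m\<^sup>2 / 2 * c1 n)) / (2 * m) = c2 n" for n
      using m by (simp add: field_simps)
    ultimately show ?thesis by simp
  qed
  have c1lim: "c1 \<longlonglongrightarrow> \<gamma>"
  proof -
    have "(\<lambda>n. ((m * c2 n + m\<^sup>2 / 2 * c1 n) + (- m * c2 n + m\<^sup>2 / 2 * c1 n)) / m\<^sup>2) \<longlonglongrightarrow> \<gamma>"
      unfolding \<gamma>_def using m by (intro tendsto_divide tendsto_add Vp Vm tendsto_const) auto
    moreover have "((m * c2 n + m\<^sup>2 / 2 * c1 n) + (- m * c2 n + m\<^sup>2 / 2 * c1 n)) / m\<^sup>2 = c1 n" for n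
      using m by (simp add: field_simps)
    ultimately show ?thesis by simp
  qed
  have Vquad: "V t = (t - x0) * \<alpha> + (t - x0)\<^sup>2 / 2 * \<gamma>" if "\<bar>t - x0\<bar> < \<eta>" for t
    by (rule LIMSEQ_unique[OF Vlim[OF that]]) (intro tendsto_intros c1lim c2lim)
  \<comment> \<open>A polynomial with real coefficients in \<open>z - x0\<close> that equals
    \<open>Im g\<close> on the axis; so \<open>g - \<i> * p\<close> is real there.\<close>
  define p where "p = (\<lambda>z::complex. complex_of_real (Im (g (complex_of_real x0))) + (z - x0) * \<alpha> + (z - x0)\<^sup>2 / 2 * \<gamma>)"
  have Im_g: "Im (g (complex_of_real t)) = Re (p (complex_of_real t)) \<and> Im (p (complex_of_real t)) = 0" if "\<bar>t - x0\<bar> < \<eta>" for t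
  proof -
    have "p (complex_of_real t) = complex_of_real (Im (g (complex_of_real x0)) + (t - x0) * \<alpha> + (t - x0)\<^sup>2 / 2 * \<gamma>)"
      by (simp add: p_def)
    moreover have "Im (g (complex_of_real t)) = Im (g (complex_of_real x0)) + (t - x0) * \<alpha> + (t - x0)\<^sup>2 / 2 * \<gamma>"
      using Vquad[OF that] by (simp add: V_def)
    ultimately show ?thesis by (simp del: of_real_add of_real_mult)
  qed
  let ?S = "ball (complex_of_real x0) \<eta>"
  have Sre: "\<bar>Re z - x0\<bar> < \<eta>" "\<bar>Im z\<bar> < \<eta>" if "z \<in> ?S" for z
    using that abs_Re_le_cmod[of "z - x0"] abs_Im_le_cmod[of "z - x0"] by (auto simp: dist_norm norm_minus_commute)
  have SX: "z \<in> X" if "z \<in> ?S" "0 < Im z" for z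
    using Sre[OF that(1)] that(2) by (auto simp: X_def)
  have Scl: "z \<in> closure X" if "z \<in> ?S" "0 \<le> Im z" for z
  proof (cases "Im z = 0")
    case True
    then have "z = complex_of_real (Re z)" by (simp add: complex_eq_iff)
    then show ?thesis using seqlim[OF Sre(1)[OF that(1)]] by metis
  next
    case False
    then show ?thesis using SX[of z] that closure_subset by auto
  qed
  define P where "P = (\<lambda>z. g z - \<i> * p z)"
  have holp: "p holomorphic_on A" for A unfolding p_def by (intro holomorphic_intros) simp_all
  have holP: "P holomorphic_on ?S \<inter> {z. 0 < Im z}"
  proof -
    have "F3 holomorphic_on ?S \<inter> {z. 0 < Im z}"
      by (rule holomorphic_on_subset[OF hol'[OF F3]]) (use SX XQ in auto)
    then have "g holomorphic_on ?S \<inter> {z. 0 < Im z}"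
      by (rule holomorphic_transform) (use SX g(2) in auto)
    then show ?thesis unfolding P_def by (intro holomorphic_intros holp)
  qed
  have contP: "continuous_on (?S \<inter> {z. 0 \<le> Im z}) P"
    unfolding P_def
    by (intro continuous_intros holomorphic_on_imp_continuous_on[OF holp] continuous_on_subset[OF cg])
       (use Scl in auto)
  have realP: "P z \<in> \<real>" if zS: "z \<in> ?S" "z \<in> \<real>" for z
  proof -
    obtain t where t: "z = complex_of_real t" using zS(2) by (auto elim: Reals_cases)
    then show ?thesis using Im_g[of t] Sre[OF zS(1)] by (simp add: P_def complex_is_Real_iff)
  qed
  define R where "R = (\<lambda>z. if 0 \<le> Im z then P z else cnj (P (cnj z)))"
  have cnjS: "cnj z \<in> ?S" if "z \<in> ?S" for z
  proof -
    have "norm (cnj z - complex_of_real x0) = norm (z - complex_of_real x0)"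
      by (metis complex_cnj_complex_of_real complex_cnj_diff complex_mod_cnj)
    then show ?thesis using that by (simp add: dist_norm norm_minus_commute)
  qed
  have holR: "R holomorphic_on ?S"
    unfolding R_def by (rule Schwarz_reflection[OF open_ball _ holP contP realP]) (use cnjS in auto)
  have symR: "R (cnj z) = cnj (R z)" if "z \<in> ?S" for z
  proof (cases "Im z = 0")
    case True
    then have z: "cnj z = z" by (simp add: complex_eq_iff)
    then have "P z \<in> \<real>" using realP[OF that] by (simp add: complex_is_Real_iff True)
    then show ?thesis using True z by (simp add: R_def Reals_cnj_iff)
  qed (auto simp: R_def)
  \<comment> \<open>Three derivatives recover \<open>D\<close> and annihilate the quadratic
    correction; the reflection symmetry survives each of them.\<close>
  have hol1: "deriv R holomorphic_on ?S" by (rule holomorphic_deriv[OF holR open_ball])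
  have hol2: "deriv (deriv R) holomorphic_on ?S" by (rule holomorphic_deriv[OF hol1 open_ball])
  have hol3: "deriv (deriv (deriv R)) holomorphic_on ?S" by (rule holomorphic_deriv[OF hol2 open_ball])
  have sym1: "deriv R (cnj z) = cnj (deriv R z)" if "z \<in> ?S" for z
    by (rule deriv_cnj_symmetric[OF holR open_ball cnjS symR that])
  have sym2: "deriv (deriv R) (cnj z) = cnj (deriv (deriv R) z)" if "z \<in> ?S" for z
    by (rule deriv_cnj_symmetric[OF hol1 open_ball cnjS sym1 that])
  have sym3: "deriv (deriv (deriv R)) (cnj z) = cnj (deriv (deriv (deriv R)) z)" if "z \<in> ?S" for z
    by (rule deriv_cnj_symmetric[OF hol2 open_ball cnjS sym2 that])
  let ?U = "?S \<inter> {z. 0 < Im z}"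
  have oU: "open ?U" by (intro open_Int open_ball open_halfspace_Im_gt)
  have UQ: "z \<in> Q" if "z \<in> ?U" for z using SX that XQ by auto
  have dtrans: "deriv f z = f' z" if "\<And>y. y \<in> ?U \<Longrightarrow> f y = h y" "(h has_field_derivative f' z) (at z)" "z \<in> ?U"
    for f h f' z
    by (rule DERIV_imp_deriv, rule has_field_derivative_transform_within_open[OF that(2) oU that(3)]) (simp add: that(1))
  have e1: "deriv R z = F2 z - \<i> * (complex_of_real \<alpha> + (z - complex_of_real x0) * complex_of_real \<gamma>)" if "z \<in> ?U" for z
  proof (rule dtrans[where h="\<lambda>z. F3 z - \<i> * p z"])
    show "R y = F3 y - \<i> * p y" if "y \<in> ?U" for y using that SX[of y] by (simp add: R_def P_def g(2))
    show "((\<lambda>z. F3 z - \<i> * p z) has_field_derivative F2 z - \<i> * (complex_of_real \<alpha> + (z - complex_of_real x0) * complex_of_real \<gamma>)) (at z)"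
      unfolding p_def using F3 UQ[OF that] by (auto intro!: derivative_eq_intros)
  qed (rule that)
  have e2: "deriv (deriv R) z = F z - \<i> * \<gamma>" if "z \<in> ?U" for z
  proof (rule dtrans[where h="\<lambda>z. F2 z - \<i> * (complex_of_real \<alpha> + (z - complex_of_real x0) * complex_of_real \<gamma>)"])
    show "((\<lambda>z. F2 z - \<i> * (complex_of_real \<alpha> + (z - complex_of_real x0) * complex_of_real \<gamma>)) has_field_derivative F z - \<i> * \<gamma>) (at z)"
      using F2 UQ[OF that] by (auto intro!: derivative_eq_intros)
  qed (use that in \<open>simp_all only: e1\<close>)
  have e3: "deriv (deriv (deriv R)) z = D z" if "z \<in> ?U" for z
  proof (rule dtrans[where h="\<lambda>z. F z - \<i> * \<gamma>"])
    show "((\<lambda>z. F z - \<i> * \<gamma>) has_field_derivative D z) (at z)"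
      using F UQ[OF that] by (auto intro!: derivative_eq_intros)
  qed (use e2 that in auto)
  show ?thesis
    using eta(1) hol3 e3 sym3 by (intro exI[of _ "deriv (deriv (deriv R))"] exI[of _ \<eta>]) blast
qed

section \<open>The Stieltjes transform of the spectral measure\<close>

locale weyl_measure =
  fixes M :: "complex \<Rightarrow> complex" and \<rho> :: "real measure"
  assumes wsm: "weyl_spectral_measure M \<rho>"
begin

lemma sets_rho [measurable_cong]: "sets \<rho> = sets borel"
  using wsm by (simp add: weyl_spectral_measure_def)

lemma space_rho [simp]: "space \<rho> = UNIV"
  using sets_eq_imp_space_eq[OF sets_rho] by simp

lemma finite_rho: "emeasure \<rho> {s..t} < \<infinity>"
  using wsm by (simp add: weyl_spectral_measure_def)

lemma rho_limit:
  "s < t \<Longrightarrow> ((\<lambda>\<epsilon>. 1 / pi * integral {s..t} (\<lambda>l. Im (M (Complex l \<epsilon>))))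
     \<longlongrightarrow> (measure \<rho> {s<..<t} + measure \<rho> {s..t}) / 2) (at_right 0)"
  using wsm by (simp add: weyl_spectral_measure_def)

lemma measurable_rho: "f \<in> borel_measurable borel \<Longrightarrow> f \<in> borel_measurable \<rho>"
  using measurable_cong_sets[OF sets_rho refl] by blast

lemma integrable_indicator_rho: "integrable \<rho> (\<lambda>t. c * indicator {s..t'} t :: real)"
  by (intro integrable_mult_right integrable_real_indicator finite_rho) (simp add: sets_rho)

lemma integrable_indicator_mult_rho:
  assumes f: "f \<in> borel_measurable borel" and B: "\<And>t. t \<in> {s..t'} \<Longrightarrow> norm (f t) \<le> B"
  shows "integrable \<rho> (\<lambda>t. indicator {s..t'} t * f t :: complex)"
proof (rule Bochner_Integration.integrable_bound[OF integrable_indicator_rho[of "\<bar>B\<bar>" s t']])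
  show "(\<lambda>t. indicator {s..t'} t * f t) \<in> borel_measurable \<rho>"
    using f by (intro measurable_rho) measurable
  show "AE t in \<rho>. norm (indicator {s..t'} t * f t) \<le> norm (\<bar>B\<bar> * indicator {s..t'} t)"
  proof (rule AE_I2)
    fix t show "norm (indicator {s..t'} t * f t) \<le> norm (\<bar>B\<bar> * indicator {s..t'} t)"
      using B[of t] by (cases "t \<in> {s..t'}") auto
  qed
qed

text \<open>Only bounded intervals are known to have finite measure, so the transform is truncated;
  for the behaviour near a given real point this is enough.\<close>

definition stieltjes :: "real \<Rightarrow> complex \<Rightarrow> complex" where
  "stieltjes R z = (LINT t|\<rho>. indicator {-R..R} t * (1 / (complex_of_real t - z)))"

lemma norm_diff_Im: "\<bar>Im z\<bar> \<le> norm (complex_of_real t - z)"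
  using abs_Im_le_cmod[of "complex_of_real t - z"] by simp

lemma measurable_resolvent: "(\<lambda>t. 1 / (complex_of_real t - z)) \<in> borel_measurable borel"
  by measurable

lemma resolvent_bound:
  assumes "\<eta> \<le> \<bar>Im z\<bar>" "0 < \<eta>"
  shows "norm (1 / (complex_of_real t - z)) \<le> 1 / \<eta>"
proof -
  have "\<eta> \<le> norm (complex_of_real t - z)" using norm_diff_Im[of z t] assms by linarith
  then show ?thesis using assms(2) by (simp add: norm_divide frac_le)
qed

lemma stieltjes_integrable:
  assumes "Im z \<noteq> 0"
  shows "integrable \<rho> (\<lambda>t. indicator {-R..R} t * (1 / (complex_of_real t - z)))"
  by (rule integrable_indicator_mult_rho[OF measurable_resolvent resolvent_bound[OF order_refl]])
     (use assms in auto)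

lemma stieltjes_bound:
  assumes "Im z \<noteq> 0"
  shows "norm (stieltjes R z) \<le> measure \<rho> {-R..R} / \<bar>Im z\<bar>"
proof -
  have "norm (stieltjes R z) \<le> (LINT t|\<rho>. norm (indicator {-R..R} t * (1 / (complex_of_real t - z))))"
    unfolding stieltjes_def by (rule integral_norm_bound)
  also have "\<dots> \<le> (LINT t|\<rho>. (1 / \<bar>Im z\<bar>) * indicator {-R..R} t)"
  proof (rule integral_mono[OF integrable_norm[OF stieltjes_integrable[OF assms]] integrable_indicator_rho])
    fix t
    show "norm (indicator {-R..R} t * (1 / (complex_of_real t - z))) \<le> (1 / \<bar>Im z\<bar>) * indicator {-R..R} t"
      using resolvent_bound[of "\<bar>Im z\<bar>" z t] assms by (cases "t \<in> {-R..R}") auto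
  qed
  also have "\<dots> = measure \<rho> {-R..R} / \<bar>Im z\<bar>"
    using finite_rho[of "-R" R] by (simp add: sets_rho)
  finally show ?thesis .
qed

lemma stieltjes_cnj: "stieltjes R (cnj z) = cnj (stieltjes R z)"
proof -
  have "cnj (stieltjes R z) = (LINT t|\<rho>. cnj (indicator {-R..R} t * (1 / (complex_of_real t - z))))"
    unfolding stieltjes_def by (rule Bochner_Integration.integral_cnj[symmetric])
  also have "\<dots> = stieltjes R (cnj z)"
    unfolding stieltjes_def by (rule Bochner_Integration.integral_cong) (auto simp: indicator_def)
  finally show ?thesis ..
qed

text \<open>The rotation by \<open>- \<i>\<close> carries the upper half-plane to the right
  half-plane, away from the branch cut of \<open>Ln\<close>. So one logarithm is a primitive for
  every \<open>t\<close> at once, and its imaginary part is an arctangent.\<close>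

lemma stieltjes_primitive:
  assumes z0: "0 < Im z0"
  shows "((\<lambda>z. LINT t|\<rho>. indicator {-R..R} t * (- Ln (- \<i> * (z - complex_of_real t))))
      has_field_derivative stieltjes R z0) (at z0)"
proof -
  define \<eta> where "\<eta> = Im z0 / 2"
  define B where "B = norm z0 + 1"
  \<comment> \<open>Bounded and away from the real axis, which bounds the logarithm uniformly for
    \<open>t\<close> in \<open>{-R..R}\<close>.\<close>
  define U where "U = {z. \<eta> < Im z} \<inter> ball 0 B"
  let ?f = "\<lambda>t z. indicator {-R..R} t * (- Ln (- \<i> * (z - complex_of_real t)))"
  have eta: "0 < \<eta>" using z0 by (simp add: \<eta>_def)
  have "open U" unfolding U_def by (intro open_Int open_halfspace_Im_gt open_ball)
  moreover have "z0 \<in> U" unfolding U_def \<eta>_def B_def using z0 by auto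
  ultimately have U: "open U" "z0 \<in> U" by auto
  have pos: "0 < Re (- \<i> * (z - complex_of_real t))" if "z \<in> U" for z t
    using that eta by (simp add: U_def)
  have der: "((\<lambda>z. - Ln (- \<i> * (z - complex_of_real t))) has_field_derivative 1 / (complex_of_real t - z)) (at z)"
    if "z \<in> U" for z t
  proof -
    have nz: "z - complex_of_real t \<noteq> 0" using pos[OF that, of t] by force
    have nn: "- \<i> * (z - complex_of_real t) \<notin> \<real>\<^sub>\<le>\<^sub>0"
      using pos[OF that, of t] by (auto simp: complex_nonpos_Reals_iff)
    have "((\<lambda>z. - Ln (- \<i> * (z - complex_of_real t))) has_field_derivative
       - (inverse (- \<i> * (z - complex_of_real t)) * (- \<i> * (1 - 0)))) (at z)"
      by (intro DERIV_minus DERIV_chain2[where f=Ln and g="\<lambda>z. - \<i> * (z - complex_of_real t)", OF has_field_derivative_Ln[OF nn]] DERIV_cmult DERIV_diff DERIV_ident DERIV_const)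
    moreover have "- (inverse (- \<i> * (z - complex_of_real t)) * (- \<i> * (1 - 0))) = 1 / (complex_of_real t - z)"
      using nz by (simp add: field_simps)
    ultimately show ?thesis by simp
  qed
  have "((\<lambda>z. LINT t|\<rho>. ?f t z) has_field_derivative (LINT t|\<rho>. deriv (?f t) z0)) (at z0)"
  proof (rule has_field_derivative_integral_param[OF U])
    fix z assume z: "z \<in> U"
    have "isCont (\<lambda>t. - Ln (- \<i> * (z - complex_of_real t))) t" for t
      using pos[OF z, of t] by (intro continuous_intros) (auto simp: complex_nonpos_Reals_iff)
    then have "continuous_on UNIV (\<lambda>t. - Ln (- \<i> * (z - complex_of_real t)))"
      by (simp add: continuous_on_eq_continuous_at)
    then have "(\<lambda>t. - Ln (- \<i> * (z - complex_of_real t))) \<in> borel_measurable borel"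
      by (rule borel_measurable_continuous_onI)
    then show "(\<lambda>t. ?f t z) \<in> borel_measurable \<rho>"
      by (intro measurable_rho borel_measurable_times) auto
  next
    fix t
    have "(\<lambda>z. - Ln (- \<i> * (z - complex_of_real t))) holomorphic_on U"
      using der[of _ t] U(1) by (auto simp: holomorphic_on_open)
    then show "?f t holomorphic_on U" by (rule holomorphic_on_mult[OF holomorphic_on_const])
  next
    show "integrable \<rho> (\<lambda>t. (\<bar>ln \<eta>\<bar> + \<bar>ln (B + \<bar>R\<bar>)\<bar> + pi) * indicator {-R..R} t)"
      by (rule integrable_indicator_rho)
  next
    fix t z assume z: "z \<in> U"
    show "norm (?f t z) \<le> (\<bar>ln \<eta>\<bar> + \<bar>ln (B + \<bar>R\<bar>)\<bar> + pi) * indicator {-R..R} t"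
    proof (cases "t \<in> {-R..R}")
      case True
      let ?w = "- \<i> * (z - complex_of_real t)"
      have nz: "?w \<noteq> 0" using pos[OF z, of t] by force
      have n1: "\<eta> \<le> norm ?w" using norm_diff_Im[of z t] z eta
        by (simp add: U_def norm_mult norm_minus_commute)
      have "norm ?w \<le> norm z + norm (complex_of_real t)"
        using norm_triangle_ineq4[of z "complex_of_real t"] by (simp add: norm_mult)
      also have "\<dots> \<le> B + \<bar>R\<bar>" using z True by (auto simp: U_def)
      finally have n2: "norm ?w \<le> B + \<bar>R\<bar>" .
      have "ln \<eta> \<le> ln (norm ?w)" "ln (norm ?w) \<le> ln (B + \<bar>R\<bar>)"
        using n1 n2 eta nz by (auto simp: ln_le_cancel_iff)
      then have "\<bar>ln (norm ?w)\<bar> \<le> \<bar>ln \<eta>\<bar> + \<bar>ln (B + \<bar>R\<bar>)\<bar>" by linarith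
      moreover have "\<bar>Im (Ln ?w)\<bar> \<le> pi"
        using mpi_less_Im_Ln[OF nz] Im_Ln_le_pi[OF nz] by linarith
      moreover have "Re (Ln ?w) = ln (norm ?w)" by (rule Re_Ln[OF nz])
      ultimately have "norm (Ln ?w) \<le> \<bar>ln \<eta>\<bar> + \<bar>ln (B + \<bar>R\<bar>)\<bar> + pi"
        using cmod_le[of "Ln ?w"] by linarith
      then show ?thesis using True by simp
    qed simp
  qed
  moreover have "deriv (?f t) z0 = indicator {-R..R} t * (1 / (complex_of_real t - z0))" for t
    by (rule DERIV_imp_deriv) (rule DERIV_cmult[OF der[OF U(2)]])
  ultimately show ?thesis unfolding stieltjes_def by simp
qed

lemma holomorphic_stieltjes_upper: "stieltjes R holomorphic_on {z. 0 < Im z}"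
proof -
  let ?P = "\<lambda>z. LINT t|\<rho>. indicator {-R..R} t * (- Ln (- \<i> * (z - complex_of_real t)))"
  have op: "open {z. 0 < Im z}" by (rule open_halfspace_Im_gt)
  have "?P holomorphic_on {z. 0 < Im z}"
    unfolding holomorphic_on_open[OF op] using stieltjes_primitive by blast
  then have "deriv ?P holomorphic_on {z. 0 < Im z}" by (rule holomorphic_deriv[OF _ op])
  then show ?thesis
    by (rule holomorphic_transform) (use DERIV_imp_deriv[OF stieltjes_primitive] in auto)
qed

text \<open>The integral over \<open>{s..t}\<close> of the Poisson kernel at height
  \<open>\<epsilon>\<close>, taken against the truncated measure: the arctangents are
  antiderivatives of that kernel.\<close>

definition arctan_int :: "real \<Rightarrow> real \<Rightarrow> real \<Rightarrow> real \<Rightarrow> real" where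
  "arctan_int R s t \<epsilon> = (LINT \<tau>|\<rho>. indicator {-R..R} \<tau> * (arctan ((t - \<tau>) / \<epsilon>) - arctan ((s - \<tau>) / \<epsilon>)))"

text \<open>The logarithmic primitive evaluates the integral over the horizontal segment, which
  avoids interchanging two integrations.\<close>

lemma has_integral_Im_stieltjes:
  assumes e: "0 < \<epsilon>" and st: "s \<le> t"
  shows "((\<lambda>l. Im (stieltjes R (Complex l \<epsilon>))) has_integral arctan_int R s t \<epsilon>) {s..t}"
proof -
  let ?P = "\<lambda>z. LINT t|\<rho>. indicator {-R..R} t * (- Ln (- \<i> * (z - complex_of_real t)))"
  have vd: "((\<lambda>l. Im (?P (Complex l \<epsilon>))) has_vector_derivative Im (stieltjes R (Complex l \<epsilon>))) (at l)" for l
  proof -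
    have 1: "((\<lambda>l. Complex l \<epsilon>) has_vector_derivative 1) (at l)"
      unfolding Complex_eq by (auto intro!: derivative_eq_intros)
    have 2: "(?P has_field_derivative stieltjes R (Complex l \<epsilon>)) (at (Complex l \<epsilon>))"
      by (rule stieltjes_primitive) (use e in simp)
    from field_vector_diff_chain_at[OF 1 2]
    have "((\<lambda>l. ?P (Complex l \<epsilon>)) has_vector_derivative stieltjes R (Complex l \<epsilon>)) (at l)"
      by (simp add: o_def)
    from bounded_linear.has_vector_derivative[OF bounded_linear_Im this] show ?thesis .
  qed
  have I: "((\<lambda>l. Im (stieltjes R (Complex l \<epsilon>))) has_integral (Im (?P (Complex t \<epsilon>)) - Im (?P (Complex s \<epsilon>)))) {s..t}"
    by (rule fundamental_theorem_of_calculus[OF st]) (rule has_vector_derivative_at_within[OF vd])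
  have int: "integrable \<rho> (\<lambda>\<tau>. indicator {-R..R} \<tau> * (- Ln (- \<i> * (Complex l \<epsilon> - complex_of_real \<tau>))))" for l
  proof -
    let ?q = "\<lambda>\<tau>. - Ln (- \<i> * (Complex l \<epsilon> - complex_of_real \<tau>))"
    have "isCont ?q \<tau>" for \<tau>
      using e by (intro continuous_intros) (auto simp: complex_nonpos_Reals_iff)
    then have c: "continuous_on A ?q" for A by (simp add: continuous_at_imp_continuous_on)
    have "bounded (?q ` {-R..R})"
      by (intro compact_imp_bounded compact_continuous_image c) simp
    then obtain B where B: "\<forall>y\<in>?q ` {-R..R}. norm y \<le> B" by (auto simp: bounded_iff)
    show ?thesis
    proof (rule integrable_indicator_mult_rho)
      from c show "?q \<in> borel_measurable borel" by (rule borel_measurable_continuous_onI)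
      show "norm (?q \<tau>) \<le> B" if "\<tau> \<in> {-R..R}" for \<tau> using B that by blast
    qed
  qed
  have imP: "Im (?P (Complex l \<epsilon>)) = (LINT \<tau>|\<rho>. indicator {-R..R} \<tau> * arctan ((l - \<tau>) / \<epsilon>))" for l
  proof -
    have "Im (?P (Complex l \<epsilon>)) = (LINT \<tau>|\<rho>. Im (indicator {-R..R} \<tau> * (- Ln (- \<i> * (Complex l \<epsilon> - complex_of_real \<tau>)))))"
      by (rule integral_Im[OF int, symmetric])
    also have "\<dots> = (LINT \<tau>|\<rho>. indicator {-R..R} \<tau> * arctan ((l - \<tau>) / \<epsilon>))"
    proof (rule Bochner_Integration.integral_cong[OF refl])
      fix \<tau>
      let ?w = "- \<i> * (Complex l \<epsilon> - complex_of_real \<tau>)"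
      have re: "Re ?w = \<epsilon>" "Im ?w = - (l - \<tau>)" by simp_all
      have nz: "?w \<noteq> 0"
      proof
        assume "?w = 0"
        then have "Re ?w = 0" by (simp only: zero_complex.sel)
        then show False using e re(1) by simp
      qed
      have "Im (Ln ?w) = arctan (Im ?w / Re ?w)" using Im_Ln_eq[OF nz] e unfolding re by simp
      also have "Im ?w / Re ?w = - ((l - \<tau>) / \<epsilon>)" unfolding re by (simp only: minus_divide_left)
      finally have "Im (Ln ?w) = - arctan ((l - \<tau>) / \<epsilon>)" unfolding arctan_minus .
      then show "Im (indicator {-R..R} \<tau> * (- Ln ?w)) = indicator {-R..R} \<tau> * arctan ((l - \<tau>) / \<epsilon>)"
        by (auto simp: indicator_def)
    qed
    finally show ?thesis .
  qed
  have ai: "integrable \<rho> (\<lambda>\<tau>. indicator {-R..R} \<tau> * arctan ((l - \<tau>) / \<epsilon>))" for l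
  proof (rule Bochner_Integration.integrable_bound[OF integrable_indicator_rho[of "pi / 2" "-R" R]])
    show "(\<lambda>\<tau>. indicator {-R..R} \<tau> * arctan ((l - \<tau>) / \<epsilon>)) \<in> borel_measurable \<rho>"
      by (intro measurable_rho) measurable
    show "AE \<tau> in \<rho>. norm (indicator {-R..R} \<tau> * arctan ((l - \<tau>) / \<epsilon>)) \<le> norm (pi / 2 * indicator {-R..R} \<tau> :: real)"
    proof (rule AE_I2)
      fix \<tau>
      have "\<bar>arctan ((l - \<tau>) / \<epsilon>)\<bar> \<le> pi / 2" using arctan_bounded[of "(l - \<tau>) / \<epsilon>"] by linarith
      then show "norm (indicator {-R..R} \<tau> * arctan ((l - \<tau>) / \<epsilon>)) \<le> norm (pi / 2 * indicator {-R..R} \<tau> :: real)"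
        by (auto simp: indicator_def)
    qed
  qed
  have "arctan_int R s t \<epsilon> = (LINT \<tau>|\<rho>. indicator {-R..R} \<tau> * arctan ((t - \<tau>) / \<epsilon>)
      - indicator {-R..R} \<tau> * arctan ((s - \<tau>) / \<epsilon>))"
    unfolding arctan_int_def by (simp only: right_diff_distrib)
  also have "\<dots> = Im (?P (Complex t \<epsilon>)) - Im (?P (Complex s \<epsilon>))"
    unfolding imP by (rule Bochner_Integration.integral_diff[OF ai ai])
  finally show ?thesis using I by (simp only:)
qed

section \<open>Stieltjes inversion for the truncated transform\<close>

lemma arctan_int_bound: "\<bar>arctan_int R s t \<epsilon>\<bar> \<le> pi * measure \<rho> {-R..R}"
proof -
  have "norm (arctan_int R s t \<epsilon>) \<le> (LINT \<tau>|\<rho>. pi * indicator {-R..R} \<tau>)"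
    unfolding arctan_int_def
  proof (rule Bochner_Integration.integral_norm_bound_integral)
    show "integrable \<rho> (\<lambda>\<tau>. pi * indicator {-R..R} \<tau>)" by (rule integrable_indicator_rho)
    have b: "norm (indicator {-R..R} \<tau> * (arctan ((t - \<tau>) / \<epsilon>) - arctan ((s - \<tau>) / \<epsilon>))) \<le> pi * indicator {-R..R} \<tau>" for \<tau>
    proof -
      have "\<bar>arctan ((t - \<tau>) / \<epsilon>) - arctan ((s - \<tau>) / \<epsilon>)\<bar> \<le> pi"
        using arctan_bounded[of "(t - \<tau>) / \<epsilon>"] arctan_bounded[of "(s - \<tau>) / \<epsilon>"] by linarith
      then show ?thesis by (auto simp: indicator_def)
    qed
    then show "norm (indicator {-R..R} \<tau> * (arctan ((t - \<tau>) / \<epsilon>) - arctan ((s - \<tau>) / \<epsilon>))) \<le> pi * indicator {-R..R} \<tau>" for \<tau> .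
    show "integrable \<rho> (\<lambda>\<tau>. indicator {-R..R} \<tau> * (arctan ((t - \<tau>) / \<epsilon>) - arctan ((s - \<tau>) / \<epsilon>)))"
    proof (rule Bochner_Integration.integrable_bound[OF integrable_indicator_rho[of pi "-R" R]])
      show "(\<lambda>\<tau>. indicator {-R..R} \<tau> * (arctan ((t - \<tau>) / \<epsilon>) - arctan ((s - \<tau>) / \<epsilon>))) \<in> borel_measurable \<rho>"
        by (intro measurable_rho) measurable
    qed (use b in \<open>auto intro!: AE_I2 intro: order_trans[OF _ abs_ge_self]\<close>)
  qed
  also have "\<dots> = pi * measure \<rho> {-R..R}" using finite_rho[of "-R" R] by (simp add: sets_rho)
  finally show ?thesis by simp
qed

text \<open>The case \<open>x = 0\<close>, where the limit is 0, is responsible for the half weights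
  of the endpoints in the inversion formula.\<close>

lemma arctan_limit:
  fixes x :: real and eps :: "nat \<Rightarrow> real"
  assumes "\<And>n. 0 < eps n" "eps \<longlonglongrightarrow> 0"
  shows "(\<lambda>n. arctan (x / eps n)) \<longlonglongrightarrow> pi / 2 * sgn x"
proof -
  have pos: "(\<lambda>n. arctan (y / eps n)) \<longlonglongrightarrow> pi / 2" if "0 < y" for y :: real
  proof -
    have "eps n \<noteq> 0" for n using assms(1)[of n] by simp
    then have "filterlim eps (at_right 0) sequentially"
      using assms by (simp add: filterlim_at)
    then have "filterlim (\<lambda>n. inverse (eps n)) at_top sequentially"
      by (rule filterlim_compose[OF filterlim_inverse_at_top_right])
    then have "filterlim (\<lambda>n. y * inverse (eps n)) at_top sequentially"
      by (rule filterlim_tendsto_pos_mult_at_top[OF tendsto_const that])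
    then have "(\<lambda>n. arctan (y * inverse (eps n))) \<longlonglongrightarrow> pi / 2"
      by (rule filterlim_compose[OF tendsto_arctan_at_top])
    then show ?thesis by (simp only: divide_inverse)
  qed
  consider "x = 0" | "0 < x" | "x < 0" by linarith
  then show ?thesis
  proof cases
    case 3
    then have "(\<lambda>n. - arctan ((- x) / eps n)) \<longlonglongrightarrow> - (pi / 2)" by (intro tendsto_minus pos) simp
    then show ?thesis using 3 by (simp add: arctan_minus)
  qed (use pos in auto)
qed

text \<open>The integrand tends to \<open>pi\<close> inside the interval, to \<open>pi / 2\<close>
  at its endpoints and to 0 outside, which is \<open>pi\<close> times the mean of the open and the
  closed indicator. This is exactly the limit that \<open>rho_limit\<close> prescribes for
  \<open>M\<close>, up to the factor \<open>pi\<close>.\<close>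

lemma arctan_int_limit:
  assumes eps: "\<And>n. 0 < eps n" "eps \<longlonglongrightarrow> 0" and st: "- R \<le> s" "s < t" "t \<le> R"
  shows "(\<lambda>n. arctan_int R s t (eps n)) \<longlonglongrightarrow> pi * ((measure \<rho> {s<..<t} + measure \<rho> {s..t}) / 2)"
proof -
  let ?h = "\<lambda>\<tau>. pi / 2 * indicator {s<..<t} \<tau> + pi / 2 * indicator {s..t} \<tau> :: real"
  have "(\<lambda>n. arctan_int R s t (eps n)) \<longlonglongrightarrow> (LINT \<tau>|\<rho>. ?h \<tau>)"
    unfolding arctan_int_def
  proof (rule integral_dominated_convergence[where w="\<lambda>\<tau>. pi * indicator {-R..R} \<tau>"])
    show "integrable \<rho> (\<lambda>\<tau>. pi * indicator {-R..R} \<tau>)" by (rule integrable_indicator_rho)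
    show "?h \<in> borel_measurable \<rho>" by (intro measurable_rho) measurable
    show "(\<lambda>\<tau>. indicator {-R..R} \<tau> * (arctan ((t - \<tau>) / eps n) - arctan ((s - \<tau>) / eps n))) \<in> borel_measurable \<rho>" for n
      by (intro measurable_rho) measurable
    show "AE \<tau> in \<rho>. norm (indicator {-R..R} \<tau> * (arctan ((t - \<tau>) / eps n) - arctan ((s - \<tau>) / eps n))) \<le> pi * indicator {-R..R} \<tau>" for n
    proof (rule AE_I2)
      fix \<tau>
      have "\<bar>arctan ((t - \<tau>) / eps n) - arctan ((s - \<tau>) / eps n)\<bar> \<le> pi"
        using arctan_bounded[of "(t - \<tau>) / eps n"] arctan_bounded[of "(s - \<tau>) / eps n"] by linarith
      then show "norm (indicator {-R..R} \<tau> * (arctan ((t - \<tau>) / eps n) - arctan ((s - \<tau>) / eps n))) \<le> pi * indicator {-R..R} \<tau>"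
        by (auto simp: indicator_def)
    qed
    show "AE \<tau> in \<rho>. (\<lambda>n. indicator {-R..R} \<tau> * (arctan ((t - \<tau>) / eps n) - arctan ((s - \<tau>) / eps n))) \<longlonglongrightarrow> ?h \<tau>"
    proof (rule AE_I2)
      fix \<tau>
      have "(\<lambda>n. indicator {-R..R} \<tau> * (arctan ((t - \<tau>) / eps n) - arctan ((s - \<tau>) / eps n)))
         \<longlonglongrightarrow> indicator {-R..R} \<tau> * (pi / 2 * sgn (t - \<tau>) - pi / 2 * sgn (s - \<tau>))"
        by (intro tendsto_mult tendsto_const tendsto_diff arctan_limit eps)
      also have "indicator {-R..R} \<tau> * (pi / 2 * sgn (t - \<tau>) - pi / 2 * sgn (s - \<tau>)) = ?h \<tau>"
        using st by (auto simp: indicator_def sgn_if)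
      finally show "(\<lambda>n. indicator {-R..R} \<tau> * (arctan ((t - \<tau>) / eps n) - arctan ((s - \<tau>) / eps n))) \<longlonglongrightarrow> ?h \<tau>" .
    qed
  qed
  also have "(LINT \<tau>|\<rho>. ?h \<tau>) = pi / 2 * measure \<rho> {s<..<t} + pi / 2 * measure \<rho> {s..t}"
  proof -
    have "emeasure \<rho> {s<..<t} \<le> emeasure \<rho> {s..t}" by (rule emeasure_mono) (auto simp: sets_rho)
    then have "emeasure \<rho> {s<..<t} < \<infinity>" using finite_rho[of s t] by (rule le_less_trans)
    then have i: "integrable \<rho> (\<lambda>\<tau>. pi / 2 * indicator {s<..<t} \<tau> :: real)"
      by (intro integrable_mult_right integrable_real_indicator) (auto simp: sets_rho)
    show ?thesis
      by (subst Bochner_Integration.integral_add[OF i integrable_indicator_rho]) (simp add: sets_rho)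
  qed
  also have "\<dots> = pi * ((measure \<rho> {s<..<t} + measure \<rho> {s..t}) / 2)" by (simp add: field_simps)
  finally show ?thesis .
qed

text \<open>The limits for \<open>M\<close> and for the transform of \<open>\<rho>\<close> cancel.
  The uniform bound on all subintervals needs the one-sided bound on \<open>Im M\<close>: it lets
  the convergent integral over the whole interval control every part of it.\<close>

lemma local_extension:
  fixes x0 :: real
  assumes hol: "M holomorphic_on {z. 0 < Im z}" and sym: "\<And>z. Im z \<noteq> 0 \<Longrightarrow> M (cnj z) = cnj (M z)"
    and d: "0 < d" and C: "0 \<le> C"
    and bnd: "\<And>z. dist z (complex_of_real x0) < d \<Longrightarrow> 0 < Im z \<Longrightarrow> norm (M z) \<le> C / Im z \<and> - C \<le> Im (M z)"
    and R: "\<bar>x0\<bar> < R"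
  shows "\<exists>e r. 0 < r \<and> e holomorphic_on ball (complex_of_real x0) r \<and>
    (\<forall>z\<in>ball (complex_of_real x0) r. Im z \<noteq> 0 \<longrightarrow> e z = M z - stieltjes R z)"
proof -
  \<comment> \<open>The box of half-width and height \<open>\<delta>\<close> lies in the disc of
    radius \<open>d\<close>, and its real part in \<open>{-R..R}\<close>.\<close>
  define \<delta> where "\<delta> = min (d / 2) ((R - \<bar>x0\<bar>) / 2)"
  have de: "0 < \<delta>" "2 * \<delta> \<le> d" "\<bar>x0\<bar> + \<delta> < R" using d R by (auto simp: \<delta>_def min_def field_simps)
  let ?m = "measure \<rho> {-R..R}"
  let ?D = "\<lambda>z. M z - stieltjes R z"
  \<comment> \<open>The double successor makes already the first term strictly smaller than
    \<open>\<delta>\<close>.\<close>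
  define eps where "eps = (\<lambda>n::nat. \<delta> * inverse (real (Suc (Suc n))))"
  have eps: "0 < eps n" "eps n < \<delta>" for n
  proof -
    have "inverse (real (Suc (Suc n))) < 1" by (rule inverse_less_1_iff[THEN iffD2]) simp
    from mult_strict_left_mono[OF this de(1)] show "eps n < \<delta>" unfolding eps_def by simp
    show "0 < eps n" using de(1) by (simp add: eps_def)
  qed
  have epslim: "eps \<longlonglongrightarrow> 0"
    unfolding eps_def by (rule tendsto_mult_right_zero[OF LIMSEQ_Suc[OF LIMSEQ_inverse_real_of_nat]])
  have "eps n \<noteq> 0" for n using eps(1)[of n] by simp
  then have epsr: "filterlim eps (at_right 0) sequentially"
    using eps epslim by (simp add: filterlim_at)
  have near: "dist (Complex l y) (complex_of_real x0) < d" if "\<bar>l - x0\<bar> \<le> \<delta>" "0 < y" "y < \<delta>" for l y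
  proof -
    have "norm (Complex l y - complex_of_real x0) \<le> \<bar>l - x0\<bar> + \<bar>y\<bar>"
      using cmod_le[of "Complex l y - complex_of_real x0"] by simp
    then show ?thesis using that de by (simp add: dist_norm)
  qed
  have contM: "continuous_on A (\<lambda>l. Im (M (Complex l (eps n))))" for A n
  proof -
    have "continuous_on A (\<lambda>l. M (Complex l (eps n)))"
      by (rule continuous_on_compose2[OF holomorphic_on_imp_continuous_on[OF hol]])
         (use eps in \<open>auto simp: Complex_eq intro!: continuous_intros\<close>)
    then show ?thesis by (rule continuous_on_Im)
  qed
  have intM: "(\<lambda>l. Im (M (Complex l (eps n)))) integrable_on {s..t}" for n s t
    by (rule integrable_continuous_real[OF contM])
  have intD: "integral {s..t} (\<lambda>l. Im (?D (Complex l (eps n))))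
      = integral {s..t} (\<lambda>l. Im (M (Complex l (eps n)))) - arctan_int R s t (eps n)" if "s \<le> t" for s t n
    using has_integral_diff[OF integrable_integral[OF intM[of n s t]] has_integral_Im_stieltjes[OF eps(1)[of n] that, of R]]
    by (simp add: integral_unique)
  have limM: "(\<lambda>n. integral {s..t} (\<lambda>l. Im (M (Complex l (eps n))))) \<longlonglongrightarrow>
      pi * ((measure \<rho> {s<..<t} + measure \<rho> {s..t}) / 2)" if "s < t" for s t
  proof -
    have "(\<lambda>n. pi * (1 / pi * integral {s..t} (\<lambda>l. Im (M (Complex l (eps n)))))) \<longlonglongrightarrow>
      pi * ((measure \<rho> {s<..<t} + measure \<rho> {s..t}) / 2)"
      by (intro tendsto_mult tendsto_const filterlim_compose[OF rho_limit[OF that] epsr])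
    then show ?thesis by simp
  qed
  let ?s0 = "x0 - \<delta>" and ?t0 = "x0 + \<delta>"
  obtain B0 where B0: "\<And>n. \<bar>integral {?s0..?t0} (\<lambda>l. Im (M (Complex l (eps n))))\<bar> \<le> B0"
  proof -
    have "Bseq (\<lambda>n. integral {?s0..?t0} (\<lambda>l. Im (M (Complex l (eps n)))))"
      by (rule convergent_imp_Bseq, rule convergentI, rule limM) (use de in simp)
    then show ?thesis using that by (auto simp: Bseq_def)
  qed
  \<comment> \<open>From \<open>Im M \<ge> - C\<close> it follows that \<open>Im M + 2 * C\<close>
    is nonnegative and dominates the absolute value of \<open>Im M\<close>, so its integral is
    monotone in the interval.\<close>
  have Mabs: "\<bar>Im (M (Complex l (eps n)))\<bar> \<le> Im (M (Complex l (eps n))) + 2 * C \<and>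
      0 \<le> Im (M (Complex l (eps n))) + 2 * C" if "l \<in> {?s0..?t0}" for l n
  proof -
    have "\<bar>l - x0\<bar> \<le> \<delta>" using that by auto
    from bnd[OF near[OF this eps]] eps(1)[of n] have "- C \<le> Im (M (Complex l (eps n)))" by simp
    then show ?thesis using C by linarith
  qed
  have boundD: "\<bar>integral {s..t} (\<lambda>l. Im (?D (Complex l (eps n))))\<bar> \<le> B0 + 4 * C * \<delta> + pi * ?m"
    if st: "x0 - \<delta> < s" "s \<le> t" "t < x0 + \<delta>" for s t n
  proof -
    let ?g = "\<lambda>l. Im (M (Complex l (eps n))) + 2 * C"
    have gi: "?g integrable_on {p..q}" for p q
      by (intro integrable_add intM integrable_const_ivl)
    have sub: "{s..t} \<subseteq> {?s0..?t0}" using st by auto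
    have "norm (integral {s..t} (\<lambda>l. Im (M (Complex l (eps n))))) \<le> integral {s..t} ?g"
      by (rule Henstock_Kurzweil_Integration.integral_norm_bound_integral[OF intM gi]) (use Mabs sub in auto)
    also have "\<dots> \<le> integral {?s0..?t0} ?g"
      by (rule integral_subset_le[OF sub gi gi]) (use Mabs in auto)
    also have "\<dots> = integral {?s0..?t0} (\<lambda>l. Im (M (Complex l (eps n)))) + 4 * C * \<delta>"
      by (subst Henstock_Kurzweil_Integration.integral_add[OF intM integrable_const_ivl]) (use de in simp)
    also have "\<dots> \<le> B0 + 4 * C * \<delta>" using B0[of n] by linarith
    finally show ?thesis
      unfolding intD[OF st(2)] using arctan_int_bound[of R s t "eps n"] by simp
  qed
  have limD: "(\<lambda>n. integral {s..t} (\<lambda>l. Im (?D (Complex l (eps n))))) \<longlonglongrightarrow> 0"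
    if st: "x0 - \<delta> < s" "s \<le> t" "t < x0 + \<delta>" for s t
  proof (cases "s = t")
    case False
    then have lt: "s < t" using st by simp
    have "(\<lambda>n. integral {s..t} (\<lambda>l. Im (M (Complex l (eps n)))) - arctan_int R s t (eps n)) \<longlonglongrightarrow>
       pi * ((measure \<rho> {s<..<t} + measure \<rho> {s..t}) / 2) - pi * ((measure \<rho> {s<..<t} + measure \<rho> {s..t}) / 2)"
      by (rule tendsto_diff[OF limM[OF lt] arctan_int_limit[OF eps(1) epslim _ lt]]) (use st de in auto)
    then show ?thesis unfolding intD[OF st(2)] by simp
  qed simp
  let ?Q = "{z. \<bar>Re z - x0\<bar> < \<delta> \<and> 0 < Im z \<and> Im z < \<delta>}"
  have holD: "?D holomorphic_on ?Q"
    by (intro holomorphic_on_diff holomorphic_on_subset[OF hol] holomorphic_on_subset[OF holomorphic_stieltjes_upper]) auto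
  have bndD: "norm (?D z) \<le> (C + ?m) / Im z" if "z \<in> ?Q" for z
  proof -
    have "dist (Complex (Re z) (Im z)) (complex_of_real x0) < d" using near[of "Re z" "Im z"] that by auto
    then have "norm (M z) \<le> C / Im z" using bnd[of z] that by auto
    moreover have "norm (stieltjes R z) \<le> ?m / Im z" using stieltjes_bound[of z R] that by auto
    ultimately show ?thesis using norm_triangle_ineq4[of "M z" "stieltjes R z"] by (simp add: add_divide_distrib)
  qed
  obtain e r where e: "0 < r" "e holomorphic_on ball (complex_of_real x0) r"
    "\<And>z. z \<in> ball (complex_of_real x0) r \<Longrightarrow> 0 < Im z \<Longrightarrow> e z = ?D z"
    "\<And>z. z \<in> ball (complex_of_real x0) r \<Longrightarrow> e (cnj z) = cnj (e z)"
    using reflection_extension[OF de(1) holD bndD eps epslim boundD limD] by blast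
  show ?thesis
  proof (intro exI[of _ e] exI[of _ r] conjI ballI impI e(1,2))
    fix z assume z: "z \<in> ball (complex_of_real x0) r" "Im z \<noteq> 0"
    show "e z = ?D z"
    proof (cases "0 < Im z")
      case False
      have "norm (complex_of_real x0 - cnj z) = norm (complex_of_real x0 - z)"
        by (metis complex_cnj_complex_of_real complex_cnj_diff complex_mod_cnj)
      then have "cnj z \<in> ball (complex_of_real x0) r" using z(1) by (simp add: dist_norm)
      with e(3)[of "cnj z"] e(4)[of "cnj z"] False z show ?thesis
        by (simp add: stieltjes_cnj sym)
    qed (use e(3) z in auto)
  qed
qed

end

section \<open>Weighted spectral measures\<close>

lemma isCont_eq_off_real_axis:
  fixes f h :: "complex \<Rightarrow> complex"
  assumes f: "isCont f z" and h: "isCont h z" and r: "0 < r"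
    and eq: "\<And>w. w \<in> ball z r \<Longrightarrow> Im w \<noteq> 0 \<Longrightarrow> f w = h w" and z: "Im z = 0"
  shows "f z = h z"
proof -
  define s where "s = (\<lambda>n. z + Complex 0 (inverse (real (Suc n))))"
  have "s \<longlonglongrightarrow> z + Complex 0 0"
    unfolding s_def by (intro tendsto_add tendsto_Complex tendsto_const LIMSEQ_inverse_real_of_nat)
  then have s: "s \<longlonglongrightarrow> z" by (simp add: Complex_eq)
  have "eventually (\<lambda>n. dist (s n) z < r) sequentially" using s r by (rule tendstoD)
  then have "eventually (\<lambda>n. f (s n) = h (s n)) sequentially"
  proof eventually_elim
    case (elim n)
    have "Im (s n) = inverse (real (Suc n))" using z by (simp add: s_def)
    then have "Im (s n) \<noteq> 0" by simp
    with elim show ?case by (intro eq) (simp add: dist_commute)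
  qed
  with isCont_tendsto_compose[OF f s] have "(\<lambda>n. h (s n)) \<longlonglongrightarrow> f z"
    by (rule Lim_transform_eventually)
  then show ?thesis using isCont_tendsto_compose[OF h s] by (rule LIMSEQ_unique)
qed

text \<open>At a real point any two local extensions agree, since both are limits of
  \<open>E0\<close> along the vertical line; no connectedness of overlaps is involved.\<close>

lemma entire_glue:
  assumes hol: "E0 holomorphic_on {z. Im z \<noteq> 0}"
    and loc: "\<And>x::real. \<exists>e r. 0 < r \<and> e holomorphic_on ball (complex_of_real x) r \<and>
      (\<forall>z\<in>ball (complex_of_real x) r. Im z \<noteq> 0 \<longrightarrow> e z = E0 z)"
  shows "\<exists>E. E holomorphic_on UNIV \<and> (\<forall>z. Im z \<noteq> 0 \<longrightarrow> E z = E0 z)"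
proof -
  obtain ex rx where e: "\<And>x. 0 < rx x" "\<And>x::real. ex x holomorphic_on ball (complex_of_real x) (rx x)"
    "\<And>x z. z \<in> ball (complex_of_real x) (rx x) \<Longrightarrow> Im z \<noteq> 0 \<Longrightarrow> ex x z = E0 z"
    using loc by metis
  \<comment> \<open>Each real point uses the extension centred at itself; \<open>Eex\<close> shows
    that this choice is immaterial.\<close>
  define E where "E = (\<lambda>z. if Im z \<noteq> 0 then E0 z else ex (Re z) z)"
  have Eex: "ex x z = E z" if z: "z \<in> ball (complex_of_real x) (rx x)" for x z
  proof (cases "Im z = 0")
    case True
    let ?y = "Re z"
    have zy: "z = complex_of_real ?y" using True by (simp add: complex_eq_iff)
    have zin: "z \<in> ball (complex_of_real ?y) (rx ?y)" using e(1)[of ?y] zy[symmetric] by simp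
    obtain r1 where r1: "0 < r1" "ball z r1 \<subseteq> ball (complex_of_real x) (rx x)"
      using z open_ball by (meson open_contains_ball)
    obtain r2 where r2: "0 < r2" "ball z r2 \<subseteq> ball (complex_of_real ?y) (rx ?y)"
      using zin open_ball by (meson open_contains_ball)
    have c: "isCont (ex x) z" "isCont (ex ?y) z"
      using holomorphic_on_imp_continuous_on[OF e(2)] z zin
      by (auto simp: continuous_on_eq_continuous_at)
    have "ex x z = ex ?y z"
    proof (rule isCont_eq_off_real_axis[OF c, of "min r1 r2"])
      fix w assume w: "w \<in> ball z (min r1 r2)" "Im w \<noteq> 0"
      have "w \<in> ball (complex_of_real x) (rx x)" "w \<in> ball (complex_of_real ?y) (rx ?y)"
        using r1(2) r2(2) w(1) by auto
      then show "ex x w = ex ?y w" using e(3) w(2) by metis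
    qed (use r1 r2 True in auto)
    then show ?thesis using True by (simp add: E_def)
  qed (use e(3) z in \<open>auto simp: E_def\<close>)
  have op: "open {z. Im z \<noteq> 0}"
    by (rule open_Collect_neq[OF continuous_on_Im[OF continuous_on_id] continuous_on_const])
  have "\<exists>D. (E has_field_derivative D) (at z)" for z
  proof (cases "Im z = 0")
    case False
    obtain D where "(E0 has_field_derivative D) (at z)"
      using hol False unfolding holomorphic_on_open[OF op] by blast
    then have "(E has_field_derivative D) (at z)"
      by (rule has_field_derivative_transform_within_open[OF _ op]) (use False in \<open>auto simp: E_def\<close>)
    then show ?thesis by blast
  next
    case True
    let ?y = "Re z"
    have zy: "z = complex_of_real ?y" using True by (simp add: complex_eq_iff)
    have zin: "z \<in> ball (complex_of_real ?y) (rx ?y)" using e(1)[of ?y] zy[symmetric] by simp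
    obtain D where "(ex ?y has_field_derivative D) (at z)"
      using e(2)[of ?y] zin unfolding holomorphic_on_open[OF open_ball] by blast
    then have "(E has_field_derivative D) (at z)"
      by (rule has_field_derivative_transform_within_open[OF _ open_ball zin]) (rule Eex)
    then show ?thesis by blast
  qed
  then have "E holomorphic_on UNIV" by (simp add: holomorphic_on_open)
  moreover have "\<forall>z. Im z \<noteq> 0 \<longrightarrow> E z = E0 z" by (simp add: E_def)
  ultimately show ?thesis by blast
qed

section \<open>The regularised kernel and its integral\<close>

locale weighted_weyl_measure = weyl_measure +
  fixes G :: "complex \<Rightarrow> complex"
  assumes adm: "admissible_weight \<rho> G"
begin

definition g :: "real \<Rightarrow> real" where "g t = Re (G (complex_of_real t))"

lemma G_of_real: "G (complex_of_real t) = complex_of_real (g t)"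
  using adm by (simp add: admissible_weight_def g_def complex_is_Real_iff complex_eq_iff)

lemma g_pos: "0 < g t"
  using adm by (simp add: admissible_weight_def g_def)

lemma holomorphic_G: "G holomorphic_on S"
  using adm holomorphic_on_subset[of G UNIV S] by (simp add: admissible_weight_def)

lemma G_cnj: "G (cnj z) = cnj (G z)"
  by (rule real_entire_cnj) (simp add: real_entire_def holomorphic_G G_of_real)

definition w0 :: "real \<Rightarrow> real" where "w0 t = 1 / ((1 + t\<^sup>2) * g t)"

lemma w0_nonneg: "0 \<le> w0 t"
  using g_pos[of t] by (simp add: w0_def)

lemma inverse_G_eq: "1 / ((1 + (complex_of_real t)\<^sup>2) * G (complex_of_real t)) = complex_of_real (w0 t)"
  by (simp add: w0_def G_of_real)

lemma integrable_w0: "integrable \<rho> w0"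
proof -
  have "integrable \<rho> (\<lambda>t. complex_of_real (w0 t))"
    using adm by (simp add: admissible_weight_def inverse_G_eq)
  from integrable_norm[OF this] show ?thesis using w0_nonneg by simp
qed

definition kern :: "complex \<Rightarrow> real \<Rightarrow> complex" where
  "kern z t = (1 / (complex_of_real t - z) - complex_of_real t / (1 + (complex_of_real t)\<^sup>2)) / G (complex_of_real t)"

lemma one_plus_square_ne: "1 + (complex_of_real t)\<^sup>2 \<noteq> 0"
proof -
  have "0 < 1 + t\<^sup>2" by (simp add: add_pos_nonneg)
  then have "1 + t\<^sup>2 \<noteq> 0" by simp
  then have "complex_of_real (1 + t\<^sup>2) \<noteq> 0" by (simp only: of_real_eq_0_iff not_False_eq_True)
  then show ?thesis by simp
qed

text \<open>Isolates the integrable weight \<open>w0\<close>: the remaining factor is bounded in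
  \<open>t\<close> as long as \<open>t\<close> keeps a positive distance from
  \<open>z\<close>.\<close>

lemma kern_eq:
  assumes "complex_of_real t \<noteq> z"
  shows "kern z t = (z + (1 + z\<^sup>2) / (complex_of_real t - z)) * complex_of_real (w0 t)"
proof -
  let ?t = "complex_of_real t"
  have nz: "?t - z \<noteq> 0" "1 + ?t\<^sup>2 \<noteq> 0" using assms one_plus_square_ne by auto
  have "1 / (?t - z) - ?t / (1 + ?t\<^sup>2) = ((1 + ?t\<^sup>2) - ?t * (?t - z)) / ((?t - z) * (1 + ?t\<^sup>2))"
    using nz by (simp add: diff_frac_eq mult.commute)
  also have "(1 + ?t\<^sup>2) - ?t * (?t - z) = 1 + ?t * z" by (simp add: power2_eq_square algebra_simps)
  finally have 1: "1 / (?t - z) - ?t / (1 + ?t\<^sup>2) = (1 + ?t * z) / ((?t - z) * (1 + ?t\<^sup>2))" .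
  have "z + (1 + z\<^sup>2) / (?t - z) = (z * (?t - z) + (1 + z\<^sup>2)) / (?t - z)"
    using nz(1) by (simp add: add_divide_distrib)
  also have "z * (?t - z) + (1 + z\<^sup>2) = 1 + ?t * z" by (simp add: power2_eq_square algebra_simps)
  finally have 2: "z + (1 + z\<^sup>2) / (?t - z) = (1 + ?t * z) / (?t - z)" .
  show ?thesis unfolding kern_def 1 2 inverse_G_eq[symmetric] by simp
qed

lemma kern_bound:
  assumes k: "0 < \<kappa>" "\<kappa> \<le> norm (complex_of_real t - z)" and B: "norm z \<le> B"
  shows "norm (kern z t) \<le> (B + (1 + B\<^sup>2) / \<kappa>) * w0 t"
proof -
  have ne: "complex_of_real t \<noteq> z" using k by auto
  have "norm (1 + z\<^sup>2) \<le> 1 + B\<^sup>2"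
  proof -
    have "norm (1 + z\<^sup>2) \<le> norm (1::complex) + norm (z\<^sup>2)" by (rule norm_triangle_ineq)
    also have "\<dots> \<le> 1 + B\<^sup>2" using power_mono[OF B norm_ge_zero, of 2] by (simp add: norm_power)
    finally show ?thesis .
  qed
  then have "norm ((1 + z\<^sup>2) / (complex_of_real t - z)) \<le> (1 + B\<^sup>2) / \<kappa>"
    unfolding norm_divide using k by (intro frac_le) auto
  then have "norm (z + (1 + z\<^sup>2) / (complex_of_real t - z)) \<le> B + (1 + B\<^sup>2) / \<kappa>"
    using B norm_triangle_ineq[of z "(1 + z\<^sup>2) / (complex_of_real t - z)"] by linarith
  then have "norm (z + (1 + z\<^sup>2) / (complex_of_real t - z)) * w0 t \<le> (B + (1 + B\<^sup>2) / \<kappa>) * w0 t"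
    using w0_nonneg by (rule mult_right_mono)
  then show ?thesis unfolding kern_eq[OF ne] norm_mult using w0_nonneg[of t] by simp
qed

lemma measurable_G: "(\<lambda>t. G (complex_of_real t)) \<in> borel_measurable borel"
proof (rule borel_measurable_continuous_onI)
  show "continuous_on UNIV (\<lambda>t. G (complex_of_real t))"
    by (rule continuous_on_compose2[OF holomorphic_on_imp_continuous_on[OF holomorphic_G[of UNIV]]])
       (auto intro: continuous_intros)
qed

lemma measurable_kern: "(\<lambda>t. kern z t) \<in> borel_measurable borel"
  unfolding kern_def using measurable_G by measurable

lemma measurable_indicator_mult:
  fixes f :: "real \<Rightarrow> complex"
  assumes "A \<in> sets borel" "f \<in> borel_measurable borel"
  shows "(\<lambda>t. indicator A t * f t) \<in> borel_measurable \<rho>"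
  by (rule measurable_rho) (use assms in measurable)

text \<open>Formulated for a set \<open>A\<close> at positive distance from \<open>U\<close>, so
  that it serves both the whole line for nonreal \<open>z\<close> and the complement of an interval
  around a real point.\<close>

lemma kern_param:
  assumes A: "A \<in> sets borel" and U: "open U" and UB': "\<forall>z\<in>U. norm z \<le> B"
    and k': "0 < \<kappa>" "\<forall>t\<in>A. \<forall>z\<in>U. \<kappa> \<le> norm (complex_of_real t - z)"
  shows "(\<lambda>z. LINT t|\<rho>. indicator A t * kern z t) holomorphic_on U"
    and "\<And>z. z \<in> U \<Longrightarrow> integrable \<rho> (\<lambda>t. indicator A t * kern z t)"
proof -
  note UB = bspec[OF UB'] and k = k'(1) bspec[OF bspec[OF k'(2)]]
  let ?w = "\<lambda>t. (B + (1 + B\<^sup>2) / \<kappa>) * w0 t"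
  have w: "integrable \<rho> ?w" by (intro integrable_mult_right integrable_w0)
  have bnd: "norm (indicator A t * kern z t) \<le> ?w t" if "z \<in> U" for t z
  proof (cases "t \<in> A")
    case True
    then show ?thesis using kern_bound[OF k(1) k(2)[OF True that] UB[OF that]] by simp
  next
    case False
    have "0 \<le> B" using UB[OF that] norm_ge_zero order_trans by blast
    then have "0 \<le> ?w t" using w0_nonneg k(1) by simp
    then show ?thesis using False by simp
  qed
  have m: "(\<lambda>t. indicator A t * kern z t) \<in> borel_measurable \<rho>" for z
    by (rule measurable_indicator_mult[OF A measurable_kern])
  show "(\<lambda>z. LINT t|\<rho>. indicator A t * kern z t) holomorphic_on U"
  proof (rule holomorphic_integral_param[OF U m _ w bnd])
    fix t show "(\<lambda>z. indicator A t * kern z t) holomorphic_on U"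
    proof (cases "t \<in> A")
      case True
      have "complex_of_real t - z \<noteq> 0" if "z \<in> U" for z using k(1) k(2)[OF True that] by auto
      moreover have "G (complex_of_real t) \<noteq> 0" using g_pos[of t] by (simp add: G_of_real)
      ultimately show ?thesis using True one_plus_square_ne[of t] unfolding kern_def
        by (intro holomorphic_intros) auto
    qed simp
  qed
  show "integrable \<rho> (\<lambda>t. indicator A t * kern z t)" if "z \<in> U" for z
    by (rule Bochner_Integration.integrable_bound[OF w m])
       (use bnd[OF that] in \<open>auto intro!: AE_I2 intro: order_trans[OF _ abs_ge_self]\<close>)
qed

definition K :: "complex \<Rightarrow> complex" where "K z = (LINT t|\<rho>. kern z t)"

lemma kern_nonreal:
  assumes z: "Im z \<noteq> 0"
  shows "integrable \<rho> (kern z)" and "K field_differentiable (at z)"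
proof -
  define U where "U = ball z (\<bar>Im z\<bar> / 2)"
  have zU: "z \<in> U" using z by (simp add: U_def)
  have im: "\<bar>Im z\<bar> / 2 \<le> \<bar>Im y\<bar>" if "y \<in> U" for y
    using that abs_Im_le_cmod[of "z - y"] by (auto simp: U_def dist_norm)
  have k: "\<bar>Im z\<bar> / 2 \<le> norm (complex_of_real t - y)" if "y \<in> U" for t y
    using norm_diff_Im[of y t] im[OF that] by linarith
  have B: "norm y \<le> norm z + \<bar>Im z\<bar>" if "y \<in> U" for y
    using that norm_triangle_sub[of y z] by (auto simp: U_def dist_norm norm_minus_commute)
  have oU: "open U" by (simp add: U_def)
  have pos: "0 < \<bar>Im z\<bar> / 2" using z by simp
  have "(UNIV :: real set) \<in> sets borel" by simp
  from kern_param[OF this oU ballI[OF B] pos ballI[OF ballI[OF k]]]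
  have kp: "(\<lambda>z. LINT t|\<rho>. indicator UNIV t * kern z t) holomorphic_on U"
    "\<And>z. z \<in> U \<Longrightarrow> integrable \<rho> (\<lambda>t. indicator UNIV t * kern z t)" by (blast, blast)
  show "integrable \<rho> (kern z)" using kp(2)[OF zU] by simp
  have "K = (\<lambda>z. LINT t|\<rho>. indicator UNIV t * kern z t)" by (rule ext) (simp add: K_def)
  with kp(1) have "K holomorphic_on U" by simp
  then show "K field_differentiable (at z)" using oU zU by (rule holomorphic_on_imp_differentiable_at)
qed

lemma K_cnj: "K (cnj z) = cnj (K z)"
proof -
  have "cnj (K z) = (LINT t|\<rho>. cnj (kern z t))" unfolding K_def by (rule Bochner_Integration.integral_cnj[symmetric])
  also have "\<dots> = K (cnj z)" unfolding K_def
    by (rule Bochner_Integration.integral_cong[OF refl]) (simp add: kern_def G_of_real)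
  finally show ?thesis ..
qed

section \<open>Comparison with the unweighted transform\<close>

definition quot :: "real \<Rightarrow> complex \<Rightarrow> complex" where
  "quot t z = (if z = complex_of_real t then deriv G (complex_of_real t)
     else (G z - G (complex_of_real t)) / (z - complex_of_real t))"

lemma holomorphic_quot: "quot t holomorphic_on U"
proof -
  have "quot t holomorphic_on UNIV"
    unfolding quot_def[abs_def] by (rule pole_lemma[OF holomorphic_G]) simp
  then show ?thesis by (rule holomorphic_on_subset) simp
qed

text \<open>The divided difference is symmetric in its two points, so continuity in \<open>t\<close>
  follows from the removable singularity with the roles exchanged.\<close>

lemma measurable_quot: "(\<lambda>t. quot t z) \<in> borel_measurable borel"
proof -
  let ?h = "\<lambda>w. if w = z then deriv G z else (G w - G z) / (w - z)"
  have "?h holomorphic_on UNIV" by (rule pole_lemma[OF holomorphic_G]) simp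
  then have "continuous_on UNIV (\<lambda>t. ?h (complex_of_real t))"
    by (intro continuous_on_compose2[OF holomorphic_on_imp_continuous_on, of ?h UNIV UNIV complex_of_real])
       (auto intro: continuous_intros)
  then have "(\<lambda>t. ?h (complex_of_real t)) \<in> borel_measurable borel" by (rule borel_measurable_continuous_onI)
  also have "(\<lambda>t. ?h (complex_of_real t)) = (\<lambda>t. quot t z)"
  proof
    fix t
    have "(G (complex_of_real t) - G z) / (complex_of_real t - z) = (G z - G (complex_of_real t)) / (z - complex_of_real t)"
      by (metis minus_diff_eq minus_divide_divide)
    then show "?h (complex_of_real t) = quot t z" by (auto simp: quot_def)
  qed
  finally show ?thesis .
qed

text \<open>Near \<open>[-R,R]\<close> the function \<open>G K\<close> differs from the unweighted Stieltjes transform only by an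
  analytic function, since \<open>(G z - G t)/(z - t)\<close> has no pole.\<close>

lemma stieltjes_minus_K:
  fixes x0 :: real
  defines "R \<equiv> \<bar>x0\<bar> + 2"
  shows "\<exists>h. h holomorphic_on ball (complex_of_real x0) 1 \<and>
    (\<forall>z\<in>ball (complex_of_real x0) 1. Im z \<noteq> 0 \<longrightarrow> stieltjes R z - G z * K z = h z)"
proof -
  let ?I = "{-R..R}" and ?U = "ball (complex_of_real x0) 1"
  have Un: "norm z \<le> \<bar>x0\<bar> + 1" if "z \<in> ?U" for z
    using that norm_triangle_sub[of z "complex_of_real x0"] by (auto simp: dist_norm norm_minus_commute)
  define T3 where "T3 = (\<lambda>z. LINT t|\<rho>. indicator (- ?I) t * kern z t)"
  \<comment> \<open>The radius \<open>R\<close> exceeds \<open>\<bar>x0\<bar>\<close> by 2: one unit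
    is taken by the ball and one remains as distance to the complement of
    \<open>{-R..R}\<close>.\<close>
  have far: "1 \<le> norm (complex_of_real t - z)" if t: "t \<in> - ?I" and z: "z \<in> ?U" for t z
  proof -
    have "R \<le> \<bar>t\<bar>" using t by auto
    then show ?thesis using norm_triangle_ineq2[of "complex_of_real t" z] Un[OF z] by (simp add: R_def)
  qed
  have "- ?I \<in> sets borel" by measurable
  from kern_param[OF this open_ball ballI[OF Un] zero_less_one ballI[OF ballI[OF far]]]
  have T3p: "(\<lambda>z. LINT t|\<rho>. indicator (- ?I) t * kern z t) holomorphic_on ?U"
    "\<And>z. z \<in> ?U \<Longrightarrow> integrable \<rho> (\<lambda>t. indicator (- ?I) t * kern z t)" by (blast, blast)
  have T3: "T3 holomorphic_on ?U" unfolding T3_def by (rule T3p(1))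
  let ?qt = "\<lambda>t. complex_of_real t / (1 + (complex_of_real t)\<^sup>2) / G (complex_of_real t)"
  define c1 where "c1 = (LINT t|\<rho>. indicator ?I t * ?qt t)"
  define T1 where "T1 = (\<lambda>z. LINT t|\<rho>. indicator ?I t * (quot t z / G (complex_of_real t)))"
  obtain B where B: "0 \<le> B" "\<And>z. z \<in> cball 0 R \<Longrightarrow> norm (deriv G z) \<le> B"
  proof -
    have "deriv G holomorphic_on UNIV" by (rule holomorphic_deriv[OF holomorphic_G open_UNIV])
    then have "continuous_on (cball 0 R) (deriv G)"
      using holomorphic_on_imp_continuous_on continuous_on_subset by blast
    then have "bounded (deriv G ` cball 0 R)" by (intro compact_imp_bounded compact_continuous_image) auto
    then obtain B where B: "\<forall>y\<in>deriv G ` cball 0 R. norm y \<le> B" by (auto simp: bounded_iff)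
    have "norm (deriv G z) \<le> \<bar>B\<bar>" if "z \<in> cball 0 R" for z
    proof -
      have "norm (deriv G z) \<le> B" using B that by blast
      then show ?thesis by simp
    qed
    then show ?thesis using that[of "\<bar>B\<bar>"] by auto
  qed
  have quotB: "norm (quot t z) \<le> B" if t: "t \<in> ?I" and z: "z \<in> ?U" for t z
  proof (cases "z = complex_of_real t")
    case True
    then show ?thesis using B(2)[of z] t by (auto simp: quot_def)
  next
    case False
    have "norm (G z - G (complex_of_real t)) \<le> B * norm (z - complex_of_real t)"
    proof (rule field_differentiable_bound[OF convex_cball[of "0::complex" R]])
      fix y assume y: "y \<in> cball (0::complex) R"
      have "(G has_field_derivative deriv G y) (at y)"
        by (rule holomorphic_derivI[OF holomorphic_G[of UNIV] open_UNIV UNIV_I])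
      then show "(G has_field_derivative deriv G y) (at y within cball 0 R)"
        by (rule has_field_derivative_at_within)
      show "norm (deriv G y) \<le> B" by (rule B(2)[OF y])
    qed (use Un[OF z] t in \<open>auto simp: R_def\<close>)
    then show ?thesis using False by (simp add: quot_def norm_divide divide_le_eq)
  qed
  \<comment> \<open>On the bounded interval the factor \<open>1 + t\<^sup>2\<close> is at most
    \<open>1 + R\<^sup>2\<close>, so \<open>1 / G\<close> is dominated by a multiple of
    \<open>w0\<close>.\<close>
  have invG: "norm (1 / G (complex_of_real t)) \<le> (1 + R\<^sup>2) * w0 t" if t: "t \<in> ?I" for t
  proof -
    have "t\<^sup>2 \<le> R\<^sup>2" using t by (intro abs_le_square_iff[THEN iffD1]) auto
    then have "(1 + t\<^sup>2) * w0 t \<le> (1 + R\<^sup>2) * w0 t" using w0_nonneg by (intro mult_right_mono) auto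
    moreover have "(1 + t\<^sup>2) * w0 t = 1 / g t"
    proof -
      have "0 < 1 + t\<^sup>2" by (simp add: add_pos_nonneg)
      then have "1 + t\<^sup>2 \<noteq> 0" by simp
      then show ?thesis by (simp add: w0_def)
    qed
    moreover have "norm (1 / G (complex_of_real t)) = 1 / g t"
      using g_pos[of t] by (simp add: G_of_real norm_divide)
    ultimately show ?thesis by simp
  qed
  let ?w = "\<lambda>t. (B * (1 + R\<^sup>2)) * w0 t"
  have w: "integrable \<rho> ?w" by (intro integrable_mult_right integrable_w0)
  have b1: "norm (indicator ?I t * (quot t z / G (complex_of_real t))) \<le> ?w t" if z: "z \<in> ?U" for t z
  proof (cases "t \<in> ?I")
    case True
    have "norm (quot t z * (1 / G (complex_of_real t))) \<le> B * ((1 + R\<^sup>2) * w0 t)"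
      unfolding norm_mult using quotB[OF True z] invG[OF True] B(1) by (intro mult_mono) auto
    then show ?thesis using True by simp
  qed (use B(1) w0_nonneg in simp)
  have m1: "(\<lambda>t. indicator ?I t * (quot t z / G (complex_of_real t))) \<in> borel_measurable \<rho>" for z
    by (rule measurable_indicator_mult) (auto intro: borel_measurable_divide measurable_quot measurable_G)
  have T1: "T1 holomorphic_on ?U"
    unfolding T1_def
  proof (rule holomorphic_integral_param[OF open_ball m1 _ w b1])
    fix t
    have "G (complex_of_real t) \<noteq> 0" using g_pos[of t] by (simp add: G_of_real)
    then show "(\<lambda>z. indicator ?I t * (quot t z / G (complex_of_real t))) holomorphic_on ?U"
      by (intro holomorphic_intros holomorphic_quot)
  qed
  have i1: "integrable \<rho> (\<lambda>t. indicator ?I t * (quot t z / G (complex_of_real t)))" if "z \<in> ?U" for z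
    by (rule Bochner_Integration.integrable_bound[OF w m1])
       (use b1[OF that] in \<open>auto intro!: AE_I2 intro: order_trans[OF _ abs_ge_self]\<close>)
  \<comment> \<open>Inside \<open>{-R..R}\<close> the poles cancel and leave the divided difference
    \<open>T1\<close> together with the regularising term \<open>c1\<close>; outside, all of
    \<open>G K\<close> remains.\<close>
  define h where "h = (\<lambda>z. T1 z + G z * c1 - G z * T3 z)"
  have "h holomorphic_on ?U" unfolding h_def by (intro holomorphic_intros T1 T3 holomorphic_G)
  moreover have "stieltjes R z - G z * K z = h z" if z: "z \<in> ?U" "Im z \<noteq> 0" for z
  proof -
    let ?r = "\<lambda>t. 1 / (complex_of_real t - z)"
    have ne: "complex_of_real t \<noteq> z" for t using z(2) by auto
    have s: "integrable \<rho> (\<lambda>t. indicator ?I t * ?r t)" by (rule stieltjes_integrable[OF z(2)])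
    have k: "integrable \<rho> (kern z)" by (rule kern_nonreal[OF z(2)])
    have k3: "integrable \<rho> (\<lambda>t. indicator (- ?I) t * kern z t)" by (rule T3p(2)[OF z(1)])
    have k1: "integrable \<rho> (\<lambda>t. indicator ?I t * kern z t)"
    proof (rule Bochner_Integration.integrable_bound[OF k])
      show "(\<lambda>t. indicator ?I t * kern z t) \<in> borel_measurable \<rho>"
        by (rule measurable_indicator_mult[OF _ measurable_kern]) simp
    qed (auto simp: indicator_def)
    \<comment> \<open>The cancellation: \<open>1 / (t - z)\<close> minus
      \<open>G z / (G t * (t - z))\<close> is \<open>(G t - G z) / (t - z)\<close> divided by
      \<open>G t\<close>.\<close>
    have pt: "G z * (indicator ?I t * ?qt t) = indicator ?I t * ?r t - G z * (indicator ?I t * kern z t)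
        - indicator ?I t * (quot t z / G (complex_of_real t))" for t
    proof -
      have Gn: "G (complex_of_real t) \<noteq> 0" using g_pos[of t] by (simp add: G_of_real)
      have "quot t z = (G (complex_of_real t) - G z) * ?r t"
      proof -
        have "quot t z = (G z - G (complex_of_real t)) / (z - complex_of_real t)"
          using ne[of t] by (auto simp: quot_def)
        also have "\<dots> = (G (complex_of_real t) - G z) / (complex_of_real t - z)"
          by (metis minus_diff_eq minus_divide_divide)
        finally show ?thesis by simp
      qed
      then have "quot t z / G (complex_of_real t)
          = (G (complex_of_real t) * ?r t) / G (complex_of_real t) - (G z * ?r t) / G (complex_of_real t)"
        by (simp only: left_diff_distrib diff_divide_distrib)
      also have "(G (complex_of_real t) * ?r t) / G (complex_of_real t) = ?r t"
        using Gn by (rule nonzero_mult_div_cancel_left)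
      also have "(G z * ?r t) / G (complex_of_real t) = G z * (?r t / G (complex_of_real t))"
        by (rule times_divide_eq_right[symmetric])
      finally have "quot t z / G (complex_of_real t) = ?r t - G z * (?r t / G (complex_of_real t))" .
      moreover have "kern z t = ?r t / G (complex_of_real t) - ?qt t"
        by (simp add: kern_def diff_divide_distrib)
      ultimately show ?thesis by (cases "t \<in> ?I") (simp_all add: right_diff_distrib)
    qed
    have "G z * c1 = (LINT t|\<rho>. G z * (indicator ?I t * ?qt t))"
      unfolding c1_def by (rule integral_mult_right_zero[symmetric])
    also have "\<dots> = (LINT t|\<rho>. indicator ?I t * ?r t - G z * (indicator ?I t * kern z t)
        - indicator ?I t * (quot t z / G (complex_of_real t)))" by (simp only: pt)
    also have "\<dots> = (LINT t|\<rho>. indicator ?I t * ?r t - G z * (indicator ?I t * kern z t)) - T1 z"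
      unfolding T1_def
      by (rule Bochner_Integration.integral_diff[OF Bochner_Integration.integrable_diff[OF s integrable_mult_right[OF k1]] i1[OF z(1)]])
    also have "(LINT t|\<rho>. indicator ?I t * ?r t - G z * (indicator ?I t * kern z t))
      = stieltjes R z - G z * (LINT t|\<rho>. indicator ?I t * kern z t)"
      unfolding stieltjes_def
      by (subst Bochner_Integration.integral_diff[OF s integrable_mult_right[OF k1]]) simp
    finally have A: "G z * c1 = stieltjes R z - G z * (LINT t|\<rho>. indicator ?I t * kern z t) - T1 z" .
    have "K z = (LINT t|\<rho>. indicator ?I t * kern z t + indicator (- ?I) t * kern z t)"
      unfolding K_def by (rule Bochner_Integration.integral_cong[OF refl]) (auto simp: indicator_def)
    also have "\<dots> = (LINT t|\<rho>. indicator ?I t * kern z t) + T3 z"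
      unfolding T3_def by (rule Bochner_Integration.integral_add[OF k1 k3])
    finally have "K z = (LINT t|\<rho>. indicator ?I t * kern z t) + T3 z" .
    then show ?thesis unfolding h_def using A by (simp add: algebra_simps)
  qed
  ultimately show ?thesis by blast
qed

end

section \<open>Gaps of the spectrum and assembly of the representation\<close>

context weighted_weyl_measure
begin

text \<open>On a real interval where \<open>M\<close> is analytic and real, the limit formula gives \<open>\<rho>\<close> no mass.\<close>

lemma null_interval:
  fixes x :: real
  assumes \<Omega>: "open \<Omega>" "complex_of_real x \<in> \<Omega>" and hol: "M holomorphic_on \<Omega>"
    and sym: "\<And>z. z \<in> \<Omega> \<Longrightarrow> M (cnj z) = cnj (M z)"
  shows "\<exists>\<eta>>0. emeasure \<rho> {x - \<eta>..x + \<eta>} = 0"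
proof -
  obtain r where r: "0 < r" "ball (complex_of_real x) r \<subseteq> \<Omega>"
    using \<Omega> by (meson open_contains_ball)
  \<comment> \<open>A quarter, so that the closed disc of radius \<open>2 * \<eta>\<close> lies in
    \<Omega> and \<open>M\<close> is bounded on it.\<close>
  define \<eta> where "\<eta> = r / 4"
  have eta: "0 < \<eta>" using r by (simp add: \<eta>_def)
  let ?c = "cball (complex_of_real x) (2 * \<eta>)"
  have sub: "?c \<subseteq> \<Omega>" using r by (auto simp: \<eta>_def)
  have contM: "continuous_on \<Omega> M" by (rule holomorphic_on_imp_continuous_on[OF hol])
  have "bounded (M ` ?c)"
    using continuous_on_subset[OF contM sub] by (intro compact_imp_bounded compact_continuous_image) auto
  then obtain B where B: "\<forall>y\<in>M ` ?c. norm y \<le> B" by (auto simp: bounded_iff)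
  define eps where "eps = (\<lambda>n::nat. \<eta> * inverse (real (Suc (Suc n))))"
  have eps: "0 < eps n" "eps n < \<eta>" for n
  proof -
    have "inverse (real (Suc (Suc n))) < 1" by (rule inverse_less_1_iff[THEN iffD2]) simp
    from mult_strict_left_mono[OF this eta] show "eps n < \<eta>" unfolding eps_def by simp
    show "0 < eps n" using eta by (simp add: eps_def)
  qed
  have epslim: "eps \<longlonglongrightarrow> 0"
    unfolding eps_def by (rule tendsto_mult_right_zero[OF LIMSEQ_Suc[OF LIMSEQ_inverse_real_of_nat]])
  have "eps n \<noteq> 0" for n using eps(1)[of n] by simp
  then have epsr: "filterlim eps (at_right 0) sequentially"
    using eps epslim by (simp add: filterlim_at)
  let ?s = "x - \<eta>" and ?t = "x + \<eta>"
  have inc: "Complex l y \<in> ?c" if "l \<in> {?s..?t}" "\<bar>y\<bar> \<le> \<eta>" for l y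
  proof -
    have "norm (Complex l y - complex_of_real x) \<le> \<bar>l - x\<bar> + \<bar>y\<bar>"
      using cmod_le[of "Complex l y - complex_of_real x"] by simp
    moreover have "\<bar>l - x\<bar> \<le> \<eta>" using that(1) by auto
    ultimately show ?thesis using that(2) by (simp add: dist_norm norm_minus_commute)
  qed
  \<comment> \<open>\<open>Im M\<close> tends pointwise to its value 0 on the axis; boundedness on
    the compact disc permits dominated convergence.\<close>
  have "(\<lambda>n. integral {?s..?t} (\<lambda>l. Im (M (Complex l (eps n))))) \<longlonglongrightarrow> integral {?s..?t} (\<lambda>l. 0)"
  proof (rule dominated_convergence(2)[where h="\<lambda>_. B"])
    fix n
    have "continuous_on {?s..?t} (\<lambda>l. M (Complex l (eps n)))"
    proof (rule continuous_on_compose2[OF continuous_on_subset[OF contM sub]])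
      show "continuous_on {?s..?t} (\<lambda>l. Complex l (eps n))"
        unfolding Complex_eq by (intro continuous_intros)
      show "(\<lambda>l. Complex l (eps n)) ` {?s..?t} \<subseteq> ?c"
        using inc[OF _ less_imp_le] eps[of n] by (auto simp: abs_of_pos)
    qed
    then show "(\<lambda>l. Im (M (Complex l (eps n)))) integrable_on {?s..?t}"
      by (intro integrable_continuous_real continuous_on_Im)
    fix l assume l: "l \<in> {?s..?t}"
    have "Complex l (eps n) \<in> ?c" using inc[OF l, of "eps n"] eps[of n] by simp
    then have "norm (M (Complex l (eps n))) \<le> B" using B by blast
    then show "norm (Im (M (Complex l (eps n)))) \<le> B"
      using abs_Im_le_cmod[of "M (Complex l (eps n))"] by simp
  next
    fix l assume l: "l \<in> {?s..?t}"
    have z: "Complex l 0 \<in> \<Omega>" using inc[OF l, of 0] eta sub by auto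
    have "cnj (Complex l 0) = Complex l 0" by (simp add: complex_eq_iff)
    then have "Im (M (Complex l 0)) = 0"
      using sym[OF z] by (metis cnj.sel(2) neg_equal_zero)
    moreover have "(\<lambda>n. Complex l (eps n)) \<longlonglongrightarrow> Complex l 0"
      by (intro tendsto_Complex tendsto_const epslim)
    moreover have "isCont M (Complex l 0)"
      using contM z \<Omega>(1) by (simp add: continuous_on_eq_continuous_at)
    ultimately show "(\<lambda>n. Im (M (Complex l (eps n)))) \<longlonglongrightarrow> 0"
      using tendsto_Im[OF isCont_tendsto_compose] by metis
  qed (rule integrable_const_ivl)
  then have "(\<lambda>n. 1 / pi * integral {?s..?t} (\<lambda>l. Im (M (Complex l (eps n))))) \<longlonglongrightarrow> 1 / pi * 0"
    by (intro tendsto_mult tendsto_const) simp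
  moreover have "(\<lambda>n. 1 / pi * integral {?s..?t} (\<lambda>l. Im (M (Complex l (eps n)))))
      \<longlonglongrightarrow> (measure \<rho> {?s<..<?t} + measure \<rho> {?s..?t}) / 2"
    by (rule filterlim_compose[OF rho_limit epsr]) (use eta in simp)
  ultimately have "(measure \<rho> {?s<..<?t} + measure \<rho> {?s..?t}) / 2 = 1 / pi * 0"
    using LIMSEQ_unique by blast
  then have "measure \<rho> {?s<..<?t} + measure \<rho> {?s..?t} = 0" by simp
  then have "measure \<rho> {?s..?t} = 0" by (simp only: add_nonneg_eq_0_iff measure_nonneg)
  then have "emeasure \<rho> {?s..?t} = 0"
    using finite_rho[of ?s ?t] by (simp add: emeasure_eq_ennreal_measure)
  then show ?thesis using eta by blast
qed

text \<open>At a real \<open>z\<close> the kernel has its pole at \<open>t = z\<close>, where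
  division by zero merely assigns a default value. As a whole neighbourhood is a null set, the
  kernel may be cut off there, and \<open>kern_param\<close> gives integrability and
  continuity.\<close>

lemma K_real_gap:
  fixes x :: real
  assumes eta: "0 < \<eta>" and null: "emeasure \<rho> {x - \<eta>..x + \<eta>} = 0"
  shows "integrable \<rho> (kern (complex_of_real x))" and "isCont K (complex_of_real x)"
proof -
  let ?A = "- {x - \<eta>..x + \<eta>}" and ?z = "complex_of_real x"
  let ?U = "ball ?z (\<eta> / 2)"
  have far: "\<eta> / 2 \<le> norm (complex_of_real t - y)" if t: "t \<in> ?A" and y: "y \<in> ?U" for t y
  proof -
    have "\<eta> < \<bar>t - x\<bar>" using t by auto
    also have "\<bar>t - x\<bar> = norm ((complex_of_real t - y) + (y - ?z))" by (simp flip: of_real_diff)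
    also have "\<dots> \<le> norm (complex_of_real t - y) + norm (y - ?z)" by (rule norm_triangle_ineq)
    finally show ?thesis using y by (simp add: dist_norm norm_minus_commute)
  qed
  have B: "norm y \<le> norm ?z + \<eta>" if "y \<in> ?U" for y
    using that norm_triangle_sub[of y ?z] eta by (simp add: dist_norm norm_minus_commute)
  have A: "?A \<in> sets borel" by measurable
  have pos: "0 < \<eta> / 2" using eta by simp
  from kern_param[OF A open_ball ballI[OF B] pos ballI[OF ballI[OF far]]]
  have kp: "(\<lambda>z. LINT t|\<rho>. indicator ?A t * kern z t) holomorphic_on ?U"
    "\<And>z. z \<in> ?U \<Longrightarrow> integrable \<rho> (\<lambda>t. indicator ?A t * kern z t)" by (blast, blast)
  have "{x - \<eta>..x + \<eta>} \<in> null_sets \<rho>" using null by (intro null_setsI) (auto simp: sets_rho)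
  then have ae: "AE t in \<rho>. t \<notin> {x - \<eta>..x + \<eta>}" by (rule AE_not_in)
  have eq: "AE t in \<rho>. kern z t = indicator ?A t * kern z t" for z
    using ae by eventually_elim auto
  have m: "(\<lambda>t. indicator ?A t * kern z t) \<in> borel_measurable \<rho>" "kern z \<in> borel_measurable \<rho>" for z
    using measurable_indicator_mult[OF A measurable_kern] measurable_rho[OF measurable_kern] by auto
  have zU: "?z \<in> ?U" using eta by simp
  show "integrable \<rho> (kern ?z)"
    using kp(2)[OF zU] integrable_cong_AE[OF m(2,1) eq] by blast
  have "K = (\<lambda>z. LINT t|\<rho>. indicator ?A t * kern z t)"
    unfolding K_def by (rule ext) (rule integral_cong_AE[OF m(2,1) eq])
  with kp(1) have "K holomorphic_on ?U" by simp
  then have "continuous_on ?U K" by (rule holomorphic_on_imp_continuous_on)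
  then show "isCont K ?z" using zU by (simp add: continuous_on_eq_continuous_at)
qed

text \<open>Off the real axis \<open>E\<close> is forced to be \<open>M - G K\<close>; once this is
  known to extend, the real points of \<Omega> follow because both sides of the formula are
  continuous there.\<close>

theorem representation:
  assumes \<Omega>: "open \<Omega>" "\<And>z. Im z \<noteq> 0 \<Longrightarrow> z \<in> \<Omega>" and hol: "M holomorphic_on \<Omega>"
    and sym: "\<And>z. z \<in> \<Omega> \<Longrightarrow> M (cnj z) = cnj (M z)"
    and loc: "\<And>x::real. \<exists>d>0. \<exists>C\<ge>0. \<forall>z. dist z (complex_of_real x) < d \<longrightarrow> 0 < Im z \<longrightarrow>
      norm (M z) \<le> C / Im z \<and> - C \<le> Im (M z)"
  shows "\<exists>E. real_entire E \<and> (\<forall>z\<in>\<Omega>. integrable \<rho> (kern z) \<and> M z = E z + G z * K z)"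
proof -
  define E0 where "E0 = (\<lambda>z. M z - G z * K z)"
  have "K holomorphic_on {z. Im z \<noteq> 0}"
    unfolding holomorphic_on_def using kern_nonreal(2) by (auto intro: field_differentiable_at_within)
  then have hol0: "E0 holomorphic_on {z. Im z \<noteq> 0}"
    unfolding E0_def using \<Omega>(2)
    by (intro holomorphic_on_diff holomorphic_on_mult holomorphic_G holomorphic_on_subset[OF hol]) auto
  have "\<exists>e r. 0 < r \<and> e holomorphic_on ball (complex_of_real x) r \<and>
      (\<forall>z\<in>ball (complex_of_real x) r. Im z \<noteq> 0 \<longrightarrow> e z = E0 z)" for x :: real
  proof -
    let ?R = "\<bar>x\<bar> + 2"
    obtain d C where dC: "0 < d" "0 \<le> C" "\<And>z. dist z (complex_of_real x) < d \<Longrightarrow> 0 < Im z \<Longrightarrow>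
      norm (M z) \<le> C / Im z \<and> - C \<le> Im (M z)" using loc[of x] by blast
    have up: "M holomorphic_on {z. 0 < Im z}" by (rule holomorphic_on_subset[OF hol]) (use \<Omega>(2) in auto)
    have ex: "\<exists>e r. 0 < r \<and> e holomorphic_on ball (complex_of_real x) r \<and>
      (\<forall>z\<in>ball (complex_of_real x) r. Im z \<noteq> 0 \<longrightarrow> e z = M z - stieltjes ?R z)"
    proof (rule local_extension)
      show "M holomorphic_on {z. 0 < Im z}" by (rule up)
      show "M (cnj z) = cnj (M z)" if "Im z \<noteq> 0" for z using sym[OF \<Omega>(2)[OF that]] .
      show "0 < d" "0 \<le> C" by (rule dC)+
      show "norm (M z) \<le> C / Im z \<and> - C \<le> Im (M z)"
        if "dist z (complex_of_real x) < d" "0 < Im z" for z using dC(3)[OF that] .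
      show "\<bar>x\<bar> < ?R" by simp
    qed
    obtain e r where e: "0 < r" "e holomorphic_on ball (complex_of_real x) r"
      "\<And>z. z \<in> ball (complex_of_real x) r \<Longrightarrow> Im z \<noteq> 0 \<Longrightarrow> e z = M z - stieltjes ?R z"
      using ex by blast
    obtain h where h: "h holomorphic_on ball (complex_of_real x) 1"
      "\<And>z. z \<in> ball (complex_of_real x) 1 \<Longrightarrow> Im z \<noteq> 0 \<Longrightarrow> stieltjes ?R z - G z * K z = h z"
      using stieltjes_minus_K[of x] by blast
    let ?r = "min r 1"
    \<comment> \<open>The transform of the truncated measure cancels: \<open>E0\<close> is the sum
      of \<open>M - stieltjes\<close> and \<open>stieltjes - G K\<close>, and each of them continues
      across the axis.\<close>
    have "(\<lambda>z. e z + h z) holomorphic_on ball (complex_of_real x) ?r"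
      by (intro holomorphic_on_add holomorphic_on_subset[OF e(2)] holomorphic_on_subset[OF h(1)]) auto
    moreover have "e z + h z = E0 z" if "z \<in> ball (complex_of_real x) ?r" "Im z \<noteq> 0" for z
      using e(3)[of z] h(2)[of z] that by (auto simp: E0_def diff_eq_eq)
    moreover have "0 < ?r" using e(1) by simp
    ultimately show ?thesis by (intro exI[of _ "\<lambda>z. e z + h z"] exI[of _ ?r]) blast
  qed
  from entire_glue[OF hol0 this] obtain E where E: "E holomorphic_on UNIV" "\<And>z. Im z \<noteq> 0 \<Longrightarrow> E z = E0 z"
    by blast
  have contE: "isCont E z" for z
    using holomorphic_on_imp_continuous_on[OF E(1)] by (simp add: continuous_on_eq_continuous_at)
  have "real_entire E"
    unfolding real_entire_def
  proof (intro conjI allI E(1))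
    fix t :: real
    let ?z = "complex_of_real t"
    have "E ?z = cnj (E (cnj ?z))"
    proof (rule isCont_eq_off_real_axis[OF contE _ zero_less_one])
      show "isCont (\<lambda>z. cnj (E (cnj z))) ?z"
        by (intro continuous_intros isCont_o2[OF _ contE])
      show "E y = cnj (E (cnj y))" if "Im y \<noteq> 0" for y
        using that \<Omega>(2)[of y] by (simp add: E(2) E0_def sym G_cnj K_cnj)
    qed simp
    then show "E ?z \<in> \<real>" by (simp add: Reals_cnj_iff)
  qed
  moreover have "integrable \<rho> (kern z) \<and> M z = E z + G z * K z" if z: "z \<in> \<Omega>" for z
  proof (cases "Im z = 0")
    case False
    then show ?thesis using kern_nonreal(1)[OF False] E(2)[OF False] by (simp add: E0_def)
  next
    case True
    define x where "x = Re z"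
    have zx: "z = complex_of_real x" using True by (simp add: x_def complex_eq_iff)
    \<comment> \<open>A real point of \<Omega>, where \<open>M\<close> is analytic and symmetric,
      has a neighbourhood without mass.\<close>
    obtain \<eta> where eta: "0 < \<eta>" "emeasure \<rho> {x - \<eta>..x + \<eta>} = 0"
      using null_interval[OF \<Omega>(1) _ hol sym, of x] z zx by blast
    note gap = K_real_gap[OF eta]
    have "isCont M z"
      using holomorphic_on_imp_continuous_on[OF hol] z \<Omega>(1) by (simp add: continuous_on_eq_continuous_at)
    moreover have "isCont (\<lambda>z. E z + G z * K z) z"
      using contE gap(2) holomorphic_on_imp_continuous_on[OF holomorphic_G[of UNIV]] unfolding zx
      by (intro continuous_intros) (auto simp: continuous_on_eq_continuous_at)
    ultimately have "M z = E z + G z * K z"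
      by (rule isCont_eq_off_real_axis[OF _ _ zero_less_one]) (auto simp: E(2) E0_def True)
    then show ?thesis using gap(1) zx by simp
  qed
  ultimately show ?thesis by blast
qed

end

section \<open>Existence of a weight\<close>

context weyl_measure
begin

lemma weight_exists: "\<exists>g. sq_int_weight \<rho> g"
proof -
  define a where "a = (\<lambda>n. measure \<rho> {- (real n + 1)..real n + 1})"
  \<comment> \<open>The lower bound wanted for \<open>g t\<close> when
    \<open>n \<le> \<bar>t\<bar>\<close>: the summand \<open>a n\<close> beats the measure of the
    interval and the summand \<open>n\<close> makes the resulting series converge.\<close>
  define L where "L = (\<lambda>n. real n + a n)"
  \<comment> \<open>The part \<open>nat \<lceil>L n\<rceil>\<close> of the exponent offsets the
    coefficient \<open>L n\<close> for \<open>norm z \<le> n / 2\<close>, and the part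
    \<open>n\<close> leaves a geometric bound.\<close>
  define k where "k = (\<lambda>n. n + nat \<lceil>L n\<rceil>)"
  \<comment> \<open>The doubled exponent makes every term nonnegative on the real axis. The term
    \<open>n = 0\<close> is split off, since it must supply \<open>L 0\<close> everywhere, which a
    quotient by 0 would not give in general.\<close>
  define f where "f = (\<lambda>n z. if n = 0 then complex_of_real (L 0)
     else complex_of_real (L n) * (z / of_nat n) ^ (2 * k n))"
  have a0: "0 \<le> a n" for n by (simp add: a_def)
  have L0: "0 \<le> L n" for n using a0[of n] by (simp add: L_def)
  have small: "norm (f n z) \<le> (1/2)^n" if n: "n \<noteq> 0" "2 * norm z \<le> real n" for n z
  proof -
    have "norm (f n z) = L n * (norm z / real n) ^ (2 * k n)"
      using n(1) L0[of n] by (simp add: f_def norm_mult norm_power norm_divide)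
    also have "\<dots> \<le> L n * (1/2) ^ (2 * k n)"
      using n L0[of n] by (intro mult_left_mono power_mono) (auto simp: field_simps)
    also have "\<dots> \<le> L n * (1/2) ^ k n"
      using L0[of n] by (intro mult_left_mono power_decreasing) auto
    also have "\<dots> = (L n * (1/2) ^ nat \<lceil>L n\<rceil>) * (1/2)^n"
      by (simp add: k_def power_add)
    also have "\<dots> \<le> 1 * (1/2)^n"
    proof (intro mult_right_mono)
      let ?m = "nat \<lceil>L n\<rceil>"
      have "L n \<le> real ?m" by (rule real_nat_ceiling_ge)
      also have "\<dots> \<le> 2 ^ ?m" using of_nat_less_two_power[of ?m, where 'a=real] by linarith
      finally show "L n * (1/2) ^ ?m \<le> 1" by (simp add: power_divide divide_le_eq)
    qed simp
    finally show ?thesis by simp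
  qed
  have geo: "summable (\<lambda>n. (1/2::real)^n)" by (rule summable_geometric) simp
  define g where "g = (\<lambda>z. \<Sum>n. f n z)"
  have ev: "eventually (\<lambda>n. \<forall>z\<in>cball 0 B. norm (f n z) \<le> (1/2)^n) sequentially" for B
  proof -
    obtain N :: nat where N: "2 * B \<le> real N" using real_arch_simple by blast
    show ?thesis
    proof (rule eventually_sequentiallyI[of "Suc N"], rule ballI)
      fix n z assume "Suc N \<le> n" "z \<in> cball (0::complex) B"
      then show "norm (f n z) \<le> (1/2)^n" using N by (intro small) auto
    qed
  qed
  have unif: "uniform_limit (cball 0 B) (\<lambda>n z. \<Sum>i<n. f i z) g sequentially" for B
    unfolding g_def by (rule Weierstrass_m_test_ev[OF ev geo])
  have holf: "f n holomorphic_on UNIV" for n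
    unfolding f_def by (cases "n = 0") (auto intro!: holomorphic_intros)
  have holg: "g holomorphic_on UNIV"
  proof (rule holomorphic_uniform_sequence[OF open_UNIV])
    show "(\<lambda>z. \<Sum>i<n. f i z) holomorphic_on UNIV" for n by (intro holomorphic_on_sum holf)
    fix z :: complex
    have "cball z 1 \<subseteq> cball 0 (norm z + 1)"
    proof
      fix y assume "y \<in> cball z 1"
      then show "y \<in> cball 0 (norm z + 1)"
        using norm_triangle_sub[of y z] by (simp add: dist_norm norm_minus_commute)
    qed
    then have "uniform_limit (cball z 1) (\<lambda>n z. \<Sum>i<n. f i z) g sequentially"
      by (rule uniform_limit_on_subset[OF unif])
    then show "\<exists>d>0. cball z d \<subseteq> UNIV \<and> uniform_limit (cball z d) (\<lambda>n z. \<Sum>i<n. f i z) g sequentially"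
      by (intro exI[of _ 1]) simp
  qed
  have sums: "(\<lambda>n. f n z) sums g z" for z
    unfolding sums_def by (rule tendsto_uniform_limitI[OF unif[of "norm z"]]) simp
  have fre: "f n (complex_of_real t) = complex_of_real (Re (f n (complex_of_real t)))"
    "0 \<le> Re (f n (complex_of_real t))" for n t
  proof -
    have "f n (complex_of_real t) = complex_of_real (if n = 0 then L 0 else L n * (t / real n) ^ (2 * k n))"
      by (simp add: f_def)
    then have *: "f n (complex_of_real t) = complex_of_real (if n = 0 then L 0 else L n * ((t / real n) ^ k n)\<^sup>2)"
      by (simp only: power_mult mult.commute[of 2])
    then show "f n (complex_of_real t) = complex_of_real (Re (f n (complex_of_real t)))" by simp
    show "0 \<le> Re (f n (complex_of_real t))" unfolding * using L0 by simp
  qed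
  have resums: "(\<lambda>n. Re (f n (complex_of_real t))) sums Re (g (complex_of_real t))" for t
    by (rule sums_Re[OF sums])
  have ge: "Re (f n (complex_of_real t)) \<le> Re (g (complex_of_real t))" for n t
    using sum_le_suminf[OF sums_summable[OF resums], of "{n}" t] fre(2) sums_unique[OF resums[of t]] by simp
  have real: "g (complex_of_real t) \<in> \<real>" for t
  proof -
    have "(\<lambda>n. Im (f n (complex_of_real t))) sums Im (g (complex_of_real t))" by (rule sums_Im[OF sums])
    moreover have "Im (f n (complex_of_real t)) = 0" for n by (subst fre(1)) simp
    ultimately have "Im (g (complex_of_real t)) = 0" using sums_unique2[OF sums_zero, of "Im (g (complex_of_real t))"] by simp
    then show ?thesis by (simp add: complex_is_Real_iff)
  qed
  have nonneg: "0 \<le> Re (g (complex_of_real t))" for t using ge[of 0 t] fre(2)[of 0 t] by linarith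
  \<comment> \<open>All terms are nonnegative on the axis, so the single term of index
    \<open>n\<close>, whose base is at least 1 in absolute value, gives the bound.\<close>
  have low: "L n \<le> Re (g (complex_of_real t))" if "real n \<le> \<bar>t\<bar>" for n t
  proof (cases "n = 0")
    case True
    then show ?thesis using ge[of 0 t] by (simp add: f_def)
  next
    case False
    have "1 \<le> \<bar>t\<bar> / real n" using that False by simp
    then have "1 \<le> (\<bar>t\<bar> / real n) ^ (2 * k n)" by (rule one_le_power)
    also have "\<dots> = (t / real n) ^ (2 * k n)" by (simp add: power_divide power_even_abs)
    finally have "L n * 1 \<le> L n * (t / real n) ^ (2 * k n)" using L0 by (rule mult_left_mono)
    moreover have "Re (f n (complex_of_real t)) = L n * (t / real n) ^ (2 * k n)"
    proof -
      have "f n (complex_of_real t) = complex_of_real (L n * (t / real n) ^ (2 * k n))"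
        using False by (simp add: f_def)
      then show ?thesis by (simp only: Re_complex_of_real)
    qed
    ultimately show ?thesis using ge[of n t] by linarith
  qed
  have meas: "(\<lambda>t. exp (- g (complex_of_real t))) \<in> borel_measurable \<rho>"
  proof (rule measurable_rho, rule borel_measurable_continuous_onI)
    show "continuous_on UNIV (\<lambda>t. exp (- g (complex_of_real t)))"
      by (intro continuous_intros continuous_on_compose2[OF holomorphic_on_imp_continuous_on[OF holg]]) auto
  qed
  let ?F = "\<lambda>t. (norm (exp (- g (complex_of_real t))))\<^sup>2"
  let ?S = "\<lambda>n. {- (real n + 1)..real n + 1}"
  \<comment> \<open>Nested intervals are used instead of shells: the term with
    \<open>n = nat \<lfloor>\<bar>t\<bar>\<rfloor>\<close> already dominates, and counting the
    others too does not disturb summability.\<close>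
  have Fle: "ennreal (?F t) \<le> (\<Sum>n. ennreal (exp (- 2 * L n)) * indicator (?S n) t)" for t
  proof -
    define n where "n = nat \<lfloor>\<bar>t\<bar>\<rfloor>"
    have n: "real n \<le> \<bar>t\<bar>" "\<bar>t\<bar> \<le> real n + 1"
      unfolding n_def using of_int_floor_le[of "\<bar>t\<bar>"] floor_correct[of "\<bar>t\<bar>"] by auto
    have "?F t = exp (- 2 * Re (g (complex_of_real t)))"
      by (simp add: norm_exp_eq_Re exp_double[symmetric] power2_eq_square exp_add[symmetric])
    also have "\<dots> \<le> exp (- 2 * L n)" using low[OF n(1)] by simp
    finally have "ennreal (?F t) \<le> ennreal (exp (- 2 * L n))" by (rule ennreal_leI)
    also have "\<dots> = ennreal (exp (- 2 * L n)) * indicator (?S n) t"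
      using n(2) by (auto simp: indicator_def)
    also have "\<dots> \<le> (\<Sum>n. ennreal (exp (- 2 * L n)) * indicator (?S n) t)"
    proof -
      let ?f = "\<lambda>n. ennreal (exp (- 2 * L n)) * indicator (?S n) t"
      have "sum ?f {n} \<le> suminf ?f" by (rule sum_le_suminf) (rule summableI, rule finite.intros, rule finite.intros, rule zero_le)
      then show ?thesis by (simp only: sum.insert finite.emptyI empty_iff sum.empty add_0_right not_False_eq_True)
    qed
    finally show ?thesis .
  qed
  have "(\<integral>\<^sup>+t. ennreal (?F t) \<partial>\<rho>) \<le> (\<integral>\<^sup>+t. (\<Sum>n. ennreal (exp (- 2 * L n)) * indicator (?S n) t) \<partial>\<rho>)"
    by (intro nn_integral_mono Fle)
  also have "\<dots> = (\<Sum>n. \<integral>\<^sup>+t. ennreal (exp (- 2 * L n)) * indicator (?S n) t \<partial>\<rho>)"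
    by (rule nn_integral_suminf) (auto simp: sets_rho)
  also have "\<dots> = (\<Sum>n. ennreal (exp (- 2 * L n)) * emeasure \<rho> (?S n))"
    by (subst nn_integral_cmult_indicator) (auto simp: sets_rho)
  also have "\<dots> \<le> (\<Sum>n. ennreal (exp (-2) ^ n))"
  proof (rule suminf_le)
    fix n
    have "emeasure \<rho> (?S n) = ennreal (a n)"
      unfolding a_def using finite_rho[of "- (real n + 1)" "real n + 1"] by (intro emeasure_eq_ennreal_measure) auto
    then have "ennreal (exp (- 2 * L n)) * emeasure \<rho> (?S n) = ennreal (exp (- 2 * L n) * a n)"
      using a0[of n] by (simp add: ennreal_mult)
    also have "exp (- 2 * L n) * a n \<le> exp (-2) ^ n"
    proof -
      \<comment> \<open>The two summands of \<open>L n\<close> separate: one becomes the geometric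
        factor, the other meets \<open>a n\<close> in a quotient bounded by 1.\<close>
      have "exp (- 2 * L n) * a n = exp (-2) ^ n * (a n / exp (2 * a n))"
        by (simp add: L_def exp_of_nat_mult[symmetric] exp_minus exp_add[symmetric] divide_inverse algebra_simps
            flip: exp_minus)
      also have "a n / exp (2 * a n) \<le> 1"
        using order_trans[OF _ exp_ge_add_one_self[of "2 * a n"], of "a n"] a0[of n] by (simp add: divide_le_eq)
      finally show ?thesis by (simp add: mult_left_mono)
    qed
    finally show "ennreal (exp (- 2 * L n)) * emeasure \<rho> (?S n) \<le> ennreal (exp (-2) ^ n)"
      by (simp add: ennreal_leI)
  qed auto
  also have "\<dots> < \<infinity>"
    by (subst suminf_ennreal2) (auto intro!: summable_geometric)
  finally have fin: "(\<integral>\<^sup>+t. ennreal (?F t) \<partial>\<rho>) < \<infinity>" .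
  have "integrable \<rho> ?F"
  proof (rule integrableI_bounded)
    show "?F \<in> borel_measurable \<rho>" by (intro borel_measurable_power measurable_compose[OF meas borel_measurable_norm])
    show "(\<integral>\<^sup>+t. ennreal (norm (?F t)) \<partial>\<rho>) < \<infinity>" using fin by simp
  qed
  then have "sq_int_weight \<rho> g"
    unfolding sq_int_weight_def square_integrable_def using holg real nonneg meas by blast
  then show ?thesis by blast
qed

text \<open>On the real axis \<open>1 / exp (2 g)\<close> is the square of \<open>exp (- g)\<close>,
  and the factor \<open>1 + t\<^sup>2 \<ge> 1\<close> can only help.\<close>

lemma exp_weight_admissible:
  assumes "sq_int_weight \<rho> g"
  shows "admissible_weight \<rho> (\<lambda>z. exp (2 * g z))"
  unfolding admissible_weight_def
proof (intro conjI allI)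
  have hol: "g holomorphic_on UNIV" and real: "\<And>t::real. g (complex_of_real t) \<in> \<real>"
    and sq: "square_integrable \<rho> (\<lambda>t. exp (- g (complex_of_real t)))"
    using assms by (auto simp: sq_int_weight_def)
  show "(\<lambda>z. exp (2 * g z)) holomorphic_on UNIV" by (intro holomorphic_intros hol)
  have gr: "g (complex_of_real t) = complex_of_real (Re (g (complex_of_real t)))" for t
    using real[of t] by (simp add: complex_is_Real_iff complex_eq_iff)
  have ge: "exp (2 * g (complex_of_real t)) = complex_of_real (exp (2 * Re (g (complex_of_real t))))" for t
    by (subst gr) (simp flip: exp_of_real)
  show "exp (2 * g (complex_of_real t)) \<in> \<real>" "0 < Re (exp (2 * g (complex_of_real t)))" for t
    unfolding ge by simp_all
  show "integrable \<rho> (\<lambda>t. 1 / ((1 + (complex_of_real t)\<^sup>2) * exp (2 * g (complex_of_real t))))"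
  proof (rule Bochner_Integration.integrable_bound)
    show "integrable \<rho> (\<lambda>t. (norm (exp (- g (complex_of_real t))))\<^sup>2)"
      using sq by (simp add: square_integrable_def)
    have "(\<lambda>t. exp (2 * g (complex_of_real t))) \<in> borel_measurable borel"
    proof (rule borel_measurable_continuous_onI)
      show "continuous_on UNIV (\<lambda>t. exp (2 * g (complex_of_real t)))"
        by (intro continuous_intros continuous_on_compose2[OF holomorphic_on_imp_continuous_on[OF hol]]) auto
    qed
    moreover have "(\<lambda>t. 1 + (complex_of_real t)\<^sup>2) \<in> borel_measurable borel" by measurable
    ultimately show "(\<lambda>t. 1 / ((1 + (complex_of_real t)\<^sup>2) * exp (2 * g (complex_of_real t)))) \<in> borel_measurable \<rho>"
      by (intro measurable_rho borel_measurable_divide borel_measurable_times borel_measurable_const)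
    show "AE t in \<rho>. norm (1 / ((1 + (complex_of_real t)\<^sup>2) * exp (2 * g (complex_of_real t))))
        \<le> norm ((norm (exp (- g (complex_of_real t))))\<^sup>2)"
    proof (rule AE_I2)
      fix t :: real
      let ?e = "exp (2 * Re (g (complex_of_real t)))"
      have "1 / ((1 + (complex_of_real t)\<^sup>2) * exp (2 * g (complex_of_real t))) = complex_of_real (1 / ((1 + t\<^sup>2) * ?e))"
        unfolding ge by simp
      then have "norm (1 / ((1 + (complex_of_real t)\<^sup>2) * exp (2 * g (complex_of_real t)))) = \<bar>1 / ((1 + t\<^sup>2) * ?e)\<bar>"
        by (simp only: norm_of_real)
      also have "\<dots> = 1 / ((1 + t\<^sup>2) * ?e)" by (simp add: add_nonneg_nonneg)
      also have "\<dots> \<le> 1 / (1 * ?e)"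
        by (intro divide_left_mono mult_right_mono mult_pos_pos) (auto simp: add_pos_nonneg)
      also have "\<dots> = (norm (exp (- g (complex_of_real t))))\<^sup>2"
        by (simp only: norm_exp_eq_Re uminus_complex.sel exp_minus exp_double power_inverse norm_inverse divide_inverse mult_1_left)
      finally show "norm (1 / ((1 + (complex_of_real t)\<^sup>2) * exp (2 * g (complex_of_real t))))
        \<le> norm ((norm (exp (- g (complex_of_real t))))\<^sup>2)" by simp
    qed
  qed
qed

end

section \<open>The integral representation\<close>

text \<open>Integrability of the kernel is asserted along with the formula: the integral of a
  non-integrable function is 0 by default, so the equation alone would not express
  convergence.\<close>

theorem theorem4p1:
  fixes a b :: ereal
    and q :: "real \<Rightarrow> real"
    and v w :: "real \<Rightarrow> complex"
    and H :: "real operator"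
    and \<phi> \<theta> :: "complex \<Rightarrow> real \<Rightarrow> complex"
    and M :: "complex \<Rightarrow> complex"
    and \<rho> :: "real measure"
  assumes "a < b"
    and "locally_integrable a b q"
    and "bc_function_left a b q v"
    and "bc_function_right a b q w"
    and "H = sl_operator a b q v w"
    and "self_adjoint_operator (lebesgue_ival a b) H"
    and "\<exists>c. a < ereal c \<and> ereal c < b \<and>
           purely_discrete_spectrum (lebesgue_ival a (ereal c)) (sl_dirichlet a b q v c)"
    and "entire_system a b q v \<phi> \<theta>"
    and "singular_weyl_function a b q w H \<phi> \<theta> M"
    and "weyl_spectral_measure M \<rho>"
  shows "(\<exists>g. sq_int_weight \<rho> g) \<and>
         (\<forall>g. sq_int_weight \<rho> g \<longrightarrow> admissible_weight \<rho> (\<lambda>z. exp (2 * g z))) \<and>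
         (\<forall>G. admissible_weight \<rho> G \<longrightarrow>
           (\<exists>E. real_entire E \<and>
             (\<forall>z. z \<notin> op_spectrum (lebesgue_ival a b) H \<longrightarrow>
               integrable \<rho> (\<lambda>t. (1 / (complex_of_real t - z)
                   - complex_of_real t / (1 + (complex_of_real t)\<^sup>2)) / G (complex_of_real t)) \<and>
               M z = E z + G z * (LINT t|\<rho>. (1 / (complex_of_real t - z)
                   - complex_of_real t / (1 + (complex_of_real t)\<^sup>2)) / G (complex_of_real t)))))"
proof (intro conjI allI impI)
  interpret S: weyl_system a b q v w H \<phi> \<theta> M
    using assms(1,5,6,8,9) by (rule weyl_system.intro)
  interpret weyl_measure M \<rho>
    using assms(10) by (rule weyl_measure.intro)
  show "\<exists>g. sq_int_weight \<rho> g" by (rule weight_exists)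
  show "admissible_weight \<rho> (\<lambda>z. exp (2 * g z))" if "sq_int_weight \<rho> g" for g
    by (rule exp_weight_admissible[OF that])
  fix G assume G: "admissible_weight \<rho> G"
  interpret W: weighted_weyl_measure M \<rho> G
    using G by unfold_locales
  have "\<exists>E. real_entire E \<and> (\<forall>z\<in>S.R. integrable \<rho> (W.kern z) \<and> M z = E z + G z * W.K z)"
  proof (rule W.representation)
    show "open S.R" by (rule self_adjoint_resolvent_open[OF S.sa])
    show "z \<in> S.R" if "Im z \<noteq> 0" for z using S.nonreal_in_R[OF that] .
    show "M holomorphic_on S.R" by (rule S.holomorphic_M)
    show "M (cnj z) = cnj (M z)" if "z \<in> S.R" for z using S.M_cnj[OF that] .
    show "\<exists>d>0. \<exists>C\<ge>0. \<forall>z. dist z (complex_of_real x) < d \<longrightarrow> 0 < Im z \<longrightarrow>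
        norm (M z) \<le> C / Im z \<and> - C \<le> Im (M z)" for x
      by (rule S.M_local_bound[of x]) blast
  qed
  moreover have kern: "W.kern z = (\<lambda>t. (1 / (complex_of_real t - z)
      - complex_of_real t / (1 + (complex_of_real t)\<^sup>2)) / G (complex_of_real t))" for z
    by (rule ext) (rule W.kern_def)
  ultimately show "\<exists>E. real_entire E \<and>
      (\<forall>z. z \<notin> op_spectrum S.\<mu> H \<longrightarrow>
        integrable \<rho> (\<lambda>t. (1 / (complex_of_real t - z)
            - complex_of_real t / (1 + (complex_of_real t)\<^sup>2)) / G (complex_of_real t)) \<and>
        M z = E z + G z * (LINT t|\<rho>. (1 / (complex_of_real t - z)
            - complex_of_real t / (1 + (complex_of_real t)\<^sup>2)) / G (complex_of_real t)))"
    by (simp add: W.K_def op_spectrum_def kern Ball_def)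
qed

end
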